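(* Let $n\ge1$ and $0<y_n<r$. Conditioned on the event $\mathcal{E}_n$, on $Y_n=y_n$ and on the serving distance $R=r$, the number $N_l\big(b(o,r)\setminus b(o,y_n)\big)$ of lines of $\Phi_l$ whose distance from the origin is larger than $y_n$ and smaller than $r$ has probability mass function, for $k=0,1,2,\dots$, $$\mathbb{P}\Big(N_l\big(b(o,r)\setminus b(o,y_n)\big)=k\,\Big|\,\mathcal{E}_n,Y_n=y_n,R=r\Big)=\exp\Big(-2\pi\lambda_l\int_{y_n}^r e^{-2\lambda_v\sqrt{r^2-y^2}}\,\mathrm{d}y\Big)\,\frac{\Big(2\pi\lambda_l\int_{y_n}^r e^{-2\lambda_v\sqrt{r^2-y^2}}\,\mathrm{d}y\Big)^k}{k!}.$$
   Context: Fix $\lambda_l,\lambda_v>0$. An undirected line in $\mathbb{R}^2$ is described by $(\theta,\rho)\in[0,2\pi)\times[0,\infty)$, where $\rho$ is its perpendicular distance from the origin $o$ and $\theta$ the angle of the perpendicular with the positive $x$-axis. $\Phi_l$ is the Poisson line process whose $(\theta,\rho)$ points form a homogeneous Poisson point process (PPP) of intensity $\lambda_l$ on $[0,2\pi)\times[0,\infty)$. $L_0$ (the typical line) is an additional line through $o$. For $i\ge1$, $L_i$ is the $i$-th closest line of $\Phi_l$ to $o$ and $Y_i$ its perpendicular distance from $o$. Given the lines, each line of $\Phi_l\cup\{L_0\}$ carries an independent homogeneous 1D PPP of intensity $\lambda_v$, whose points are called nodes. The typical receiver is at $o$ and is served by the node nearest to $o$ (on any line); $R$ is its distance from $o$;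 $\mathcal{E}_n$ is the event that the serving node lies on $L_n$. $b(o,t)$ is the disc of radius $t$ about $o$; $N_l(b(o,r)\setminus b(o,y_n))$ counts the lines intersecting $b(o,r)$ but not intersecting $b(o,y_n)$. *)

theory Defs
  imports "HOL-Probability.Probability"
begin

section \<open>Homogeneous Poisson point processes\<close>

text \<open>
  A homogeneous Poisson process has no multiple points, so realisations are modelled as
  locally finite sets. The measurable sets of configurations are generated by the counts in bounded
  Borel sets.
\<close>

definition locally_finite :: "'a::metric_space set \<Rightarrow> bool" where
  "locally_finite C \<longleftrightarrow> (\<forall>K. bounded K \<longrightarrow> finite (C \<inter> K))"

definition configs :: "'a::euclidean_space set measure" where
  "configs = sigma {C. locally_finite C}
     {{C. locally_finite C \<and> card (C \<inter> B) = k} | B k. bounded B \<and> B \<in> sets borel}"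

definition homogeneous_PPP ::
    "'w measure \<Rightarrow> real \<Rightarrow> 'a::euclidean_space set \<Rightarrow> ('w \<Rightarrow> 'a set) \<Rightarrow> bool" where
  "homogeneous_PPP M intensity S X \<longleftrightarrow>
     X \<in> measurable M configs \<and>
     (\<forall>\<omega>\<in>space M. X \<omega> \<subseteq> S) \<and>
     (\<forall>B. bounded B \<and> B \<in> sets borel \<longrightarrow>
        distr M (count_space UNIV) (\<lambda>\<omega>. card (X \<omega> \<inter> B))
          = measure_pmf (poisson_pmf (intensity * measure lborel (B \<inter> S)))) \<and>
     (\<forall>B :: nat \<Rightarrow> 'a set. (\<forall>i. bounded (B i) \<and> B i \<in> sets borel) \<and> disjoint_family B \<longrightarrow>
        prob_space.indep_vars M (\<lambda>_. count_space UNIV) (\<lambda>i \<omega>. card (X \<omega> \<inter> B i)) UNIV)"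

section \<open>Lines in the plane\<close>

text \<open>
  A pair \<^term>\<open>(\<theta>, \<rho>) :: real \<times> real\<close> encodes the line at distance \<open>\<rho>\<close> from the origin whose
  perpendicular through the origin has angle \<open>\<theta>\<close>. The point \<open>line_point (\<theta>, \<rho>) t\<close> lies
  at signed distance \<open>t\<close> along the line from the foot of that perpendicular.
\<close>

definition line :: "real \<times> real \<Rightarrow> (real \<times> real) set" where
  "line p = {x. x \<bullet> (cos (fst p), sin (fst p)) = snd p}"

definition line_point :: "real \<times> real \<Rightarrow> real \<Rightarrow> real \<times> real" where
  "line_point p t = snd p *\<^sub>R (cos (fst p), sin (fst p)) + t *\<^sub>R (- sin (fst p), cos (fst p))"

lemma line_point_coords:
  "line_point p t = (snd p * cos (fst p) - t * sin (fst p), snd p * sin (fst p) + t * cos (fst p))"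
  by (simp add: line_point_def)

lemma norm_line_point: "norm (line_point p t) = sqrt ((snd p)\<^sup>2 + t\<^sup>2)"
proof -
  have "(a * c - t * s)\<^sup>2 + (a * s + t * c)\<^sup>2 = (a\<^sup>2 + t\<^sup>2) * (s\<^sup>2 + c\<^sup>2)" for a c s t :: real
    by (simp add: power2_eq_square algebra_simps)
  then show ?thesis
    by (simp add: line_point_coords norm_Pair)
qed

lemma dist_line_point: "dist (line_point p s) (line_point p t) = \<bar>s - t\<bar>"
proof -
  have "line_point p s - line_point p t = line_point (fst p, 0) (s - t)"
    by (simp add: line_point_coords algebra_simps)
  then show ?thesis
    by (simp add: dist_norm norm_line_point)
qed

lemma line_eq_range: "line p = range (line_point p)"
proof (intro set_eqI iffI)
  fix x :: "real \<times> real" assume x: "x \<in> line p"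
  define c s where "c = cos (fst p)" and "s = sin (fst p)"
  have cs: "c * c + s * s = 1"
    unfolding c_def s_def using sin_cos_squared_add[of "fst p"] by (simp add: power2_eq_square)
  obtain a b where ab: "x = (a, b)" by (cases x)
  have ip: "a * c + b * s = snd p"
    using x by (simp add: line_def ab c_def s_def)
  have "a = (a * c + b * s) * c - (b * c - a * s) * s"
    using cs by algebra
  moreover have "b = (a * c + b * s) * s + (b * c - a * s) * c"
    using cs by algebra
  ultimately have "x = line_point p (b * c - a * s)"
    unfolding line_point_coords ab ip by (simp add: c_def s_def)
  then show "x \<in> range (line_point p)" by blast
next
  fix x :: "real \<times> real" assume "x \<in> range (line_point p)"
  then obtain t where "x = line_point p t" by blast
  moreover have "(a * c - t * s) * c + (a * s + t * c) * s = a * (s\<^sup>2 + c\<^sup>2)" for a c s :: real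
    by (simp add: power2_eq_square algebra_simps)
  ultimately show "x \<in> line p"
    by (simp add: line_def line_point_coords)
qed

lemma line_Int_ball_nonempty_iff: "line p \<inter> ball 0 r \<noteq> {} \<longleftrightarrow> \<bar>snd p\<bar> < r"
proof
  assume "line p \<inter> ball 0 r \<noteq> {}"
  then obtain t where "norm (line_point p t) < r"
    by (auto simp: line_eq_range)
  moreover have "\<bar>snd p\<bar> \<le> norm (line_point p t)"
    unfolding norm_line_point by (rule real_le_rsqrt) simp
  ultimately show "\<bar>snd p\<bar> < r" by simp
next
  assume "\<bar>snd p\<bar> < r"
  then have "line_point p 0 \<in> line p \<inter> ball 0 r"
    by (simp add: line_eq_range norm_line_point)
  then show "line p \<inter> ball 0 r \<noteq> {}" by blast
qed

lemma line_Int_cball_empty_iff: "line p \<inter> cball 0 r = {} \<longleftrightarrow> r < \<bar>snd p\<bar>"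
proof
  assume "line p \<inter> cball 0 r = {}"
  then have "line_point p 0 \<notin> cball 0 r"
    unfolding line_eq_range by blast
  then show "r < \<bar>snd p\<bar>"
    by (simp add: norm_line_point)
next
  assume r: "r < \<bar>snd p\<bar>"
  have "\<bar>snd p\<bar> \<le> norm (line_point p t)" for t
    unfolding norm_line_point by (rule real_le_rsqrt) simp
  then have "line_point p t \<notin> cball 0 r" for t
    using r by (simp add: not_le) (meson less_le_trans)
  then show "line p \<inter> cball 0 r = {}"
    by (auto simp: line_eq_range)
qed

text \<open>
  The outer disc is open and the inner one closed: a line tangent to the inner disc, in
  particular the serving line itself, is not counted.
\<close>

definition num_lines :: "(real \<times> real) set \<Rightarrow> real \<Rightarrow> real \<Rightarrow> nat" where
  "num_lines \<Phi> y r = card {p \<in> \<Phi>. line p \<inter> ball 0 r \<noteq> {} \<and> line p \<inter> cball 0 y = {}}"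

lemma num_lines_eq:
  assumes "\<Phi> \<subseteq> {0..<2 * pi} \<times> {0..}"
  shows "num_lines \<Phi> y r = card {p \<in> \<Phi>. y < snd p \<and> snd p < r}"
proof -
  have "\<bar>snd p\<bar> = snd p" if "p \<in> \<Phi>" for p
    using that assms by auto
  then have "{p \<in> \<Phi>. line p \<inter> ball 0 r \<noteq> {} \<and> line p \<inter> cball 0 y = {}}
      = {p \<in> \<Phi>. y < snd p \<and> snd p < r}"
    by (auto simp: line_Int_ball_nonempty_iff line_Int_cball_empty_iff)
  then show ?thesis by (simp add: num_lines_def)
qed

section \<open>The Cox process of nodes\<close>

text \<open>
  Lines are ordered by distance; ties, which have probability zero, are broken by the angle.
  If \<open>\<Phi>\<close> has fewer than \<open>n\<close> lines, again a null event for a Poisson line process, the value of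
  \<open>nth_closest \<Phi> n\<close> is unspecified.
\<close>

definition closer :: "real \<times> real \<Rightarrow> real \<times> real \<Rightarrow> bool" where
  "closer q p \<longleftrightarrow> snd q < snd p \<or> (snd q = snd p \<and> fst q < fst p)"

definition nth_closest :: "(real \<times> real) set \<Rightarrow> nat \<Rightarrow> real \<times> real" where
  "nth_closest \<Phi> n = (THE p. p \<in> \<Phi> \<and> card {q \<in> \<Phi>. closer q p} = n - 1)"

text \<open>
  \<open>L \<theta>\<^sub>0 \<Phi> 0\<close> is the typical line, through the origin and with perpendicular direction \<open>\<theta>\<^sub>0\<close>.
\<close>

definition L :: "real \<Rightarrow> (real \<times> real) set \<Rightarrow> nat \<Rightarrow> real \<times> real" where
  "L \<theta>\<^sub>0 \<Phi> i = (if i = 0 then (\<theta>\<^sub>0, 0) else nth_closest \<Phi> i)"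

definition Y :: "(real \<times> real) set \<Rightarrow> nat \<Rightarrow> real" where
  "Y \<Phi> i = snd (nth_closest \<Phi> i)"

text \<open>
  \<open>\<Psi> i\<close> is the set of positions of the nodes of the \<open>i\<close>-th line, measured along that
  line from the foot of its perpendicular.
\<close>

definition nodes_on :: "real \<Rightarrow> (real \<times> real) set \<Rightarrow> (nat \<Rightarrow> real set) \<Rightarrow> nat \<Rightarrow> (real \<times> real) set" where
  "nodes_on \<theta>\<^sub>0 \<Phi> \<Psi> i = line_point (L \<theta>\<^sub>0 \<Phi> i) ` \<Psi> i"

definition nodes :: "real \<Rightarrow> (real \<times> real) set \<Rightarrow> (nat \<Rightarrow> real set) \<Rightarrow> (real \<times> real) set" where
  "nodes \<theta>\<^sub>0 \<Phi> \<Psi> = (\<Union>i. nodes_on \<theta>\<^sub>0 \<Phi> \<Psi> i)"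

definition serving_nodes :: "real \<Rightarrow> (real \<times> real) set \<Rightarrow> (nat \<Rightarrow> real set) \<Rightarrow> (real \<times> real) set" where
  "serving_nodes \<theta>\<^sub>0 \<Phi> \<Psi> = {x \<in> nodes \<theta>\<^sub>0 \<Phi> \<Psi>. \<forall>z \<in> nodes \<theta>\<^sub>0 \<Phi> \<Psi>. dist 0 x \<le> dist 0 z}"

definition serving_dist :: "real \<Rightarrow> (real \<times> real) set \<Rightarrow> (nat \<Rightarrow> real set) \<Rightarrow> real" where
  "serving_dist \<theta>\<^sub>0 \<Phi> \<Psi> = infdist 0 (nodes \<theta>\<^sub>0 \<Phi> \<Psi>)"

lemma serving_dist_eq:
  assumes "x \<in> serving_nodes \<theta>\<^sub>0 \<Phi> \<Psi>"
  shows "serving_dist \<theta>\<^sub>0 \<Phi> \<Psi> = dist 0 x"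
proof -
  have x: "x \<in> nodes \<theta>\<^sub>0 \<Phi> \<Psi>" "\<And>z. z \<in> nodes \<theta>\<^sub>0 \<Phi> \<Psi> \<Longrightarrow> dist 0 x \<le> dist 0 z"
    using assms by (auto simp: serving_nodes_def)
  then have "nodes \<theta>\<^sub>0 \<Phi> \<Psi> \<noteq> {}" by blast
  with x have "dist 0 x \<le> infdist 0 (nodes \<theta>\<^sub>0 \<Phi> \<Psi>)"
    by (auto simp: infdist_def intro!: cINF_greatest)
  moreover have "infdist 0 (nodes \<theta>\<^sub>0 \<Phi> \<Psi>) \<le> dist 0 x"
    using x(1) by (rule infdist_le)
  ultimately show ?thesis by (simp add: serving_dist_def)
qed

text \<open>The condition defining \<open>\<E>\<^sub>n\<close>: the serving node, almost surely unique, is on the \<open>n\<close>-th line.\<close>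

definition served_by_line ::
    "real \<Rightarrow> (real \<times> real) set \<Rightarrow> (nat \<Rightarrow> real set) \<Rightarrow> nat \<Rightarrow> bool" where
  "served_by_line \<theta>\<^sub>0 \<Phi> \<Psi> n \<longleftrightarrow> serving_nodes \<theta>\<^sub>0 \<Phi> \<Psi> \<inter> nodes_on \<theta>\<^sub>0 \<Phi> \<Psi> n \<noteq> {}"

end

theory Submission
  imports Defs
begin

text \<open>
  Write \<open>\<rho> i\<close> for the distance of the \<open>i\<close>-th closest line and \<open>W i\<close> for the distance from the foot of its
  perpendicular to its nearest node, so that the nearest node of that line is at distance
  \<open>sqrt (\<rho> i ^ 2 + W i ^ 2)\<close>. Put \<open>r = sqrt (\<rho> n ^ 2 + W n ^ 2)\<close>. Up to null sets, the \<open>n\<close>-th line serves with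
  exactly \<open>k\<close> lines in between iff exactly \<open>k\<close> of the lines beyond the \<open>n\<close>-th one are closer than \<open>r\<close>
  and no other line has a node closer than \<open>r\<close>. Given the lines and \<open>W n\<close>, the last condition has
  probability \<open>\<Prod> exp (- 2 * lam_v * sqrt (r ^ 2 - \<rho> i ^ 2))\<close>, over all \<open>i \<noteq> n\<close> with \<open>\<rho> i < r\<close>.

  The lines form a one-dimensional Poisson process in the distance, of rate \<open>\<mu> = 2 * pi * lam_l\<close>, so the gap
  \<open>\<rho> (l + 1) - \<rho> l\<close> is exponential and independent of \<open>\<rho> 1, \<dots>, \<rho> l\<close>. Integrating the product over the
  \<open>k\<close> lines beyond the \<open>n\<close>-th one, one gap at a time, turns their contribution into
  \<open>exp (- \<mu> * (r - \<rho> n)) * m ^ k / k!\<close> with \<open>m\<close> as in the theorem, while the contribution of the lines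
  closer than the \<open>n\<close>-th one does not depend on \<open>k\<close>. Normalising over \<open>k\<close> leaves the Poisson
  probabilities \<open>exp (- m) * m ^ k / k!\<close>. They are continuous in \<open>(y, r)\<close>, and every neighbourhood of
  \<open>(y, r)\<close> has positive probability, which gives the pointwise limit.
\<close>

section \<open>Order statistics of a line configuration\<close>

text \<open>\<open>homogeneous_PPP\<close> describes counts in fixed bounded sets only, whereas a
  gap starts at a random distance. The law of a gap is therefore a strong Markov property that has
  to be derived: the \<open>l\<close>-th distance is rounded up to a grid of width \<open>d\<close>,
  each value of the rounded distance reduces the claim to independent counts in fixed strips, and
  \<open>d\<close> tends to 0. The second obstacle is that the radius \<open>r\<close> is random and
  decides which lines matter. It depends on the \<open>n\<close>-th line alone, so with
  \<open>W n\<close> frozen it is known as soon as \<open>\<rho> n\<close> is, and all later gaps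
  can be integrated with \<open>r\<close> held fixed. No density of \<open>(Y n, R)\<close> is ever
  computed. The integrals carry an arbitrary test function of this pair, and only the proportion
  between the weights for different \<open>k\<close> enters the result.\<close>

definition lines_within :: "(real \<times> real) set \<Rightarrow> real \<Rightarrow> (real \<times> real) set" where
  "lines_within \<Phi> c = {p \<in> \<Phi>. snd p < c}"

text \<open>Truncation by distance is needed because \<open>card\<close> of an infinite
  configuration is 0.\<close>

definition has_nth :: "(real \<times> real) set \<Rightarrow> nat \<Rightarrow> bool" where
  "has_nth \<Phi> i \<longleftrightarrow> (\<exists>c. i \<le> card (lines_within \<Phi> c))"

text \<open>Half-open in the distance, so that consecutive strips tile and \<open>strip 0 c\<close>
  matches the strict bound of \<open>lines_within\<close>.\<close>

definition strip :: "real \<Rightarrow> real \<Rightarrow> (real \<times> real) set" where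
  "strip a b = {0..<2 * pi} \<times> {a..<b}"

definition line_config :: "(real \<times> real) set \<Rightarrow> bool" where
  "line_config \<Phi> \<longleftrightarrow> locally_finite \<Phi> \<and> \<Phi> \<subseteq> {0..<2 * pi} \<times> {0..}"

lemma bounded_strip: "bounded (strip a b)"
proof -
  have "bounded ({0..2 * pi} \<times> {a..b})"
    by (intro bounded_Times) auto
  then show ?thesis
    by (rule bounded_subset) (auto simp: strip_def)
qed

lemma sets_strip: "strip a b \<in> sets borel"
  unfolding strip_def by (intro borel_Times) auto

lemma lines_within_eq_strip:
  assumes "line_config \<Phi>"
  shows "lines_within \<Phi> c = \<Phi> \<inter> strip 0 c"
  using assms by (auto simp: line_config_def lines_within_def strip_def)

lemma finite_lines_within:
  assumes "line_config \<Phi>"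
  shows "finite (lines_within \<Phi> c)"
  unfolding lines_within_eq_strip[OF assms]
  using assms bounded_strip unfolding line_config_def locally_finite_def by blast

lemma card_lines_within_mono:
  assumes "line_config \<Phi>" "c \<le> d"
  shows "card (lines_within \<Phi> c) \<le> card (lines_within \<Phi> d)"
  using assms(2) by (intro card_mono finite_lines_within assms) (auto simp: lines_within_def)

lemma closer_rank_less:
  assumes "line_config \<Phi>" "p \<in> \<Phi>" "closer p q"
  shows "card {x \<in> \<Phi>. closer x p} < card {x \<in> \<Phi>. closer x q}"
proof (rule psubset_card_mono)
  have "{x \<in> \<Phi>. closer x q} \<subseteq> lines_within \<Phi> (snd q + 1)"
    by (auto simp: closer_def lines_within_def)
  then show "finite {x \<in> \<Phi>. closer x q}"
    using finite_lines_within[OF assms(1)] finite_subset by blast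
  show "{x \<in> \<Phi>. closer x p} \<subset> {x \<in> \<Phi>. closer x q}"
    using assms(2,3) by (auto simp: closer_def)
qed

lemma closer_total: "p \<noteq> q \<Longrightarrow> closer p q \<or> closer q p"
  by (auto simp: closer_def prod_eq_iff)

lemma closer_rank_inj:
  assumes "line_config \<Phi>"
  shows "inj_on (\<lambda>p. card {x \<in> \<Phi>. closer x p}) \<Phi>"
proof (rule inj_onI, rule ccontr)
  fix p q
  assume *: "p \<in> \<Phi>" "q \<in> \<Phi>" "card {x \<in> \<Phi>. closer x p} = card {x \<in> \<Phi>. closer x q}" "p \<noteq> q"
  then show False
    using closer_rank_less[OF assms, of p q] closer_rank_less[OF assms, of q p] closer_total[of p q]
    by auto
qed

text \<open>Whatever is closer than a line within \<open>c\<close> is itself within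
  \<open>c\<close>, so the ranks stay below the number of these lines; being distinct, they exhaust
  all smaller numbers. This is what gives the definite description in \<open>nth_closest\<close> a
  witness.\<close>

lemma closer_rank_image:
  assumes "line_config \<Phi>"
  shows "(\<lambda>p. card {x \<in> \<Phi>. closer x p}) ` lines_within \<Phi> c = {..<card (lines_within \<Phi> c)}"
proof (rule card_subset_eq)
  have "inj_on (\<lambda>p. card {x \<in> \<Phi>. closer x p}) (lines_within \<Phi> c)"
    using closer_rank_inj[OF assms] by (rule inj_on_subset) (auto simp: lines_within_def)
  then show "card ((\<lambda>p. card {x \<in> \<Phi>. closer x p}) ` lines_within \<Phi> c) = card {..<card (lines_within \<Phi> c)}"
    by (simp add: card_image)
  show "(\<lambda>p. card {x \<in> \<Phi>. closer x p}) ` lines_within \<Phi> c \<subseteq> {..<card (lines_within \<Phi> c)}"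
  proof safe
    fix p assume p: "(p :: real \<times> real) \<in> lines_within \<Phi> c"
    have "{x \<in> \<Phi>. closer x p} \<subset> lines_within \<Phi> c"
      using p by (auto simp: lines_within_def closer_def)
    then show "card {x \<in> \<Phi>. closer x p} < card (lines_within \<Phi> c)"
      by (rule psubset_card_mono[OF finite_lines_within[OF assms]])
  qed
qed simp

lemma nth_closest_unique:
  assumes "line_config \<Phi>" "p \<in> \<Phi>"
  shows "nth_closest \<Phi> (Suc (card {q \<in> \<Phi>. closer q p})) = p"
  unfolding nth_closest_def
  using assms(2) closer_rank_inj[OF assms(1)]
  by (intro the_equality) (auto simp: inj_on_def)

lemma nth_closest_props:
  assumes "line_config \<Phi>" "1 \<le> i" "has_nth \<Phi> i"
  shows "nth_closest \<Phi> i \<in> \<Phi>" "card {q \<in> \<Phi>. closer q (nth_closest \<Phi> i)} = i - 1"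
proof -
  from assms obtain c where "i \<le> card (lines_within \<Phi> c)"
    by (auto simp: has_nth_def)
  then have "i - 1 \<in> (\<lambda>p. card {x \<in> \<Phi>. closer x p}) ` lines_within \<Phi> c"
    using assms by (auto simp: closer_rank_image)
  then obtain p where p: "p \<in> \<Phi>" "card {x \<in> \<Phi>. closer x p} = i - 1"
    by (auto simp: lines_within_def)
  then have "nth_closest \<Phi> i = p"
    using nth_closest_unique[OF assms(1) p(1)] assms(2) by simp
  then show "nth_closest \<Phi> i \<in> \<Phi>" "card {q \<in> \<Phi>. closer q (nth_closest \<Phi> i)} = i - 1"
    using p by auto
qed

text \<open>The bridge from order statistics to counts. The ranks of the lines within
  \<open>c\<close> form an initial segment, so the line of rank \<open>i - 1\<close> is among them
  as soon as there are \<open>i\<close> of them.\<close>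

lemma Y_less_iff:
  assumes "line_config \<Phi>" "1 \<le> i" "has_nth \<Phi> i"
  shows "Y \<Phi> i < c \<longleftrightarrow> i \<le> card (lines_within \<Phi> c)"
proof -
  let ?rk = "\<lambda>p. card {x \<in> \<Phi>. closer x p}"
  note p = nth_closest_props[OF assms]
  have "Y \<Phi> i < c \<longleftrightarrow> nth_closest \<Phi> i \<in> lines_within \<Phi> c"
    using p by (simp add: Y_def lines_within_def)
  also have "\<dots> \<longleftrightarrow> ?rk (nth_closest \<Phi> i) \<in> ?rk ` lines_within \<Phi> c"
    using closer_rank_inj[OF assms(1)] p(1)
    by (subst inj_on_image_mem_iff[where B = \<Phi>]) (auto simp: lines_within_def)
  also have "\<dots> \<longleftrightarrow> i \<le> card (lines_within \<Phi> c)"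
    using assms p by (auto simp: closer_rank_image)
  finally show ?thesis .
qed

lemma Y_nonneg:
  assumes "line_config \<Phi>" "1 \<le> i" "has_nth \<Phi> i"
  shows "0 \<le> Y \<Phi> i"
  using nth_closest_props(1)[OF assms] assms(1) by (auto simp: Y_def line_config_def)

text \<open>A missing line still gets one fixed value, which makes \<open>Y\<close> measurable
  without discarding a null set.\<close>

lemma nth_closest_absent:
  assumes "line_config \<Phi>" "1 \<le> i" "\<not> has_nth \<Phi> i"
  shows "nth_closest \<Phi> i = (THE p. False)"
proof -
  have "\<not> (p \<in> \<Phi> \<and> card {q \<in> \<Phi>. closer q p} = i - 1)" for p
  proof
    assume p: "p \<in> \<Phi> \<and> card {q \<in> \<Phi>. closer q p} = i - 1"
    then have "i - 1 \<in> (\<lambda>p. card {x \<in> \<Phi>. closer x p}) ` lines_within \<Phi> (snd p + 1)"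
      by (force simp: lines_within_def)
    then show False
      using assms by (auto simp: closer_rank_image has_nth_def not_le) (metis Suc_pred less_eq_Suc_le not_less)
  qed
  then have "(\<lambda>p. p \<in> \<Phi> \<and> card {q \<in> \<Phi>. closer q p} = i - 1) = (\<lambda>p. False)"
    by blast
  then show ?thesis unfolding nth_closest_def by (rule arg_cong)
qed

text \<open>Counting indices instead of lines replaces a random set of planar points by a random set
  of naturals, for which measurability of each membership suffices.\<close>

lemma num_lines_eq_card_index:
  assumes "line_config \<Phi>"
  shows "num_lines \<Phi> y r = card {i. 1 \<le> i \<and> has_nth \<Phi> i \<and> y < Y \<Phi> i \<and> Y \<Phi> i < r}"
proof -
  let ?rk = "\<lambda>p. Suc (card {x \<in> \<Phi>. closer x p})"
  have has: "has_nth \<Phi> (?rk p)" if "p \<in> \<Phi>" for p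
  proof -
    have "?rk p - 1 \<in> (\<lambda>p. card {x \<in> \<Phi>. closer x p}) ` lines_within \<Phi> (snd p + 1)"
      using that by (auto simp: lines_within_def)
    then show ?thesis
      using assms by (auto simp: closer_rank_image has_nth_def Suc_le_eq)
  qed
  have "bij_betw ?rk {p \<in> \<Phi>. y < snd p \<and> snd p < r}
      {i. 1 \<le> i \<and> has_nth \<Phi> i \<and> y < Y \<Phi> i \<and> Y \<Phi> i < r}"
    by (rule bij_betw_byWitness[where f' = "nth_closest \<Phi>"])
      (use assms has nth_closest_props[OF assms] in
        \<open>auto simp: nth_closest_unique Y_def\<close>)
  then show ?thesis
    using assms by (simp add: num_lines_eq line_config_def bij_betw_same_card)
qed

section \<open>Measurability of counts and of the ordered distances\<close>

lemma configs_generator_subset: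
  "{{C. locally_finite C \<and> card (C \<inter> B) = k} | B k. bounded B \<and> B \<in> sets borel}
    \<subseteq> Pow {C :: 'a::euclidean_space set. locally_finite C}"
  by auto

lemma space_configs: "space configs = {C. locally_finite C}"
  unfolding configs_def using configs_generator_subset by (rule space_measure_of)

lemma measurable_card_Int:
  assumes "bounded B" "B \<in> sets borel"
  shows "(\<lambda>C. card (C \<inter> B)) \<in> measurable configs (count_space UNIV)"
proof (rule measurable_count_space_eq2_countable[THEN iffD2], simp, safe)
  fix k
  have "(\<lambda>C. card (C \<inter> B)) -` {k} \<inter> space configs = {C. locally_finite C \<and> card (C \<inter> B) = k}"
    by (auto simp: space_configs)
  also have "\<dots> \<in> sets configs"
    unfolding configs_def sets_measure_of[OF configs_generator_subset]
    using assms by (intro sigma_sets.Basic) auto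
  finally show "(\<lambda>C. card (C \<inter> B)) -` {k} \<inter> space configs \<in> sets configs" .
qed

lemma measurable_card_Int_compose [measurable (raw)]:
  assumes "X \<in> measurable N configs" "bounded B" "B \<in> sets borel"
  shows "(\<lambda>\<omega>. card (X \<omega> \<inter> B)) \<in> measurable N (count_space UNIV)"
  using measurable_compose[OF assms(1) measurable_card_Int[OF assms(2,3)]] .

lemma line_configI:
  assumes "X \<in> measurable N configs" "\<forall>\<omega>\<in>space N. X \<omega> \<subseteq> {0..<2 * pi} \<times> {0..}" "\<omega> \<in> space N"
  shows "line_config (X \<omega>)"
  using measurable_space[OF assms(1,3)] assms(2,3) by (auto simp: line_config_def space_configs)

context
  fixes N :: "'w measure" and X :: "'w \<Rightarrow> (real \<times> real) set"
  assumes X: "X \<in> measurable N configs" and sub: "\<forall>\<omega>\<in>space N. X \<omega> \<subseteq> {0..<2 * pi} \<times> {0..}"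
begin

lemma measurable_card_lines_within [measurable]:
  "(\<lambda>\<omega>. card (lines_within (X \<omega>) c)) \<in> measurable N (count_space UNIV)"
proof -
  have "(\<lambda>\<omega>. card (X \<omega> \<inter> strip 0 c)) \<in> measurable N (count_space UNIV)"
    using X bounded_strip sets_strip by (rule measurable_card_Int_compose)
  then show ?thesis
    by (rule measurable_cong[THEN iffD1, rotated])
      (simp add: lines_within_eq_strip[OF line_configI[OF X sub]])
qed

lemma measurable_has_nth [measurable]: "Measurable.pred N (\<lambda>\<omega>. has_nth (X \<omega>) i)"
proof -
  have "has_nth (X \<omega>) i \<longleftrightarrow> (\<exists>m::nat. i \<le> card (lines_within (X \<omega>) (real m)))" if "\<omega> \<in> space N" for \<omega>
  proof
    assume "has_nth (X \<omega>) i"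
    then obtain c where "i \<le> card (lines_within (X \<omega>) c)" by (auto simp: has_nth_def)
    moreover obtain m :: nat where "c \<le> real m" using real_arch_simple by blast
    ultimately show "\<exists>m::nat. i \<le> card (lines_within (X \<omega>) (real m))"
      using card_lines_within_mono[OF line_configI[OF X sub that]] order_trans by blast
  qed (auto simp: has_nth_def)
  then have "Measurable.pred N (\<lambda>\<omega>. has_nth (X \<omega>) i)
      = Measurable.pred N (\<lambda>\<omega>. \<exists>m::nat. i \<le> card (lines_within (X \<omega>) (real m)))"
    by (rule measurable_cong)
  then show ?thesis by simp
qed

lemma borel_measurable_Y [measurable]:
  assumes "1 \<le> i"
  shows "(\<lambda>\<omega>. Y (X \<omega>) i) \<in> borel_measurable N"
proof (rule borel_measurable_iff_less[THEN iffD2], safe)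
  fix c
  have "{\<omega> \<in> space N. Y (X \<omega>) i < c} = {\<omega> \<in> space N.
      if has_nth (X \<omega>) i then i \<le> card (lines_within (X \<omega>) c) else snd (THE p::real\<times>real. False) < c}"
    using Y_less_iff[OF line_configI[OF X sub] assms] nth_closest_absent[OF line_configI[OF X sub] assms]
    unfolding Y_def by (intro Collect_cong conj_cong refl) (simp split: if_split)
  also have "\<dots> \<in> sets N" by measurable
  finally show "{\<omega> \<in> space N. Y (X \<omega>) i < c} \<in> sets N" .
qed

lemma measurable_num_lines [measurable]:
  assumes [measurable]: "y \<in> borel_measurable N" "r \<in> borel_measurable N"
  shows "(\<lambda>\<omega>. num_lines (X \<omega>) (y \<omega>) (r \<omega>)) \<in> measurable N (count_space UNIV)"
proof -
  have "(\<lambda>\<omega>. card {i. 1 \<le> i \<and> has_nth (X \<omega>) i \<and> y \<omega> < Y (X \<omega>) i \<and> Y (X \<omega>) i < r \<omega>})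
      \<in> measurable N (count_space UNIV)"
  proof (rule measurable_card)
    fix i
    show "{\<omega> \<in> space N. i \<in> {i. 1 \<le> i \<and> has_nth (X \<omega>) i \<and> y \<omega> < Y (X \<omega>) i \<and> Y (X \<omega>) i < r \<omega>}} \<in> sets N"
      by (cases "1 \<le> i") simp_all
  qed
  then show ?thesis
    by (rule measurable_cong[THEN iffD1, rotated])
      (simp add: num_lines_eq_card_index[OF line_configI[OF X sub]])
qed

end

section \<open>Nodes and the serving distance\<close>

text \<open>A limit point would have infinitely many points of \<open>C\<close> in a unit ball.
  Closedness is what lets \<open>infdist\<close> be attained.\<close>

lemma locally_finite_closed:
  fixes C :: "'a::metric_space set"
  assumes "locally_finite C"
  shows "closed C"
  unfolding closed_limpt
proof safe
  fix x assume "x islimpt C"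
  then have "infinite (C \<inter> ball x 1)"
    by (simp add: islimpt_eq_infinite_ball)
  then show "x \<in> C"
    using assms by (auto simp: locally_finite_def)
qed

lemma infdist_less_iff:
  assumes "A \<noteq> {}"
  shows "infdist x A < c \<longleftrightarrow> (\<exists>a\<in>A. dist x a < c)"
  unfolding infdist_notempty[OF assms]
  by (rule cINF_less_iff[OF assms]) (rule bdd_belowI[of _ 0], auto)

text \<open>\<open>infdist\<close> to the empty set is 0, so a line without nodes gets the distance
  of its foot; this explains the conditions \<open>\<Psi> i \<noteq> {}\<close> below.\<close>

definition line_dist :: "real \<Rightarrow> (real \<times> real) set \<Rightarrow> (nat \<Rightarrow> real set) \<Rightarrow> nat \<Rightarrow> real" where
  "line_dist \<theta>\<^sub>0 \<Phi> \<Psi> i = sqrt ((snd (L \<theta>\<^sub>0 \<Phi> i))\<^sup>2 + (infdist 0 (\<Psi> i))\<^sup>2)"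

lemma infdist_attained:
  assumes "locally_finite (C :: real set)" "C \<noteq> {}"
  obtains t where "t \<in> C" "\<bar>t\<bar> = infdist 0 C"
proof -
  obtain t where "t \<in> C" "infdist 0 C = dist 0 t"
    using infdist_attains_inf[OF locally_finite_closed[OF assms(1)] assms(2)] by blast
  then show ?thesis
    by (intro that[of t]) auto
qed

lemma line_dist_le:
  assumes "t \<in> \<Psi> i"
  shows "line_dist \<theta>\<^sub>0 \<Phi> \<Psi> i \<le> dist 0 (line_point (L \<theta>\<^sub>0 \<Phi> i) t)"
proof -
  have "infdist 0 (\<Psi> i) \<le> \<bar>t\<bar>"
    using infdist_le[OF assms, of 0] by simp
  then have "(infdist 0 (\<Psi> i))\<^sup>2 \<le> t\<^sup>2"
    using power_mono[of "infdist 0 (\<Psi> i)" "\<bar>t\<bar>" 2] infdist_nonneg[of 0 "\<Psi> i"] by simp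
  then show ?thesis
    by (simp add: line_dist_def norm_line_point)
qed

lemma line_dist_attained:
  assumes "locally_finite (\<Psi> i)" "\<Psi> i \<noteq> {}"
  obtains t where "t \<in> \<Psi> i" "dist 0 (line_point (L \<theta>\<^sub>0 \<Phi> i) t) = line_dist \<theta>\<^sub>0 \<Phi> \<Psi> i"
proof -
  obtain t where t: "t \<in> \<Psi> i" "\<bar>t\<bar> = infdist 0 (\<Psi> i)"
    using infdist_attained[OF assms] by blast
  have "(infdist 0 (\<Psi> i))\<^sup>2 = t\<^sup>2"
    unfolding t(2)[symmetric] by simp
  then show ?thesis
    using t by (intro that[of t]) (auto simp: line_dist_def norm_line_point)
qed

text \<open>On each nonempty line a nearest node exists by local finiteness, so minimality among all
  nodes becomes a comparison of one distance per line, a countable condition.\<close>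

lemma served_by_line_iff:
  assumes lf: "\<forall>i. locally_finite (\<Psi> i)"
  shows "served_by_line \<theta>\<^sub>0 \<Phi> \<Psi> n \<longleftrightarrow>
    \<Psi> n \<noteq> {} \<and> (\<forall>i. \<Psi> i \<noteq> {} \<longrightarrow> line_dist \<theta>\<^sub>0 \<Phi> \<Psi> n \<le> line_dist \<theta>\<^sub>0 \<Phi> \<Psi> i)"
proof (intro iffI conjI allI impI)
  assume "served_by_line \<theta>\<^sub>0 \<Phi> \<Psi> n"
  then obtain t where t: "t \<in> \<Psi> n" "line_point (L \<theta>\<^sub>0 \<Phi> n) t \<in> serving_nodes \<theta>\<^sub>0 \<Phi> \<Psi>"
    by (auto simp: served_by_line_def nodes_on_def)
  then show "\<Psi> n \<noteq> {}" by auto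
  fix i assume "\<Psi> i \<noteq> {}"
  then obtain s where s: "s \<in> \<Psi> i" "dist 0 (line_point (L \<theta>\<^sub>0 \<Phi> i) s) = line_dist \<theta>\<^sub>0 \<Phi> \<Psi> i"
    using line_dist_attained[where \<Psi> = \<Psi> and i = i, OF spec[OF lf]] by blast
  have "line_point (L \<theta>\<^sub>0 \<Phi> i) s \<in> nodes \<theta>\<^sub>0 \<Phi> \<Psi>"
    using s by (auto simp: nodes_def nodes_on_def)
  then have "dist 0 (line_point (L \<theta>\<^sub>0 \<Phi> n) t) \<le> line_dist \<theta>\<^sub>0 \<Phi> \<Psi> i"
    using t(2) unfolding serving_nodes_def s(2)[symmetric] by blast
  with line_dist_le[where \<Psi> = \<Psi> and i = n, OF t(1), of \<theta>\<^sub>0 \<Phi>]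
  show "line_dist \<theta>\<^sub>0 \<Phi> \<Psi> n \<le> line_dist \<theta>\<^sub>0 \<Phi> \<Psi> i"
    by (rule order_trans)
next
  assume "\<Psi> n \<noteq> {} \<and> (\<forall>i. \<Psi> i \<noteq> {} \<longrightarrow> line_dist \<theta>\<^sub>0 \<Phi> \<Psi> n \<le> line_dist \<theta>\<^sub>0 \<Phi> \<Psi> i)"
  then obtain t where t: "t \<in> \<Psi> n"
    and le: "\<forall>i. \<Psi> i \<noteq> {} \<longrightarrow> line_dist \<theta>\<^sub>0 \<Phi> \<Psi> n \<le> line_dist \<theta>\<^sub>0 \<Phi> \<Psi> i" by blast
  then obtain s where s: "s \<in> \<Psi> n" "dist 0 (line_point (L \<theta>\<^sub>0 \<Phi> n) s) = line_dist \<theta>\<^sub>0 \<Phi> \<Psi> n"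
    using line_dist_attained[where \<Psi> = \<Psi> and i = n, OF spec[OF lf]] by blast
  have "dist 0 (line_point (L \<theta>\<^sub>0 \<Phi> n) s) \<le> dist 0 z" if "z \<in> nodes \<theta>\<^sub>0 \<Phi> \<Psi>" for z
  proof -
    obtain i u where u: "u \<in> \<Psi> i" "z = line_point (L \<theta>\<^sub>0 \<Phi> i) u"
      using \<open>z \<in> nodes \<theta>\<^sub>0 \<Phi> \<Psi>\<close> by (auto simp: nodes_def nodes_on_def)
    then have "line_dist \<theta>\<^sub>0 \<Phi> \<Psi> n \<le> line_dist \<theta>\<^sub>0 \<Phi> \<Psi> i"
      using le by blast
    also have "\<dots> \<le> dist 0 z"
      unfolding u(2) by (rule line_dist_le[of u \<Psi> i, OF u(1)])
    finally show ?thesis unfolding s(2) .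
  qed
  moreover have "line_point (L \<theta>\<^sub>0 \<Phi> n) s \<in> nodes_on \<theta>\<^sub>0 \<Phi> \<Psi> n"
    using s(1) by (simp add: nodes_on_def)
  ultimately have "line_point (L \<theta>\<^sub>0 \<Phi> n) s \<in> serving_nodes \<theta>\<^sub>0 \<Phi> \<Psi> \<inter> nodes_on \<theta>\<^sub>0 \<Phi> \<Psi> n"
    unfolding serving_nodes_def nodes_def by blast
  then show "served_by_line \<theta>\<^sub>0 \<Phi> \<Psi> n"
    by (auto simp: served_by_line_def)
qed

lemma serving_dist_served:
  assumes lf: "\<forall>i. locally_finite (\<Psi> i)" and "served_by_line \<theta>\<^sub>0 \<Phi> \<Psi> n"
  shows "serving_dist \<theta>\<^sub>0 \<Phi> \<Psi> = line_dist \<theta>\<^sub>0 \<Phi> \<Psi> n"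
proof -
  obtain t where t: "t \<in> \<Psi> n" "line_point (L \<theta>\<^sub>0 \<Phi> n) t \<in> serving_nodes \<theta>\<^sub>0 \<Phi> \<Psi>"
    using assms(2) by (auto simp: served_by_line_def nodes_on_def)
  obtain s where s: "s \<in> \<Psi> n" "dist 0 (line_point (L \<theta>\<^sub>0 \<Phi> n) s) = line_dist \<theta>\<^sub>0 \<Phi> \<Psi> n"
    using line_dist_attained[where \<Psi> = \<Psi> and i = n, OF spec[OF lf]] t(1) by blast
  have "line_point (L \<theta>\<^sub>0 \<Phi> n) s \<in> nodes \<theta>\<^sub>0 \<Phi> \<Psi>"
    using s by (auto simp: nodes_def nodes_on_def)
  then have "dist 0 (line_point (L \<theta>\<^sub>0 \<Phi> n) t) \<le> line_dist \<theta>\<^sub>0 \<Phi> \<Psi> n"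
    using t(2) unfolding serving_nodes_def s(2)[symmetric] by blast
  then show ?thesis
    using serving_dist_eq[OF t(2)] line_dist_le[where \<Psi> = \<Psi> and i = n, OF t(1), of \<theta>\<^sub>0 \<Phi>] by simp
qed

lemma nodes_empty_iff: "nodes \<theta>\<^sub>0 \<Phi> \<Psi> = {} \<longleftrightarrow> (\<forall>i. \<Psi> i = {})"
  unfolding nodes_def nodes_on_def by simp

text \<open>Prepares the measurability of the serving distance. The second disjunct is the default
  value 0 of \<open>infdist\<close> when there is no node at all.\<close>

lemma serving_dist_less_iff:
  assumes lf: "\<forall>i. locally_finite (\<Psi> i)"
  shows "serving_dist \<theta>\<^sub>0 \<Phi> \<Psi> < c \<longleftrightarrow>
    (\<exists>i. \<Psi> i \<noteq> {} \<and> line_dist \<theta>\<^sub>0 \<Phi> \<Psi> i < c) \<or> ((\<forall>i. \<Psi> i = {}) \<and> 0 < c)"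
proof (cases "nodes \<theta>\<^sub>0 \<Phi> \<Psi> = {}")
  case True
  then show ?thesis
    using nodes_empty_iff[of \<theta>\<^sub>0 \<Phi> \<Psi>] by (auto simp: serving_dist_def infdist_def)
next
  case False
  have "serving_dist \<theta>\<^sub>0 \<Phi> \<Psi> < c \<longleftrightarrow> (\<exists>i. \<exists>t\<in>\<Psi> i. dist 0 (line_point (L \<theta>\<^sub>0 \<Phi> i) t) < c)"
    unfolding serving_dist_def infdist_less_iff[OF False] by (auto simp: nodes_def nodes_on_def)
  also have "\<dots> \<longleftrightarrow> (\<exists>i. \<Psi> i \<noteq> {} \<and> line_dist \<theta>\<^sub>0 \<Phi> \<Psi> i < c)"
  proof
    assume "\<exists>i. \<exists>t\<in>\<Psi> i. dist 0 (line_point (L \<theta>\<^sub>0 \<Phi> i) t) < c"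
    then obtain i t where t: "t \<in> \<Psi> i" "dist 0 (line_point (L \<theta>\<^sub>0 \<Phi> i) t) < c" by blast
    then have "line_dist \<theta>\<^sub>0 \<Phi> \<Psi> i < c"
      using line_dist_le[of t \<Psi> i \<theta>\<^sub>0 \<Phi>] by linarith
    with t(1) show "\<exists>i. \<Psi> i \<noteq> {} \<and> line_dist \<theta>\<^sub>0 \<Phi> \<Psi> i < c" by blast
  next
    assume "\<exists>i. \<Psi> i \<noteq> {} \<and> line_dist \<theta>\<^sub>0 \<Phi> \<Psi> i < c"
    then obtain i where i: "\<Psi> i \<noteq> {}" "line_dist \<theta>\<^sub>0 \<Phi> \<Psi> i < c" by blast
    then show "\<exists>i. \<exists>t\<in>\<Psi> i. dist 0 (line_point (L \<theta>\<^sub>0 \<Phi> i) t) < c"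
      using line_dist_attained[where \<Psi> = \<Psi> and i = i, OF spec[OF lf]] by metis
  qed
  finally show ?thesis
    using False nodes_empty_iff[of \<theta>\<^sub>0 \<Phi> \<Psi>] by auto
qed

section \<open>Measurability of node distances and of the serving line\<close>

lemma infdist_0_less_iff_card:
  assumes "locally_finite (C :: real set)" "C \<noteq> {}"
  shows "infdist 0 C < c \<longleftrightarrow> 0 < card (C \<inter> {-c<..<c})"
proof -
  have "finite (C \<inter> {-c<..<c})"
    using assms(1) by (auto simp: locally_finite_def)
  then show ?thesis
    unfolding infdist_less_iff[OF assms(2)] card_gt_0_iff by (auto simp: abs_less_iff)
qed

lemma measurable_empty_config [measurable]:
  "Measurable.pred configs (\<lambda>C :: real set. C = {})"
proof -
  have "C = {} \<longleftrightarrow> (\<forall>m::nat. card (C \<inter> {- real m<..<real m}) = 0)" if "C \<in> space configs" for C :: "real set"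
  proof
    assume card: "\<forall>m::nat. card (C \<inter> {- real m<..<real m}) = 0"
    have False if x: "x \<in> C" for x
    proof -
    obtain m :: nat where m: "\<bar>x\<bar> < real m" using reals_Archimedean2 by blast
    have "finite (C \<inter> {- real m<..<real m})"
      using \<open>C \<in> space configs\<close> by (auto simp: space_configs locally_finite_def)
    with spec[OF card, of m] have "C \<inter> {- real m<..<real m} = {}" by (simp only: card_0_eq)
    with x m show False by (auto simp: abs_less_iff)
    qed
    then show "C = {}" by blast
  qed simp
  then have "Measurable.pred configs (\<lambda>C :: real set. C = {}) =
      Measurable.pred configs (\<lambda>C :: real set. \<forall>m::nat. card (C \<inter> {- real m<..<real m}) = 0)"
    by (rule measurable_cong)
  moreover have [measurable]:
    "(\<lambda>C. card (C \<inter> {- real m<..<real m})) \<in> measurable configs (count_space UNIV)" for m :: nat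
    by (rule measurable_card_Int) auto
  ultimately show ?thesis by simp
qed

lemma borel_measurable_infdist_0 [measurable]:
  "(\<lambda>C :: real set. infdist 0 C) \<in> borel_measurable configs"
proof (rule borel_measurable_iff_less[THEN iffD2], safe)
  fix c :: real
  have [measurable]: "(\<lambda>C. card (C \<inter> {- c<..<c})) \<in> measurable configs (count_space UNIV)"
    by (rule measurable_card_Int) auto
  have "{C \<in> space configs. infdist 0 (C :: real set) < c} =
      {C \<in> space configs. if (C :: real set) = {} then 0 < c else 0 < card (C \<inter> {- c<..<c})}"
    using infdist_0_less_iff_card by (auto simp: space_configs infdist_def split: if_splits)
  also have "\<dots> \<in> sets configs" by measurable
  finally show "{C \<in> space configs. infdist 0 (C :: real set) < c} \<in> sets configs" .
qed

context
  fixes N :: "'w measure" and X :: "'w \<Rightarrow> (real \<times> real) set" and Z :: "'w \<Rightarrow> nat \<Rightarrow> real set"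
  assumes X: "X \<in> measurable N configs" and sub: "\<forall>\<omega>\<in>space N. X \<omega> \<subseteq> {0..<2 * pi} \<times> {0..}"
    and Z[measurable]: "\<And>i. (\<lambda>\<omega>. Z \<omega> i) \<in> measurable N configs"
begin

lemma Z_locally_finite: "\<omega> \<in> space N \<Longrightarrow> \<forall>i. locally_finite (Z \<omega> i)"
  using measurable_space[OF Z, of \<omega>] by (simp add: space_configs)

lemma borel_measurable_line_dist [measurable]:
  "(\<lambda>\<omega>. line_dist \<theta>\<^sub>0 (X \<omega>) (Z \<omega>) i) \<in> borel_measurable N"
proof -
  have "(\<lambda>\<omega>. snd (L \<theta>\<^sub>0 (X \<omega>) i)) \<in> borel_measurable N"
    using borel_measurable_Y[OF X sub, of i] by (cases "i = 0") (auto simp: L_def Y_def)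
  then show ?thesis
    unfolding line_dist_def by measurable
qed

lemma measurable_served_by_line [measurable]:
  "Measurable.pred N (\<lambda>\<omega>. served_by_line \<theta>\<^sub>0 (X \<omega>) (Z \<omega>) n)"
proof -
  have "Measurable.pred N (\<lambda>\<omega>. Z \<omega> n \<noteq> {} \<and>
      (\<forall>i. Z \<omega> i \<noteq> {} \<longrightarrow> line_dist \<theta>\<^sub>0 (X \<omega>) (Z \<omega>) n \<le> line_dist \<theta>\<^sub>0 (X \<omega>) (Z \<omega>) i))"
    by measurable
  then show ?thesis
    by (rule measurable_cong[THEN iffD1, rotated]) (simp add: served_by_line_iff[OF Z_locally_finite])
qed

lemma borel_measurable_serving_dist [measurable]:
  "(\<lambda>\<omega>. serving_dist \<theta>\<^sub>0 (X \<omega>) (Z \<omega>)) \<in> borel_measurable N"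
proof (rule borel_measurable_iff_less[THEN iffD2], safe)
  fix c
  have "{\<omega> \<in> space N. serving_dist \<theta>\<^sub>0 (X \<omega>) (Z \<omega>) < c} = {\<omega> \<in> space N.
      (\<exists>i. Z \<omega> i \<noteq> {} \<and> line_dist \<theta>\<^sub>0 (X \<omega>) (Z \<omega>) i < c) \<or> ((\<forall>i. Z \<omega> i = {}) \<and> 0 < c)}"
    by (intro Collect_cong conj_cong refl serving_dist_less_iff Z_locally_finite)
  also have "\<dots> \<in> sets N" by measurable
  finally show "{\<omega> \<in> space N. serving_dist \<theta>\<^sub>0 (X \<omega>) (Z \<omega>) < c} \<in> sets N" .
qed

end

section \<open>The distances of the lines\<close>

text \<open>Unlike \<open>indep_var\<close>, this allows the two random elements to have different types.\<close>

definition (in prob_space) indep_elements :: "'b measure \<Rightarrow> ('a \<Rightarrow> 'b) \<Rightarrow> 'c measure \<Rightarrow> ('a \<Rightarrow> 'c) \<Rightarrow> bool" where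
  "indep_elements S X T Z \<longleftrightarrow> X \<in> measurable M S \<and> Z \<in> measurable M T \<and>
    (\<forall>A\<in>sets S. \<forall>B\<in>sets T. prob ((X -` A \<inter> space M) \<inter> (Z -` B \<inter> space M))
      = prob (X -` A \<inter> space M) * prob (Z -` B \<inter> space M))"

lemma (in prob_space) indep_elements_distr:
  assumes "indep_elements S X T Z"
  shows "distr M S X \<Otimes>\<^sub>M distr M T Z = distr M (S \<Otimes>\<^sub>M T) (\<lambda>x. (X x, Z x))"
proof -
  have [measurable]: "random_variable S X" "random_variable T Z"
    and prod: "\<And>A B. A \<in> sets S \<Longrightarrow> B \<in> sets T \<Longrightarrow>
      prob ((X -` A \<inter> space M) \<inter> (Z -` B \<inter> space M)) = prob (X -` A \<inter> space M) * prob (Z -` B \<inter> space M)"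
    using assms unfolding indep_elements_def by auto
  interpret X: prob_space "distr M S X" by (rule prob_space_distr) measurable
  interpret Z: prob_space "distr M T Z" by (rule prob_space_distr) measurable
  show ?thesis
  proof (rule pair_measure_eqI)
    fix A B assume "A \<in> sets (distr M S X)" "B \<in> sets (distr M T Z)"
    then have AB[measurable]: "A \<in> sets S" "B \<in> sets T" by auto
    have "(\<lambda>x. (X x, Z x)) -` (A \<times> B) \<inter> space M = (X -` A \<inter> space M) \<inter> (Z -` B \<inter> space M)" by auto
    then show "emeasure (distr M S X) A * emeasure (distr M T Z) B
        = emeasure (distr M (S \<Otimes>\<^sub>M T) (\<lambda>x. (X x, Z x))) (A \<times> B)"
      using prod[OF AB] by (simp add: emeasure_distr emeasure_eq_measure ennreal_mult[symmetric])
  qed (use X.sigma_finite_measure_axioms Z.sigma_finite_measure_axioms in auto)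
qed

text \<open>Fubini in the form used below: \<open>\<omega>'\<close> plays the part of an independent
  copy, so one element can be frozen while the other is averaged.\<close>

lemma (in prob_space) indep_elements_nn_integral:
  assumes ind: "indep_elements S X T Z" and [measurable]: "G \<in> borel_measurable (S \<Otimes>\<^sub>M T)"
  shows "(\<integral>\<^sup>+\<omega>. G (X \<omega>, Z \<omega>) \<partial>M) = (\<integral>\<^sup>+\<omega>. \<integral>\<^sup>+\<omega>'. G (X \<omega>, Z \<omega>') \<partial>M \<partial>M)"
proof -
  have [measurable]: "random_variable S X" "random_variable T Z"
    using ind unfolding indep_elements_def by auto
  note eq = indep_elements_distr[OF ind]
  interpret Z: prob_space "distr M T Z" by (rule prob_space_distr) measurable
  have "(\<integral>\<^sup>+\<omega>. G (X \<omega>, Z \<omega>) \<partial>M) = (\<integral>\<^sup>+x. G x \<partial>(distr M S X \<Otimes>\<^sub>M distr M T Z))"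
    unfolding eq by (subst nn_integral_distr) auto
  also have "\<dots> = (\<integral>\<^sup>+x. \<integral>\<^sup>+z. G (x, z) \<partial>distr M T Z \<partial>distr M S X)"
    by (subst Z.nn_integral_fst[symmetric]) auto
  also have "\<dots> = (\<integral>\<^sup>+\<omega>. \<integral>\<^sup>+z. G (X \<omega>, z) \<partial>distr M T Z \<partial>M)"
    by (subst nn_integral_distr) auto
  also have "\<dots> = (\<integral>\<^sup>+\<omega>. \<integral>\<^sup>+\<omega>'. G (X \<omega>, Z \<omega>') \<partial>M \<partial>M)"
    by (intro nn_integral_cong) (subst nn_integral_distr, auto)
  finally show ?thesis .
qed

text \<open>Carries identities between grid approximations to the limit: the indicators converge
  almost surely and are bounded by 1.\<close>

lemma (in prob_space) prob_tendsto_eventually: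
  assumes [measurable]: "\<And>i::nat. A i \<in> events" "B \<in> events"
    and ev: "AE \<omega> in M. \<forall>\<^sub>F i in sequentially. \<omega> \<in> A i \<longleftrightarrow> \<omega> \<in> B"
  shows "(\<lambda>i. prob (A i)) \<longlonglongrightarrow> prob B"
proof -
  have "(\<lambda>i. \<integral>\<omega>. indicator (A i) \<omega> \<partial>M) \<longlonglongrightarrow> (\<integral>\<omega>. indicator B \<omega> \<partial>M :: real)"
  proof (rule integral_dominated_convergence[where w = "\<lambda>_. 1"])
    show "AE \<omega> in M. (\<lambda>i. indicator (A i) \<omega>) \<longlonglongrightarrow> (indicator B \<omega> :: real)"
      using ev
    proof eventually_elim
      case (elim \<omega>)
      then have "\<forall>\<^sub>F i in sequentially. indicator B \<omega> = (indicator (A i) \<omega> :: real)"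
        by (rule eventually_mono) (auto simp: indicator_def)
      then show ?case
        by (rule Lim_transform_eventually[OF tendsto_const])
    qed
  qed (auto simp: indicator_def)
  then show ?thesis by (simp add: emeasure_eq_measure)
qed

text \<open>The left side is the probability that a Poisson variable of mean \<open>a\<close> is at
  least 2. The bound is of second order, so its sum over about \<open>1 / a\<close> cells still
  vanishes as \<open>a\<close> tends to 0.\<close>

lemma one_minus_poisson_le:
  fixes a :: real
  assumes "0 \<le> a"
  shows "1 - (1 + a) * exp (- a) \<le> a\<^sup>2"
proof -
  have "(1 + a) * (1 - a) \<le> (1 + a) * exp (- a)"
    using assms exp_ge_add_one_self[of "- a"] by (intro mult_left_mono) auto
  then show ?thesis by (simp add: power2_eq_square algebra_simps)
qed

lemma card_lines_within_add:
  assumes "line_config \<Phi>" "0 \<le> a" "a \<le> b"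
  shows "card (lines_within \<Phi> b) = card (lines_within \<Phi> a) + card (\<Phi> \<inter> strip a b)"
proof -
  have "lines_within \<Phi> b = lines_within \<Phi> a \<union> (\<Phi> \<inter> strip a b)"
    using assms by (auto simp: lines_within_def strip_def line_config_def)
  moreover have "lines_within \<Phi> a \<inter> (\<Phi> \<inter> strip a b) = {}"
    by (auto simp: lines_within_def strip_def)
  moreover have "finite (\<Phi> \<inter> strip a b)"
    by (rule finite_subset[OF _ finite_lines_within[OF assms(1), of b]])
      (auto simp: lines_within_def strip_def)
  ultimately show ?thesis
    using finite_lines_within[OF assms(1), of a] by (simp add: card_Un_disjoint)
qed

lemma lines_within_nonpos: "line_config \<Phi> \<Longrightarrow> c \<le> 0 \<Longrightarrow> lines_within \<Phi> c = {}"
  by (force simp: lines_within_def line_config_def)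

lemma measure_strip:
  assumes "0 \<le> a" "a \<le> b"
  shows "measure lborel (strip a b \<inter> {0..<2 * pi} \<times> {0..}) = 2 * pi * (b - a)"
proof -
  have "strip a b \<inter> {0..<2 * pi} \<times> {0..} = {0..<2 * pi} \<times> {a..<b}"
    using assms by (auto simp: strip_def)
  moreover have "emeasure lborel ({0..<2 * pi} \<times> {a..<b}) = ennreal (2 * pi * (b - a))"
    using assms unfolding lborel_prod[symmetric]
    by (subst lborel.emeasure_pair_measure_Times) (auto simp: ennreal_mult)
  ultimately show ?thesis
    using assms by (simp add: measure_def)
qed

locale line_process = prob_space M for M :: "'w measure" +
  fixes \<Phi> :: "'w \<Rightarrow> (real \<times> real) set" and lam_l :: real
  assumes lam_l_pos: "0 < lam_l"
    and PPP: "homogeneous_PPP M lam_l ({0..<2 * pi} \<times> {0..}) \<Phi>"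
begin

definition \<mu> :: real where "\<mu> = 2 * pi * lam_l"

text \<open>Index 0 stands for the typical line, which lets products over \<open>i < n\<close>
  include it.\<close>

definition \<rho> :: "nat \<Rightarrow> 'w \<Rightarrow> real" where
  "\<rho> i \<omega> = (if i = 0 then 0 else Y (\<Phi> \<omega>) i)"

lemma \<mu>_pos: "0 < \<mu>"
  using lam_l_pos by (simp add: \<mu>_def)

lemma \<Phi>_meas: "\<Phi> \<in> measurable M configs" and \<Phi>_sub: "\<forall>\<omega>\<in>space M. \<Phi> \<omega> \<subseteq> {0..<2 * pi} \<times> {0..}"
  using PPP by (auto simp: homogeneous_PPP_def)

lemma line_config_\<Phi>: "\<omega> \<in> space M \<Longrightarrow> line_config (\<Phi> \<omega>)"
  by (rule line_configI[OF \<Phi>_meas \<Phi>_sub])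

lemma measurable_count [measurable]:
  "(\<lambda>\<omega>. card (lines_within (\<Phi> \<omega>) c)) \<in> measurable M (count_space UNIV)"
  "Measurable.pred M (\<lambda>\<omega>. has_nth (\<Phi> \<omega>) i)"
  "(\<lambda>\<omega>. card (\<Phi> \<omega> \<inter> strip a b)) \<in> measurable M (count_space UNIV)"
  using measurable_card_lines_within[OF \<Phi>_meas \<Phi>_sub] measurable_has_nth[OF \<Phi>_meas \<Phi>_sub]
    measurable_card_Int_compose[OF \<Phi>_meas bounded_strip sets_strip] by auto

lemma borel_measurable_\<rho> [measurable]: "\<rho> i \<in> borel_measurable M"
  using borel_measurable_Y[OF \<Phi>_meas \<Phi>_sub, of i] by (cases "i = 0") (auto simp: \<rho>_def[abs_def])

lemma \<rho>_less_iff: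
  "\<omega> \<in> space M \<Longrightarrow> has_nth (\<Phi> \<omega>) i \<Longrightarrow> 1 \<le> i \<Longrightarrow> \<rho> i \<omega> < c \<longleftrightarrow> i \<le> card (lines_within (\<Phi> \<omega>) c)"
  using Y_less_iff[OF line_config_\<Phi>] by (simp add: \<rho>_def)

lemma \<rho>_nonneg: "\<omega> \<in> space M \<Longrightarrow> has_nth (\<Phi> \<omega>) i \<Longrightarrow> 0 \<le> \<rho> i \<omega>"
  using Y_nonneg[OF line_config_\<Phi>] by (simp add: \<rho>_def)

lemma prob_strip:
  assumes "0 \<le> a" "a < b"
  shows "prob {\<omega> \<in> space M. card (\<Phi> \<omega> \<inter> strip a b) = k} = (\<mu> * (b - a)) ^ k / fact k * exp (- (\<mu> * (b - a)))"
proof -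
  have "distr M (count_space UNIV) (\<lambda>\<omega>. card (\<Phi> \<omega> \<inter> strip a b)) = measure_pmf (poisson_pmf (\<mu> * (b - a)))"
  proof -
    have "lam_l * measure lborel (strip a b \<inter> {0..<2 * pi} \<times> {0..}) = \<mu> * (b - a)"
      unfolding measure_strip[OF assms(1) less_imp_le[OF assms(2)]] by (simp add: \<mu>_def)
    then show ?thesis
      using PPP bounded_strip[of a b] sets_strip[of a b] unfolding homogeneous_PPP_def by metis
  qed
  then have "measure (distr M (count_space UNIV) (\<lambda>\<omega>. card (\<Phi> \<omega> \<inter> strip a b))) {k}
      = pmf (poisson_pmf (\<mu> * (b - a))) k"
    by (simp add: measure_pmf_single)
  moreover have "0 < \<mu> * (b - a)"
    using \<mu>_pos assms by simp
  moreover have "(\<lambda>\<omega>. card (\<Phi> \<omega> \<inter> strip a b)) -` {k} \<inter> space M = {\<omega> \<in> space M. card (\<Phi> \<omega> \<inter> strip a b) = k}"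
    by auto
  ultimately show ?thesis
    by (subst (asm) measure_distr) simp_all
qed

lemma prob_card_lines_within:
  assumes "0 < c"
  shows "prob {\<omega> \<in> space M. card (lines_within (\<Phi> \<omega>) c) = k} = (\<mu> * c) ^ k / fact k * exp (- (\<mu> * c))"
proof -
  have "{\<omega> \<in> space M. card (lines_within (\<Phi> \<omega>) c) = k} = {\<omega> \<in> space M. card (\<Phi> \<omega> \<inter> strip 0 c) = k}"
    using lines_within_eq_strip[OF line_config_\<Phi>] by auto
  then show ?thesis using prob_strip[of 0 c k] assms by simp
qed

text \<open>For each \<open>i\<close>, having fewer than \<open>i\<close> lines within
  \<open>c\<close> has a Poisson probability that vanishes as \<open>c\<close> grows.\<close>

lemma AE_has_nth: "AE \<omega> in M. \<forall>i. has_nth (\<Phi> \<omega>) i"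
  unfolding AE_all_countable
proof
  fix i
  have "prob {\<omega> \<in> space M. \<not> has_nth (\<Phi> \<omega>) i} \<le> (\<Sum>k<i. (\<mu> * c) ^ k / fact k * exp (- (\<mu> * c)))"
    if "0 < c" for c
  proof -
    have "prob {\<omega> \<in> space M. \<not> has_nth (\<Phi> \<omega>) i}
        \<le> prob (\<Union>k\<in>{..<i}. {\<omega> \<in> space M. card (lines_within (\<Phi> \<omega>) c) = k})"
      by (intro finite_measure_mono) (auto simp: has_nth_def not_le)
    also have "\<dots> \<le> (\<Sum>k<i. prob {\<omega> \<in> space M. card (lines_within (\<Phi> \<omega>) c) = k})"
      by (intro finite_measure_subadditive_finite) auto
    finally show ?thesis using that by (simp add: prob_card_lines_within)
  qed
  then have "\<forall>\<^sub>F c in at_top. prob {\<omega> \<in> space M. \<not> has_nth (\<Phi> \<omega>) i}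
      \<le> (\<Sum>k<i. (\<mu> * c) ^ k / fact k * exp (- (\<mu> * c)))"
    using eventually_gt_at_top[of 0] by (rule eventually_mono[rotated]) 
  moreover have "((\<lambda>c. \<Sum>k<i. (\<mu> * c) ^ k / fact k * exp (- (\<mu> * c))) \<longlongrightarrow> (\<Sum>k<i. 0)) at_top"
  proof (rule tendsto_sum)
    fix k
    have "filterlim (\<lambda>c. \<mu> * c) at_top at_top"
      using \<mu>_pos by (intro filterlim_tendsto_pos_mult_at_top[OF tendsto_const]) (auto simp: filterlim_ident)
    from filterlim_compose[OF tendsto_power_div_exp_0 this, of k]
    have "((\<lambda>c. (\<mu> * c) ^ k / exp (\<mu> * c) / fact k) \<longlongrightarrow> 0 / fact k) at_top"
      by (intro tendsto_divide tendsto_const) auto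
    then show "((\<lambda>c. (\<mu> * c) ^ k / fact k * exp (- (\<mu> * c))) \<longlongrightarrow> 0) at_top"
      by (simp add: exp_minus field_simps)
  qed
  ultimately have "prob {\<omega> \<in> space M. \<not> has_nth (\<Phi> \<omega>) i} \<le> 0"
    by (intro tendsto_le[OF _ _ tendsto_const]) (auto simp: trivial_limit_at_top_linorder)
  then have "prob {\<omega> \<in> space M. \<not> has_nth (\<Phi> \<omega>) i} = 0"
    by (simp add: measure_le_0_iff)
  then show "AE \<omega> in M. has_nth (\<Phi> \<omega>) i"
    by (subst (asm) prob_eq_0) auto
qed

lemma prob_strip_ge_2:
  assumes "0 \<le> a" "a < b"
  shows "prob {\<omega> \<in> space M. 2 \<le> card (\<Phi> \<omega> \<inter> strip a b)} \<le> (\<mu> * (b - a))\<^sup>2"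
proof -
  let ?N = "\<lambda>\<omega>. card (\<Phi> \<omega> \<inter> strip a b)"
  have "prob {\<omega> \<in> space M. 2 \<le> ?N \<omega>} = prob (space M - ({\<omega> \<in> space M. ?N \<omega> = 0} \<union> {\<omega> \<in> space M. ?N \<omega> = 1}))"
    by (intro arg_cong[where f = prob]) auto
  also have "\<dots> = 1 - (prob {\<omega> \<in> space M. ?N \<omega> = 0} + prob {\<omega> \<in> space M. ?N \<omega> = 1})"
    by (subst prob_compl, simp, subst finite_measure_Union) auto
  also have "\<dots> = 1 - (1 + \<mu> * (b - a)) * exp (- (\<mu> * (b - a)))"
    unfolding prob_strip[OF assms] by (simp add: algebra_simps)
  also have "\<dots> \<le> (\<mu> * (b - a))\<^sup>2"
    using assms \<mu>_pos by (intro one_minus_poisson_le) simp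
  finally show ?thesis .
qed

lemma \<rho>_mono:
  assumes "\<omega> \<in> space M" "\<forall>i. has_nth (\<Phi> \<omega>) i" "i \<le> j"
  shows "\<rho> i \<omega> \<le> \<rho> j \<omega>"
proof (cases "i = 0")
  case True
  then show ?thesis using \<rho>_nonneg[of \<omega> j] assms by (simp add: \<rho>_def)
next
  case False
  show ?thesis
  proof (rule dense_ge)
    fix c assume "\<rho> j \<omega> < c"
    then show "\<rho> i \<omega> \<le> c"
      using \<rho>_less_iff[OF assms(1), of j c] \<rho>_less_iff[OF assms(1), of i c] assms False by auto
  qed
qed

text \<open>A tie below \<open>T\<close> puts two lines into one of the \<open>T * (m + 1)\<close>
  cells of width \<open>1 / (m + 1)\<close>. Each cell contains two lines with probability at most
  \<open>\<mu>\<^sup>2 / (m + 1)\<^sup>2\<close>, so the total is of order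
  \<open>1 / m\<close>.\<close>

lemma AE_\<rho>_strict: "AE \<omega> in M. \<forall>i\<ge>1. \<rho> i \<omega> < \<rho> (Suc i) \<omega>"
proof -
  define bad where "bad T \<omega> \<longleftrightarrow> (\<forall>i. has_nth (\<Phi> \<omega>) i) \<and>
    (\<exists>i\<ge>1. \<rho> (Suc i) \<omega> = \<rho> i \<omega> \<and> \<rho> i \<omega> < real T)" for T :: nat and \<omega>
  have [measurable]: "Measurable.pred M (bad T)" for T
    unfolding bad_def[abs_def] by measurable
  have bound: "prob {\<omega> \<in> space M. bad T \<omega>} \<le> real T * \<mu>\<^sup>2 * inverse (real (Suc m))" for T m
  proof -
    let ?S = "\<lambda>j. strip (real j / real (Suc m)) (real (Suc j) / real (Suc m))"
    have "{\<omega> \<in> space M. bad T \<omega>} \<subseteq> (\<Union>j\<in>{..<T * Suc m}. {\<omega> \<in> space M. 2 \<le> card (\<Phi> \<omega> \<inter> ?S j)})"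
    proof
      fix \<omega> assume "\<omega> \<in> {\<omega> \<in> space M. bad T \<omega>}"
      then obtain i where \<omega>: "\<omega> \<in> space M" and has: "\<forall>i. has_nth (\<Phi> \<omega>) i"
        and i: "1 \<le> i" "\<rho> (Suc i) \<omega> = \<rho> i \<omega>" "\<rho> i \<omega> < real T"
        by (auto simp: bad_def)
      define j where "j = nat \<lfloor>\<rho> i \<omega> * real (Suc m)\<rfloor>"
      have nn: "0 \<le> \<rho> i \<omega> * real (Suc m)"
        using \<rho>_nonneg[OF \<omega>] has by simp
      then have j1: "real j \<le> \<rho> i \<omega> * real (Suc m)" and j2: "\<rho> i \<omega> * real (Suc m) < real (Suc j)"
        unfolding j_def by linarith+
      have "real j < real T * real (Suc m)"
        using j1 i(3) by (intro le_less_trans[OF j1] mult_strict_right_mono) auto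
      then have "real j < real (T * Suc m)" by (simp only: of_nat_mult)
      then have jT: "j < T * Suc m" by (simp only: of_nat_less_iff)
      have le: "real j / real (Suc m) \<le> \<rho> i \<omega>" "\<rho> i \<omega> < real (Suc j) / real (Suc m)"
        using j1 j2 by (simp_all add: field_simps)
      \<comment> \<open>The cell starts no later than the common distance and ends after it: fewer
        than \<open>i\<close> lines precede its start and at least \<open>i + 1\<close> precede its
        end.\<close>
      have "\<not> i \<le> card (lines_within (\<Phi> \<omega>) (real j / real (Suc m)))"
        using le(1) \<rho>_less_iff[OF \<omega> spec[OF has] i(1), of "real j / real (Suc m)"] by linarith
      moreover have "Suc i \<le> card (lines_within (\<Phi> \<omega>) (real (Suc j) / real (Suc m)))"
        using le(2) i(2) \<rho>_less_iff[OF \<omega> spec[OF has], of "Suc i" "real (Suc j) / real (Suc m)"] by simp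
      moreover have "card (lines_within (\<Phi> \<omega>) (real (Suc j) / real (Suc m))) =
          card (lines_within (\<Phi> \<omega>) (real j / real (Suc m))) + card (\<Phi> \<omega> \<inter> ?S j)"
        by (rule card_lines_within_add[OF line_config_\<Phi>[OF \<omega>]]) (auto simp: divide_right_mono)
      ultimately have "2 \<le> card (\<Phi> \<omega> \<inter> ?S j)" by linarith
      with jT \<omega> show "\<omega> \<in> (\<Union>j\<in>{..<T * Suc m}. {\<omega> \<in> space M. 2 \<le> card (\<Phi> \<omega> \<inter> ?S j)})"
        by blast
    qed
    then have "prob {\<omega> \<in> space M. bad T \<omega>} \<le> prob (\<Union>j\<in>{..<T * Suc m}. {\<omega> \<in> space M. 2 \<le> card (\<Phi> \<omega> \<inter> ?S j)})"
      by (intro finite_measure_mono) auto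
    also have "\<dots> \<le> (\<Sum>j<T * Suc m. prob {\<omega> \<in> space M. 2 \<le> card (\<Phi> \<omega> \<inter> ?S j)})"
      by (intro finite_measure_subadditive_finite) auto
    also have "\<dots> \<le> (\<Sum>j<T * Suc m. (\<mu> * inverse (real (Suc m)))\<^sup>2)"
    proof (rule sum_mono)
      fix j
      have "prob {\<omega> \<in> space M. 2 \<le> card (\<Phi> \<omega> \<inter> ?S j)}
          \<le> (\<mu> * (real (Suc j) / real (Suc m) - real j / real (Suc m)))\<^sup>2"
        by (rule prob_strip_ge_2) (auto intro!: divide_strict_right_mono)
      also have "real (Suc j) / real (Suc m) - real j / real (Suc m) = inverse (real (Suc m))"
        by (simp add: field_simps)
      finally show "prob {\<omega> \<in> space M. 2 \<le> card (\<Phi> \<omega> \<inter> ?S j)} \<le> (\<mu> * inverse (real (Suc m)))\<^sup>2" .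
    qed
    also have "\<dots> = real T * \<mu>\<^sup>2 * inverse (real (Suc m))"
      by (simp add: power2_eq_square field_simps del: of_nat_Suc mult_Suc_right)
    finally show ?thesis .
  qed
  have "AE \<omega> in M. \<not> bad T \<omega>" for T
  proof -
    have "(\<lambda>m. real T * \<mu>\<^sup>2 * inverse (real (Suc m))) \<longlonglongrightarrow> real T * \<mu>\<^sup>2 * 0"
      by (intro tendsto_mult tendsto_const LIMSEQ_inverse_real_of_nat)
    then have "prob {\<omega> \<in> space M. bad T \<omega>} \<le> real T * \<mu>\<^sup>2 * 0"
      by (rule LIMSEQ_le_const) (use bound in blast)
    then have "prob {\<omega> \<in> space M. bad T \<omega>} = 0"
      by (simp add: measure_le_0_iff)
    then show ?thesis
      by (subst (asm) prob_eq_0) auto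
  qed
  then have "AE \<omega> in M. \<forall>T. \<not> bad T \<omega>"
    unfolding AE_all_countable by blast
  with AE_has_nth AE_space show ?thesis
  proof eventually_elim
    case (elim \<omega>)
    show ?case
    proof safe
      fix i :: nat assume "1 \<le> i"
      obtain T :: nat where "\<rho> i \<omega> < real T" using reals_Archimedean2 by blast
      then have "\<rho> (Suc i) \<omega> \<noteq> \<rho> i \<omega>"
        using elim \<open>1 \<le> i\<close> unfolding bad_def by blast
      then show "\<rho> i \<omega> < \<rho> (Suc i) \<omega>"
        using \<rho>_mono[of \<omega> i "Suc i"] elim by simp
    qed
  qed
qed

end

section \<open>Exponential gaps from independent counts on a grid\<close>

context line_process
begin

text \<open>The exponential factor comes from the independence of the cells of a grid of width \<open>d\<close>.\<close>

lemma prob_grid_cell: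
  fixes d :: real and a :: "nat \<Rightarrow> nat" and l J K :: nat
  assumes d: "0 < d" and l: "1 \<le> l" and I: "I \<subseteq> {1..l}"
  shows "prob {\<omega> \<in> space M. (\<forall>i\<in>I. \<rho> i \<omega> < real (a i) * d) \<and> real J * d \<le> \<rho> l \<omega> \<and>
        \<rho> l \<omega> < real (Suc J) * d \<and> real (Suc J + K) * d \<le> \<rho> (Suc l) \<omega>}
    = exp (- \<mu> * (real K * d)) * prob {\<omega> \<in> space M. (\<forall>i\<in>I. \<rho> i \<omega> < real (a i) * d) \<and> real J * d \<le> \<rho> l \<omega> \<and>
        \<rho> l \<omega> < real (Suc J) * d \<and> real (Suc J) * d \<le> \<rho> (Suc l) \<omega>}"
proof (cases "K = 0")
  case False
  \<comment> \<open>Cells up to \<open>J\<close> are kept separate, the \<open>K\<close> cells after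
    them are merged into one block, and the sequence is padded by empty sets because
    \<open>homogeneous_PPP\<close> speaks of infinite families.\<close>
  define B where "B j = (if j \<le> J then strip (real j * d) (real (Suc j) * d)
      else if j = Suc J then strip (real (Suc J) * d) (real (Suc J + K) * d) else {})" for j
  define cnt where "cnt j \<omega> = card (\<Phi> \<omega> \<inter> B j)" for j \<omega>
  \<comment> \<open>The event in terms of cell counts. Capping \<open>a i\<close> at
    \<open>Suc J\<close> is harmless since \<open>\<rho> i \<le> \<rho> l\<close>, and it makes
    \<open>Q\<close> a function of the counts up to cell \<open>J\<close>. Exactly \<open>l\<close>
    lines by the end of cell \<open>J\<close> and fewer before its start place the
    \<open>l\<close>-th line in that cell and the next line beyond it.\<close>
  define Q where "Q x \<longleftrightarrow> (\<forall>i\<in>I. i \<le> (\<Sum>j<min (a i) (Suc J). x j)) \<and>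
      (\<Sum>j<J. x j) < l \<and> (\<Sum>j<Suc J. x j) = l" for x :: "nat \<Rightarrow> nat"
  have B: "bounded (B j)" "B j \<in> sets borel" for j
    by (auto simp: B_def bounded_strip sets_strip)
  have "disjoint_family B"
    unfolding disjoint_family_on_def
  proof (intro ballI impI)
    have disj: "B i \<inter> B j = {}" if "i < j" for i j
    proof -
      have "real (Suc i) * d \<le> real j * d"
        using that d by (intro mult_right_mono) auto
      then show ?thesis
        using that by (auto simp: B_def strip_def)
    qed
    fix i j :: nat assume "i \<noteq> j"
    then consider "i < j" | "j < i" by linarith
    then show "B i \<inter> B j = {}"
      by cases (use disj[of i j] disj[of j i] in auto)
  qed
  with PPP B have ind: "indep_vars (\<lambda>_. count_space UNIV) cnt UNIV"
    unfolding homogeneous_PPP_def cnt_def[abs_def] by blast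
  have indJ: "indep_var (PiM {..J} (\<lambda>_. count_space UNIV)) (\<lambda>\<omega>. restrict (\<lambda>j. cnt j \<omega>) {..J})
      (PiM {Suc J} (\<lambda>_. count_space UNIV)) (\<lambda>\<omega>. restrict (\<lambda>j. cnt j \<omega>) {Suc J})"
    by (rule indep_var_restrict[OF ind]) auto
  let ?Q = "{x \<in> {..J} \<rightarrow>\<^sub>E UNIV. Q x}" and ?Z = "{x \<in> {Suc J} \<rightarrow>\<^sub>E (UNIV :: nat set). x (Suc J) = 0}"
  have "?Q \<in> sets (PiM {..J} (\<lambda>_. count_space UNIV))" "?Z \<in> sets (PiM {Suc J} (\<lambda>_. count_space UNIV))"
    by (subst count_space_PiM_finite; auto)+
  note indep_varD[OF indJ this]
  moreover have "(\<lambda>\<omega>. (restrict (\<lambda>j. cnt j \<omega>) {..J}, restrict (\<lambda>j. cnt j \<omega>) {Suc J})) -` (?Q \<times> ?Z) \<inter> space M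
      = {\<omega> \<in> space M. Q (restrict (\<lambda>j. cnt j \<omega>) {..J}) \<and> cnt (Suc J) \<omega> = 0}"
    by auto
  moreover have "(\<lambda>\<omega>. restrict (\<lambda>j. cnt j \<omega>) {..J}) -` ?Q \<inter> space M
      = {\<omega> \<in> space M. Q (restrict (\<lambda>j. cnt j \<omega>) {..J})}"
    by auto
  moreover have "(\<lambda>\<omega>. restrict (\<lambda>j. cnt j \<omega>) {Suc J}) -` ?Z \<inter> space M = {\<omega> \<in> space M. cnt (Suc J) \<omega> = 0}"
    by auto
  moreover have "Q (restrict (\<lambda>j. cnt j \<omega>) {..J}) \<longleftrightarrow> Q (\<lambda>j. cnt j \<omega>)" for \<omega>
  proof -
    have "(\<Sum>j<k. restrict (\<lambda>j. cnt j \<omega>) {..J} j) = (\<Sum>j<k. cnt j \<omega>)" if "k \<le> Suc J" for k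
      using that by (intro sum.cong) auto
    then show ?thesis unfolding Q_def by simp
  qed
  ultimately have indep: "prob {\<omega> \<in> space M. Q (\<lambda>j. cnt j \<omega>) \<and> cnt (Suc J) \<omega> = 0}
      = prob {\<omega> \<in> space M. Q (\<lambda>j. cnt j \<omega>)} * prob {\<omega> \<in> space M. cnt (Suc J) \<omega> = 0}"
    by simp
  have "prob {\<omega> \<in> space M. cnt (Suc J) \<omega> = 0} = exp (- (\<mu> * (real (Suc J + K) * d - real (Suc J) * d)))"
    unfolding cnt_def B_def using prob_strip[of "real (Suc J) * d" "real (Suc J + K) * d" 0] d False by simp
  then have empty: "prob {\<omega> \<in> space M. cnt (Suc J) \<omega> = 0} = exp (- \<mu> * (real K * d))"
    by (simp add: algebra_simps)
  have sum_cnt: "card (lines_within (\<Phi> \<omega>) (real k * d)) = (\<Sum>j<k. cnt j \<omega>)"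
    if "\<omega> \<in> space M" "k \<le> Suc J" for k \<omega>
    using that(2)
  proof (induction k)
    case 0
    then show ?case using lines_within_nonpos[OF line_config_\<Phi>[OF that(1)]] by simp
  next
    case (Suc k)
    have "card (lines_within (\<Phi> \<omega>) (real (Suc k) * d))
        = card (lines_within (\<Phi> \<omega>) (real k * d)) + card (\<Phi> \<omega> \<inter> strip (real k * d) (real (Suc k) * d))"
      using d by (intro card_lines_within_add[OF line_config_\<Phi>[OF that(1)]]) auto
    then show ?case using Suc by (simp add: cnt_def B_def)
  qed
  have iffQ: "(\<forall>i\<in>I. \<rho> i \<omega> < real (a i) * d) \<and> real J * d \<le> \<rho> l \<omega> \<and>
        \<rho> l \<omega> < real (Suc J) * d \<and> real (Suc J) * d \<le> \<rho> (Suc l) \<omega> \<longleftrightarrow> Q (\<lambda>j. cnt j \<omega>)" (is ?a)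
    and iffZ: "(\<forall>i\<in>I. \<rho> i \<omega> < real (a i) * d) \<and> real J * d \<le> \<rho> l \<omega> \<and>
        \<rho> l \<omega> < real (Suc J) * d \<and> real (Suc J + K) * d \<le> \<rho> (Suc l) \<omega> \<longleftrightarrow>
        Q (\<lambda>j. cnt j \<omega>) \<and> cnt (Suc J) \<omega> = 0" (is ?b)
    if \<omega>: "\<omega> \<in> space M" and has: "\<forall>i. has_nth (\<Phi> \<omega>) i" for \<omega>
  proof -
    let ?C = "\<lambda>c. card (lines_within (\<Phi> \<omega>) c)"
    note less = \<rho>_less_iff[OF \<omega> spec[OF has]]
    have le: "c \<le> \<rho> i \<omega> \<longleftrightarrow> ?C c < i" if "1 \<le> i" for i c
      using less[OF that, of c] by linarith
    have part: "(\<forall>i\<in>I. \<rho> i \<omega> < real (a i) * d) \<longleftrightarrow> (\<forall>i\<in>I. i \<le> (\<Sum>j<min (a i) (Suc J). cnt j \<omega>))"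
      if lJ: "\<rho> l \<omega> < real (Suc J) * d"
    proof (intro ball_cong refl)
      fix i assume i: "i \<in> I"
      then have "\<rho> i \<omega> \<le> \<rho> l \<omega>"
        using I by (intro \<rho>_mono[OF \<omega> has]) auto
      with lJ have "\<rho> i \<omega> < real (Suc J) * d" by linarith
      moreover have "real (min (a i) (Suc J)) * d = min (real (a i) * d) (real (Suc J) * d)"
        unfolding of_nat_min by (rule min_mult_distrib_right[THEN trans]) (use d in auto)
      ultimately have "\<rho> i \<omega> < real (a i) * d \<longleftrightarrow> \<rho> i \<omega> < real (min (a i) (Suc J)) * d"
        by simp
      also have "\<dots> \<longleftrightarrow> i \<le> ?C (real (min (a i) (Suc J)) * d)"
        using i I by (intro less) auto
      also have "?C (real (min (a i) (Suc J)) * d) = (\<Sum>j<min (a i) (Suc J). cnt j \<omega>)"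
        by (rule sum_cnt[OF \<omega>]) simp
      finally show "\<rho> i \<omega> < real (a i) * d \<longleftrightarrow> i \<le> (\<Sum>j<min (a i) (Suc J). cnt j \<omega>)" .
    qed
    have J1: "real J * d \<le> \<rho> l \<omega> \<longleftrightarrow> (\<Sum>j<J. cnt j \<omega>) < l"
      using le[OF l] sum_cnt[OF \<omega>, of J] by simp
    have J2: "\<rho> l \<omega> < real (Suc J) * d \<longleftrightarrow> l \<le> (\<Sum>j<Suc J. cnt j \<omega>)"
      using less[OF l] sum_cnt[OF \<omega>, of "Suc J"] by simp
    have J3: "real (Suc J) * d \<le> \<rho> (Suc l) \<omega> \<longleftrightarrow> (\<Sum>j<Suc J. cnt j \<omega>) \<le> l"
      using le[of "Suc l"] sum_cnt[OF \<omega>, of "Suc J"] by (simp add: less_Suc_eq_le)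
    have "?C (real (Suc J + K) * d) = ?C (real (Suc J) * d) + cnt (Suc J) \<omega>"
      unfolding cnt_def B_def using d
      by (subst card_lines_within_add[OF line_config_\<Phi>[OF \<omega>], of "real (Suc J) * d"]) (auto intro!: mult_right_mono)
    then have J4: "real (Suc J + K) * d \<le> \<rho> (Suc l) \<omega> \<longleftrightarrow> (\<Sum>j<Suc J. cnt j \<omega>) + cnt (Suc J) \<omega> \<le> l"
      using le[of "Suc l"] sum_cnt[OF \<omega>, of "Suc J"] by (simp add: less_Suc_eq_le)
    show ?a
      unfolding Q_def J1 J2[symmetric] J3 using part J2 by (auto simp del: sum.lessThan_Suc)
    show ?b
      unfolding Q_def J1 J4 using part J2 by (auto simp del: sum.lessThan_Suc)
  qed
  have [measurable]: "cnt j \<in> measurable M (count_space UNIV)" for j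
    using ind by (auto simp: indep_vars_def)
  have countI: "countable I" by (rule countable_subset[OF subset_UNIV]) simp
  have [measurable]: "Measurable.pred M (\<lambda>\<omega>. Q (\<lambda>j. cnt j \<omega>))"
    unfolding Q_def using countI by measurable
  have "prob {\<omega> \<in> space M. (\<forall>i\<in>I. \<rho> i \<omega> < real (a i) * d) \<and> real J * d \<le> \<rho> l \<omega> \<and>
        \<rho> l \<omega> < real (Suc J) * d \<and> real (Suc J + K) * d \<le> \<rho> (Suc l) \<omega>}
      = prob {\<omega> \<in> space M. Q (\<lambda>j. cnt j \<omega>) \<and> cnt (Suc J) \<omega> = 0}" (is "prob ?LZ = prob ?RZ")
  proof (rule finite_measure_eq_AE)
    show "AE \<omega> in M. \<omega> \<in> ?LZ \<longleftrightarrow> \<omega> \<in> ?RZ"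
      using AE_has_nth AE_space
    proof eventually_elim
      case (elim \<omega>)
      show ?case using iffZ[OF elim(2,1)] elim(2) by (simp only: mem_Collect_eq)
    qed
  qed (use countI in measurable)
  moreover have "prob {\<omega> \<in> space M. (\<forall>i\<in>I. \<rho> i \<omega> < real (a i) * d) \<and> real J * d \<le> \<rho> l \<omega> \<and>
        \<rho> l \<omega> < real (Suc J) * d \<and> real (Suc J) * d \<le> \<rho> (Suc l) \<omega>}
      = prob {\<omega> \<in> space M. Q (\<lambda>j. cnt j \<omega>)}" (is "prob ?LQ = prob ?RQ")
  proof (rule finite_measure_eq_AE)
    show "AE \<omega> in M. \<omega> \<in> ?LQ \<longleftrightarrow> \<omega> \<in> ?RQ"
      using AE_has_nth AE_space
    proof eventually_elim
      case (elim \<omega>)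
      show ?case using iffQ[OF elim(2,1)] elim(2) by (simp only: mem_Collect_eq)
    qed
  qed (use countI in measurable)
  ultimately show ?thesis
    using indep empty by simp
qed simp

text \<open>The cell of the \<open>l\<close>-th line is random. Summing over its possible indices
  \<open>J\<close> removes it, since the factor \<open>exp (- \<mu> * (real K * d))\<close> is the
  same for all of them.\<close>

lemma prob_grid:
  fixes d :: real and a :: "nat \<Rightarrow> nat" and l K :: nat
  assumes d: "0 < d" and l: "1 \<le> l" and I: "I \<subseteq> {1..l}"
  shows "prob {\<omega> \<in> space M. (\<forall>i\<in>I. \<rho> i \<omega> < real (a i) * d) \<and> real (Suc (nat \<lfloor>\<rho> l \<omega> / d\<rfloor>) + K) * d \<le> \<rho> (Suc l) \<omega>}
    = exp (- \<mu> * (real K * d)) * prob {\<omega> \<in> space M. (\<forall>i\<in>I. \<rho> i \<omega> < real (a i) * d) \<and>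
        real (Suc (nat \<lfloor>\<rho> l \<omega> / d\<rfloor>)) * d \<le> \<rho> (Suc l) \<omega>}"
proof -
  define A where "A K J = {\<omega> \<in> space M. (\<forall>i\<in>I. \<rho> i \<omega> < real (a i) * d) \<and> real J * d \<le> \<rho> l \<omega> \<and>
        \<rho> l \<omega> < real (Suc J) * d \<and> real (Suc J + K) * d \<le> \<rho> (Suc l) \<omega>}" for K J
  have countI: "countable I" by (rule countable_subset[OF subset_UNIV]) simp
  have [measurable]: "A K J \<in> events" for K J
    unfolding A_def using countI by measurable
  have floor: "real J * d \<le> x \<and> x < real (Suc J) * d \<longleftrightarrow> nat \<lfloor>x / d\<rfloor> = J" if "0 \<le> x" for x J
  proof -
    have "real J * d \<le> x \<and> x < real (Suc J) * d \<longleftrightarrow> real J \<le> x / d \<and> x / d < real J + 1"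
      using d by (simp add: field_simps)
    also have "\<dots> \<longleftrightarrow> \<lfloor>x / d\<rfloor> = int J"
      by (simp add: floor_eq_iff)
    also have "\<dots> \<longleftrightarrow> nat \<lfloor>x / d\<rfloor> = J"
      using that d by (auto simp: nat_eq_iff)
    finally show ?thesis .
  qed
  have sums: "(\<lambda>J. prob (A K J)) sums prob {\<omega> \<in> space M. (\<forall>i\<in>I. \<rho> i \<omega> < real (a i) * d) \<and>
      real (Suc (nat \<lfloor>\<rho> l \<omega> / d\<rfloor>) + K) * d \<le> \<rho> (Suc l) \<omega>}" for K
  proof -
    have "disjoint_family (A K)"
      unfolding disjoint_family_on_def
    proof (intro ballI impI equals0I)
      fix i j :: nat and \<omega> assume "i \<noteq> j" and \<omega>: "\<omega> \<in> A K i \<inter> A K j"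
      have "0 \<le> real i * d" using d by simp
      with \<omega> have "0 \<le> \<rho> l \<omega>" by (auto simp: A_def)
      from \<omega> floor[OF this, of i] floor[OF this, of j] have "i = j"
        by (auto simp: A_def)
      with \<open>i \<noteq> j\<close> show False by simp
    qed
    then have "(\<lambda>J. prob (A K J)) sums prob (\<Union>J. A K J)"
      by (intro finite_measure_UNION) auto
    also have "prob (\<Union>J. A K J) = prob {\<omega> \<in> space M. (\<forall>i\<in>I. \<rho> i \<omega> < real (a i) * d) \<and>
        real (Suc (nat \<lfloor>\<rho> l \<omega> / d\<rfloor>) + K) * d \<le> \<rho> (Suc l) \<omega>}"
    proof (rule finite_measure_eq_AE)
      show "AE \<omega> in M. \<omega> \<in> (\<Union>J. A K J) \<longleftrightarrow> \<omega> \<in> {\<omega> \<in> space M. (\<forall>i\<in>I. \<rho> i \<omega> < real (a i) * d) \<and>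
          real (Suc (nat \<lfloor>\<rho> l \<omega> / d\<rfloor>) + K) * d \<le> \<rho> (Suc l) \<omega>}"
        using AE_has_nth AE_space
      proof eventually_elim
        case (elim \<omega>)
        have "0 \<le> \<rho> l \<omega>" using \<rho>_nonneg elim by blast
        note fl = floor[OF this]
        have "real (nat \<lfloor>\<rho> l \<omega> / d\<rfloor>) * d \<le> \<rho> l \<omega> \<and> \<rho> l \<omega> < real (Suc (nat \<lfloor>\<rho> l \<omega> / d\<rfloor>)) * d"
          by (simp add: fl del: of_nat_Suc)
        moreover have "nat \<lfloor>\<rho> l \<omega> / d\<rfloor> = J" if "real J * d \<le> \<rho> l \<omega>" "\<rho> l \<omega> < real (Suc J) * d" for J
          using fl that by blast
        ultimately show ?case
          using elim(2) unfolding A_def by (auto simp del: of_nat_Suc of_nat_add)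
      qed
    qed (use countI in measurable)
    finally show ?thesis .
  qed
  have "(\<lambda>J. exp (- \<mu> * (real K * d)) * prob (A 0 J)) sums
      (exp (- \<mu> * (real K * d)) * prob {\<omega> \<in> space M. (\<forall>i\<in>I. \<rho> i \<omega> < real (a i) * d) \<and>
        real (Suc (nat \<lfloor>\<rho> l \<omega> / d\<rfloor>) + 0) * d \<le> \<rho> (Suc l) \<omega>})"
    by (intro sums_mult sums)
  moreover have "exp (- \<mu> * (real K * d)) * prob (A 0 J) = prob (A K J)" for J
    unfolding A_def using prob_grid_cell[OF assms, where a = a and J = J and K = K] by simp
  ultimately show ?thesis
    using sums_unique2[OF sums[of K]] by simp
qed

end

text \<open>Thresholds are rounded down, so an approximation never overshoots
  \<open>max 0 c\<close>. For nonnegative \<open>x\<close> the boundary case \<open>x = c\<close> is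
  then harmless, and no exceptional set arises.\<close>

lemma eventually_floor_less_iff:
  fixes c x :: real
  assumes "0 \<le> x"
  shows "\<forall>\<^sub>F m in sequentially. x < real (nat \<lfloor>c * real (Suc m)\<rfloor>) * inverse (real (Suc m)) \<longleftrightarrow> x < c"
proof -
  define w where "w m = real (nat \<lfloor>c * real (Suc m)\<rfloor>) * inverse (real (Suc m))" for m
  have w_le: "w m \<le> max 0 c" and w_ge: "max 0 c - inverse (real (Suc m)) \<le> w m" for m
  proof -
    have "real (nat \<lfloor>c * real (Suc m)\<rfloor>) \<le> max 0 (c * real (Suc m))" by linarith
    also have "\<dots> = max 0 c * real (Suc m)"
      by (simp add: max_def zero_le_mult_iff)
    finally show "w m \<le> max 0 c"
      unfolding w_def by (simp add: field_simps del: of_nat_Suc)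
    have "max 0 c * real (Suc m) - 1 = max 0 (c * real (Suc m)) - 1"
      by (simp add: max_def zero_le_mult_iff)
    also have "\<dots> \<le> real (nat \<lfloor>c * real (Suc m)\<rfloor>)" by linarith
    finally have "(max 0 c * real (Suc m) - 1) * inverse (real (Suc m)) \<le> w m"
      unfolding w_def by (rule mult_right_mono) simp
    then show "max 0 c - inverse (real (Suc m)) \<le> w m"
      by (simp add: left_diff_distrib mult.assoc del: of_nat_Suc)
  qed
  have "(\<lambda>m. max 0 c - inverse (real (Suc m))) \<longlonglongrightarrow> max 0 c - 0"
    by (intro tendsto_diff tendsto_const LIMSEQ_inverse_real_of_nat)
  then have "(\<lambda>m. max 0 c - inverse (real (Suc m))) \<longlonglongrightarrow> max 0 c" by simp
  then have lim: "w \<longlonglongrightarrow> max 0 c"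
    by (rule tendsto_sandwich[OF _ _ _ tendsto_const, rotated 2]) (use w_le w_ge in auto)
  show ?thesis
  proof (cases "x < c")
    case True
    then have "\<forall>\<^sub>F m in sequentially. x < w m"
      by (intro order_tendstoD(1)[OF lim]) simp
    then show ?thesis by (rule eventually_mono) (use True in \<open>simp add: w_def\<close>)
  next
    case False
    then have "w m \<le> x" for m using w_le[of m] assms by linarith
    then show ?thesis using False by (simp add: w_def not_less)
  qed
qed

lemma ceiling_grid:
  fixes s :: real
  assumes "0 \<le> s"
  shows "s \<le> real (nat \<lceil>s * real (Suc m)\<rceil>) * inverse (real (Suc m))"
    and "(\<lambda>m. real (nat \<lceil>s * real (Suc m)\<rceil>) * inverse (real (Suc m))) \<longlonglongrightarrow> s"
proof -
  have ge: "s \<le> real (nat \<lceil>s * real (Suc m)\<rceil>) * inverse (real (Suc m))" for m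
  proof -
    have "s * real (Suc m) \<le> real (nat \<lceil>s * real (Suc m)\<rceil>)" by linarith
    then show ?thesis by (simp add: field_simps del: of_nat_Suc)
  qed
  then show "s \<le> real (nat \<lceil>s * real (Suc m)\<rceil>) * inverse (real (Suc m))" .
  have le: "real (nat \<lceil>s * real (Suc m)\<rceil>) * inverse (real (Suc m)) \<le> s + inverse (real (Suc m))" for m
  proof -
    have "0 \<le> s * real (Suc m)" using assms by simp
    then have "real (nat \<lceil>s * real (Suc m)\<rceil>) \<le> s * real (Suc m) + 1" by linarith
    then show ?thesis by (simp add: field_simps del: of_nat_Suc)
  qed
  have lim: "(\<lambda>m. s + inverse (real (Suc m))) \<longlonglongrightarrow> s + 0"
    by (intro tendsto_add tendsto_const LIMSEQ_inverse_real_of_nat)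
  show "(\<lambda>m. real (nat \<lceil>s * real (Suc m)\<rceil>) * inverse (real (Suc m))) \<longlonglongrightarrow> s"
    by (rule tendsto_sandwich[OF always_eventually always_eventually tendsto_const lim[simplified add_0_right]])
      (use ge le in blast)+
qed

text \<open>The grid point exceeds \<open>x + s\<close> strictly, being the end of the cell of
  \<open>x\<close> plus a shift rounded up. So both sides fail at \<open>y = x + s\<close>, and a
  nonstrict comparison turns into a strict one in the limit.\<close>

lemma eventually_grid_le_iff:
  fixes x y s :: real
  assumes "0 \<le> x" and K: "\<And>m. s \<le> real (K m) * inverse (real (Suc m))"
    and lim: "(\<lambda>m. real (K m) * inverse (real (Suc m))) \<longlonglongrightarrow> s"
  shows "\<forall>\<^sub>F m in sequentially.
    real (Suc (nat \<lfloor>x / inverse (real (Suc m))\<rfloor>) + K m) * inverse (real (Suc m)) \<le> y \<longleftrightarrow> x + s < y"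
proof -
  define u where "u m = real (Suc (nat \<lfloor>x / inverse (real (Suc m))\<rfloor>) + K m) * inverse (real (Suc m))" for m
  have u_gt: "x + s < u m" and u_le: "u m \<le> x + inverse (real (Suc m)) + real (K m) * inverse (real (Suc m))" for m
  proof -
    have nn: "0 \<le> x / inverse (real (Suc m))" using assms(1) by simp
    have "x < real (Suc (nat \<lfloor>x / inverse (real (Suc m))\<rfloor>)) * inverse (real (Suc m))"
    proof -
      have "x / inverse (real (Suc m)) < real (Suc (nat \<lfloor>x / inverse (real (Suc m))\<rfloor>))" by linarith
      then show ?thesis by (simp only: pos_divide_less_eq positive_imp_inverse_positive of_nat_0_less_iff zero_less_Suc)
    qed
    with K[of m] show "x + s < u m"
      unfolding u_def of_nat_add distrib_right by linarith
    have "real (nat \<lfloor>x / inverse (real (Suc m))\<rfloor>) \<le> x / inverse (real (Suc m))" using nn by linarith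
    then have "real (nat \<lfloor>x / inverse (real (Suc m))\<rfloor>) * inverse (real (Suc m)) \<le> x"
      by (simp only: pos_le_divide_eq positive_imp_inverse_positive of_nat_0_less_iff zero_less_Suc)
    then show "u m \<le> x + inverse (real (Suc m)) + real (K m) * inverse (real (Suc m))"
      unfolding u_def of_nat_add distrib_right of_nat_Suc[of "nat _"] by linarith
  qed
  have lim_u: "(\<lambda>m. x + inverse (real (Suc m)) + real (K m) * inverse (real (Suc m))) \<longlonglongrightarrow> x + 0 + s"
    by (intro tendsto_add tendsto_const LIMSEQ_inverse_real_of_nat lim)
  have ulim: "u \<longlonglongrightarrow> x + s"
    by (rule tendsto_sandwich[OF always_eventually always_eventually tendsto_const lim_u[simplified add_0_right]])
      (use less_imp_le[OF u_gt] u_le in blast)+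
  show ?thesis
  proof (cases "x + s < y")
    case True
    then have "\<forall>\<^sub>F m in sequentially. u m < y"
      by (intro order_tendstoD(2)[OF ulim])
    then show ?thesis by (rule eventually_mono) (use True in \<open>simp add: u_def\<close>)
  next
    case False
    then have "y < u m" for m using u_gt[of m] by linarith
    then show ?thesis using False by (simp add: u_def not_le)
  qed
qed

context line_process
begin

text \<open>The memoryless property at the random distance \<open>\<rho> l\<close>, tested against
  the past: in \<open>prob_grid\<close> the mesh tends to 0 while \<open>K\<close> cells keep a
  total width close to \<open>s\<close>.\<close>

lemma prob_gap:
  assumes l: "1 \<le> l" and I: "I \<subseteq> {1..l}" and s: "0 \<le> s"
  shows "prob {\<omega> \<in> space M. (\<forall>i\<in>I. \<rho> i \<omega> < c i) \<and> \<rho> l \<omega> + s < \<rho> (Suc l) \<omega>}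
    = exp (- \<mu> * s) * prob {\<omega> \<in> space M. \<forall>i\<in>I. \<rho> i \<omega> < c i}"
proof -
  have countI: "countable I" and finI: "finite I"
    using I finite_subset by (auto intro: countable_finite)
  define d where "d m = inverse (real (Suc m))" for m
  define a where "a m i = nat \<lfloor>c i * real (Suc m)\<rfloor>" for m i
  define A where "A K m = {\<omega> \<in> space M. (\<forall>i\<in>I. \<rho> i \<omega> < real (a m i) * d m) \<and>
      real (Suc (nat \<lfloor>\<rho> l \<omega> / d m\<rfloor>) + K) * d m \<le> \<rho> (Suc l) \<omega>}" for K :: nat and m
  have [measurable]: "A K m \<in> events" for K m
    unfolding A_def using countI by measurable
  have lim: "(\<lambda>m. prob (A (K m) m)) \<longlonglongrightarrow>
      prob {\<omega> \<in> space M. (\<forall>i\<in>I. \<rho> i \<omega> < c i) \<and> \<rho> l \<omega> + s < \<rho> (Suc l) \<omega>}"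
    if K: "\<And>m. s \<le> real (K m) * d m" "(\<lambda>m. real (K m) * d m) \<longlonglongrightarrow> s" for K :: "nat \<Rightarrow> nat" and s
  proof (rule prob_tendsto_eventually)
    show "AE \<omega> in M. \<forall>\<^sub>F m in sequentially. \<omega> \<in> A (K m) m \<longleftrightarrow>
        \<omega> \<in> {\<omega> \<in> space M. (\<forall>i\<in>I. \<rho> i \<omega> < c i) \<and> \<rho> l \<omega> + s < \<rho> (Suc l) \<omega>}"
      using AE_has_nth AE_space
    proof eventually_elim
      case (elim \<omega>)
      have nn: "0 \<le> \<rho> i \<omega>" for i using \<rho>_nonneg elim by blast
      have "\<forall>\<^sub>F m in sequentially. \<forall>i\<in>I. \<rho> i \<omega> < real (a m i) * d m \<longleftrightarrow> \<rho> i \<omega> < c i"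
        unfolding a_def d_def using finI nn by (intro eventually_ball_finite ballI eventually_floor_less_iff)
      moreover have "\<forall>\<^sub>F m in sequentially. real (Suc (nat \<lfloor>\<rho> l \<omega> / d m\<rfloor>) + K m) * d m \<le> \<rho> (Suc l) \<omega> \<longleftrightarrow>
          \<rho> l \<omega> + s < \<rho> (Suc l) \<omega>"
        using K nn unfolding d_def by (intro eventually_grid_le_iff)
      ultimately show ?case
        by eventually_elim (use elim in \<open>auto simp: A_def\<close>)
    qed
  qed (use countI in measurable)
  define K where "K m = nat \<lceil>s * real (Suc m)\<rceil>" for m
  have K: "s \<le> real (K m) * d m" "(\<lambda>m. real (K m) * d m) \<longlonglongrightarrow> s" for m
    unfolding K_def d_def using ceiling_grid[OF s] by auto
  \<comment> \<open>The same limit is taken with no extra cells, which identifies the second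
    factor.\<close>
  have 0: "0 \<le> real 0 * d m" "(\<lambda>m. real 0 * d m) \<longlonglongrightarrow> 0" for m by auto
  have "prob (A (K m) m) = exp (- \<mu> * (real (K m) * d m)) * prob (A 0 m)" for m
    unfolding A_def using prob_grid[OF _ l I, of "d m" "a m" "K m"] by (simp add: d_def)
  moreover have "(\<lambda>m. exp (- \<mu> * (real (K m) * d m)) * prob (A 0 m)) \<longlonglongrightarrow> exp (- \<mu> * s) *
      prob {\<omega> \<in> space M. (\<forall>i\<in>I. \<rho> i \<omega> < c i) \<and> \<rho> l \<omega> + 0 < \<rho> (Suc l) \<omega>}"
    by (intro tendsto_intros K lim 0)
  ultimately have "prob {\<omega> \<in> space M. (\<forall>i\<in>I. \<rho> i \<omega> < c i) \<and> \<rho> l \<omega> + s < \<rho> (Suc l) \<omega>} = exp (- \<mu> * s) *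
      prob {\<omega> \<in> space M. (\<forall>i\<in>I. \<rho> i \<omega> < c i) \<and> \<rho> l \<omega> + 0 < \<rho> (Suc l) \<omega>}"
    using LIMSEQ_unique[OF lim[OF K]] by simp
  \<comment> \<open>For \<open>s = 0\<close> the gap condition holds almost surely, because ties are
    null.\<close>
  also have "prob {\<omega> \<in> space M. (\<forall>i\<in>I. \<rho> i \<omega> < c i) \<and> \<rho> l \<omega> + 0 < \<rho> (Suc l) \<omega>}
      = prob {\<omega> \<in> space M. \<forall>i\<in>I. \<rho> i \<omega> < c i}"
  proof (rule finite_measure_eq_AE)
    show "AE \<omega> in M. \<omega> \<in> {\<omega> \<in> space M. (\<forall>i\<in>I. \<rho> i \<omega> < c i) \<and> \<rho> l \<omega> + 0 < \<rho> (Suc l) \<omega>} \<longleftrightarrow>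
        \<omega> \<in> {\<omega> \<in> space M. \<forall>i\<in>I. \<rho> i \<omega> < c i}"
      using AE_\<rho>_strict by eventually_elim (use l in auto)
  qed (use countI in measurable)
  finally show ?thesis .
qed

section \<open>The history of the first distances and its independence of the next gap\<close>

text \<open>A generator of the sigma-algebra of \<open>\<rho> 1, ..., \<rho> l\<close>. The free
  index set \<open>I\<close> stands in for infinite thresholds; it makes the family closed under
  intersection and increasing in \<open>l\<close>.\<close>

definition history :: "nat \<Rightarrow> 'w set set" where
  "history l = {{\<omega> \<in> space M. \<forall>i\<in>I. \<rho> i \<omega> < c i} | I c. I \<subseteq> {1..l}}"

definition F :: "nat \<Rightarrow> 'w measure" where
  "F l = sigma (space M) (history l)"

lemma history_events: "history l \<subseteq> events"
proof -
  have "{\<omega> \<in> space M. \<forall>i\<in>I. \<rho> i \<omega> < c i} \<in> events" if "I \<subseteq> {1..l}" for I c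
  proof -
    have "countable I" by (rule countable_subset[OF subset_UNIV]) simp
    then show ?thesis by measurable
  qed
  then show ?thesis by (auto simp: history_def)
qed

lemma space_F [simp]: "space (F l) = space M"
  and sets_F: "sets (F l) = sigma_sets (space M) (history l)"
  using history_events sets.space_closed unfolding F_def
  by (blast intro!: space_measure_of sets_measure_of)+

lemma subalgebra_F: "subalgebra M (F l)"
  unfolding subalgebra_def sets_F using sets.sigma_sets_subset[OF history_events] by simp

lemma measurable_F_M: "f \<in> measurable (F l) N \<Longrightarrow> f \<in> measurable M N"
  by (rule measurable_from_subalg[OF subalgebra_F])

lemma borel_measurable_\<rho>_F: "1 \<le> i \<Longrightarrow> i \<le> l \<Longrightarrow> \<rho> i \<in> borel_measurable (F l)"
proof (rule borel_measurable_iff_less[THEN iffD2], intro allI)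
  fix c assume "1 \<le> i" "i \<le> l"
  then have "{\<omega> \<in> space (F l). \<rho> i \<omega> < c} \<in> history l"
    unfolding history_def space_F by (intro CollectI exI[of _ "{i}"] exI[of _ "\<lambda>_. c"]) auto
  then show "{\<omega> \<in> space (F l). \<rho> i \<omega> < c} \<in> sets (F l)"
    unfolding sets_F by (rule sigma_sets.Basic)
qed

lemma sets_F_mono: "sets (F l) \<subseteq> sets (F (Suc l))"
  unfolding sets_F by (intro sigma_sets_mono') (force simp: history_def)

lemma measurable_F_Suc: "f \<in> measurable (F l) N \<Longrightarrow> f \<in> measurable (F (Suc l)) N"
  using sets_F_mono by (auto simp: measurable_def)

lemma Int_stable_history: "Int_stable (history l)"
proof (rule Int_stableI)
  fix A B assume "A \<in> history l" "B \<in> history l"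
  then obtain I J c d where A: "I \<subseteq> {1..l}" "A = {\<omega> \<in> space M. \<forall>i\<in>I. \<rho> i \<omega> < c i}"
    and B: "J \<subseteq> {1..l}" "B = {\<omega> \<in> space M. \<forall>i\<in>J. \<rho> i \<omega> < d i}"
    by (auto simp: history_def)
  define e where "e i = (if i \<in> I then if i \<in> J then min (c i) (d i) else c i else d i)" for i
  have "A \<inter> B = {\<omega> \<in> space M. \<forall>i\<in>I \<union> J. \<rho> i \<omega> < e i}"
    unfolding A B e_def by auto
  then show "A \<inter> B \<in> history l"
    unfolding history_def using A(1) B(1) by blast
qed

definition gap :: "nat \<Rightarrow> 'w \<Rightarrow> real" where
  "gap l \<omega> = \<rho> (Suc l) \<omega> - \<rho> l \<omega>"

lemma borel_measurable_gap [measurable]: "gap l \<in> borel_measurable M"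
  unfolding gap_def[abs_def] by measurable

lemma prob_gap_greater:
  assumes "1 \<le> l" "0 \<le> s"
  shows "prob {\<omega> \<in> space M. s < gap l \<omega>} = exp (- \<mu> * s)"
  using prob_gap[OF assms(1) empty_subsetI assms(2)] by (simp add: gap_def prob_space less_diff_eq add.commute)

lemma gap_distributed:
  assumes "1 \<le> l"
  shows "distributed M lborel (gap l) (exponential_density \<mu>)"
  unfolding exponential_distributed_iff[OF \<mu>_pos]
proof (intro conjI allI impI)
  fix s :: real assume "0 \<le> s"
  have "prob {\<omega> \<in> space M. gap l \<omega> \<le> s} = prob (space M - {\<omega> \<in> space M. s < gap l \<omega>})"
    by (intro arg_cong[where f = prob]) auto
  also have "\<dots> = 1 - exp (- \<mu> * s)"
    using prob_gap_greater[OF assms \<open>0 \<le> s\<close>] by (subst prob_compl) simp_all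
  finally show "\<P>(\<omega> in M. gap l \<omega> \<le> s) = 1 - exp (- s * \<mu>)"
    by (simp add: mult.commute)
qed simp

text \<open>Both sides have generators closed under intersection, the histories and the tails
  \<open>s < gap l\<close>. On these the product rule is \<open>prob_gap\<close>.\<close>

lemma indep_history_gap:
  assumes l: "1 \<le> l" and X: "X \<in> measurable (F l) S"
  shows "indep_elements S X borel (gap l)"
proof -
  let ?G = "{{\<omega> \<in> space M. s < gap l \<omega>} | s. True}"
  have G_events: "?G \<subseteq> events" by auto
  have "indep_set (history l) ?G"
  proof (rule indep_setI[OF history_events G_events])
    fix A B assume "A \<in> history l" "B \<in> ?G"
    then obtain I c s where A: "I \<subseteq> {1..l}" "A = {\<omega> \<in> space M. \<forall>i\<in>I. \<rho> i \<omega> < c i}"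
      and B: "B = {\<omega> \<in> space M. s < gap l \<omega>}"
      by (auto simp: history_def)
    have A_ev: "A \<in> events" using \<open>A \<in> history l\<close> history_events by blast
    show "prob (A \<inter> B) = prob A * prob B"
    proof (cases "0 \<le> s")
      case True
      have "A \<inter> B = {\<omega> \<in> space M. (\<forall>i\<in>I. \<rho> i \<omega> < c i) \<and> \<rho> l \<omega> + s < \<rho> (Suc l) \<omega>}"
        by (auto simp: A B gap_def)
      then show ?thesis
        using prob_gap[OF l A(1) True, of c] prob_gap_greater[OF l True] by (simp add: A(2) B)
    next
      \<comment> \<open>A negative level is exceeded almost surely, because the distances
        increase.\<close>
      case False
      have pos: "AE \<omega> in M. \<omega> \<in> B"
        using AE_\<rho>_strict AE_space by eventually_elim (use l False in \<open>force simp: B gap_def\<close>)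
      have B_ev: "B \<in> events" by (simp add: B)
      have "prob (A \<inter> B) = prob A"
        using pos by (intro finite_measure_eq_AE) (use A_ev B_ev in auto)
      moreover have "prob B = 1"
        using pos B_ev by (simp add: prob_eq_1)
      ultimately show ?thesis by simp
    qed
  qed
  moreover have "Int_stable ?G"
  proof (rule Int_stableI)
    fix A B assume "A \<in> ?G" "B \<in> ?G"
    then obtain s t where "A = {\<omega> \<in> space M. s < gap l \<omega>}" "B = {\<omega> \<in> space M. t < gap l \<omega>}" by blast
    then have "A \<inter> B = {\<omega> \<in> space M. max s t < gap l \<omega>}" by auto
    then show "A \<inter> B \<in> ?G" by blast
  qed
  ultimately have ind: "indep_set (sigma_sets (space M) (history l)) (sigma_sets (space M) ?G)"
    using Int_stable_history by (intro indep_set_sigma_sets)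
  have gap_G: "gap l \<in> borel_measurable (sigma (space M) ?G)"
  proof (rule borel_measurable_iff_greater[THEN iffD2], intro allI)
    fix s
    have G_Pow: "?G \<subseteq> Pow (space M)" by auto
    have "{\<omega> \<in> space M. s < gap l \<omega>} \<in> sigma_sets (space M) ?G"
      by (rule sigma_sets.Basic) blast
    then show "{\<omega> \<in> space (sigma (space M) ?G). s < gap l \<omega>} \<in> sets (sigma (space M) ?G)"
      unfolding sets_measure_of[OF G_Pow] space_measure_of[OF G_Pow] .
  qed
  have G_Pow: "?G \<subseteq> Pow (space M)" by auto
  have sub1: "{X -` A \<inter> space M |A. A \<in> sets S} \<subseteq> sigma_sets (space M) (history l)"
    using measurable_sets[OF X] by (auto simp: sets_F)
  have sub2: "{gap l -` A \<inter> space M |A. A \<in> sets borel} \<subseteq> sigma_sets (space M) ?G"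
    using measurable_sets[OF gap_G] unfolding sets_measure_of[OF G_Pow] space_measure_of[OF G_Pow] by blast
  show ?thesis
    unfolding indep_elements_def
  proof (intro conjI ballI)
    show "random_variable S X" by (rule measurable_F_M[OF X])
    fix A and B :: "real set" assume "A \<in> sets S" "B \<in> sets borel"
    then show "prob ((X -` A \<inter> space M) \<inter> (gap l -` B \<inter> space M))
        = prob (X -` A \<inter> space M) * prob (gap l -` B \<inter> space M)"
      using sub1 sub2 by (intro indep_setD[OF ind]) blast+
  qed simp
qed

text \<open>The single step of the induction over lines: what is known up to line \<open>l\<close>
  is kept, and the next gap is integrated against its exponential density.\<close>

lemma nn_integral_gap:
  assumes l: "1 \<le> l" and X: "X \<in> measurable (F l) S" and g[measurable]: "g \<in> borel_measurable (S \<Otimes>\<^sub>M borel)"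
  shows "(\<integral>\<^sup>+\<omega>. g (X \<omega>, gap l \<omega>) \<partial>M)
    = (\<integral>\<^sup>+\<omega>. \<integral>\<^sup>+s. ennreal (exponential_density \<mu> s) * g (X \<omega>, s) \<partial>lborel \<partial>M)"
proof -
  have [measurable]: "X \<in> measurable M S" by (rule measurable_F_M[OF X])
  have "(\<integral>\<^sup>+\<omega>'. g (X \<omega>, gap l \<omega>') \<partial>M) = (\<integral>\<^sup>+s. ennreal (exponential_density \<mu> s) * g (X \<omega>, s) \<partial>lborel)"
    if "\<omega> \<in> space M" for \<omega>
    using measurable_space[OF X, of \<omega>] that
    by (intro distributed_nn_integral[OF gap_distributed[OF l], symmetric]) simp
  then show ?thesis
    unfolding indep_elements_nn_integral[OF indep_history_gap[OF l X] g] by (intro nn_integral_cong)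
qed

end

section \<open>Lines beyond the serving line\<close>

text \<open>\<open>2 * sqrt (r\<^sup>2 - u\<^sup>2)\<close> is the length of the chord that a line at distance \<open>u\<close> cuts out of the disc of radius \<open>r\<close>.\<close>

definition void_prob :: "real \<Rightarrow> real \<Rightarrow> real \<Rightarrow> real" where
  "void_prob \<nu> r u = exp (- 2 * \<nu> * sqrt (r\<^sup>2 - u\<^sup>2))"

text \<open>Multiplied by \<open>\<mu>\<close>, this is the mean number of lines between
  \<open>y\<close> and \<open>r\<close> that survive a thinning which keeps a line iff it has no
  node in the disc.\<close>

definition void_mass :: "real \<Rightarrow> real \<Rightarrow> real \<Rightarrow> real" where
  "void_mass \<nu> y r = (LBINT u:{y..r}. void_prob \<nu> r u)"

lemma void_prob_pos: "0 < void_prob \<nu> r u"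
  by (simp add: void_prob_def)

text \<open>\<open>sqrt\<close> is extended to negative numbers as an odd function and is continuous
  everywhere, so the range \<open>u > r\<close> is covered too.\<close>

lemma continuous_void_prob: "continuous_on S (void_prob \<nu> r)"
  unfolding void_prob_def[abs_def] by (intro continuous_intros)

lemma void_mass_eq_integral: "void_mass \<nu> y r = integral {y..r} (void_prob \<nu> r)"
  unfolding void_mass_def
  by (rule set_borel_integral_eq_integral) (rule borel_integrable_atLeastAtMost', rule continuous_void_prob)

lemma void_mass_nonneg: "0 \<le> void_mass \<nu> y r"
  unfolding void_mass_def set_lebesgue_integral_def
  by (intro integral_nonneg_AE AE_I2) (auto simp: void_prob_def indicator_def)

text \<open>Integrating up to \<open>r + 1\<close> instead of \<open>r\<close> gives a two-sided
  derivative at \<open>u = r\<close>, which the fundamental theorem applied in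
  \<open>ahead_step\<close> asks for.\<close>

lemma void_mass_DERIV:
  assumes "a < u" "u < r + 1"
  shows "((\<lambda>u. integral {u..r + 1} (void_prob \<nu> r)) has_real_derivative - void_prob \<nu> r u) (at u)"
proof -
  have "((\<lambda>u. integral {u..r + 1} (void_prob \<nu> r)) has_real_derivative - void_prob \<nu> r u) (at u within {a..r + 1})"
    using assms by (intro integral_has_real_derivative' continuous_void_prob) auto
  moreover have "at u within {a..r + 1} = at u"
    using assms by (intro at_within_interior) auto
  ultimately show ?thesis by simp
qed

lemma void_mass_split:
  assumes "u \<le> r"
  shows "void_mass \<nu> u r = integral {u..r + 1} (void_prob \<nu> r) - integral {r..r + 1} (void_prob \<nu> r)"
  using Henstock_Kurzweil_Integration.integral_combine[where a = u and c = r and b = "r + 1" and f = "void_prob \<nu> r"] assms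
    integrable_continuous_real[OF continuous_void_prob, of \<nu> r u "r + 1"]
  by (simp add: void_mass_eq_integral)

lemma borel_measurable_void_prob [measurable]:
  assumes [measurable]: "r \<in> borel_measurable N" "u \<in> borel_measurable N"
  shows "(\<lambda>x. void_prob \<nu> (r x) (u x)) \<in> borel_measurable N"
  unfolding void_prob_def by measurable

lemma borel_measurable_void_mass [measurable]:
  assumes [measurable]: "y \<in> borel_measurable N" "r \<in> borel_measurable N"
  shows "(\<lambda>x. void_mass \<nu> (y x) (r x)) \<in> borel_measurable N"
proof -
  have "(\<lambda>(p :: real \<times> real). void_mass \<nu> (fst p) (snd p)) \<in> borel_measurable (borel \<Otimes>\<^sub>M borel)"
  proof -
    have [measurable]: "(\<lambda>p :: (real \<times> real) \<times> real. indicator {fst (fst p)..snd (fst p)} (snd p) :: real)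
        \<in> borel_measurable ((borel \<Otimes>\<^sub>M borel) \<Otimes>\<^sub>M lborel)"
    proof (rule borel_measurable_indicator')
      show "{p \<in> space ((borel \<Otimes>\<^sub>M borel) \<Otimes>\<^sub>M lborel). snd p \<in> {fst (fst p)..snd (fst p) :: real}}
          \<in> sets ((borel \<Otimes>\<^sub>M borel) \<Otimes>\<^sub>M lborel)"
        unfolding atLeastAtMost_iff by measurable
    qed
    have "(\<lambda>p :: (real \<times> real) \<times> real. indicator {fst (fst p)..snd (fst p)} (snd p) *\<^sub>R
        void_prob \<nu> (snd (fst p)) (snd p)) \<in> borel_measurable ((borel \<Otimes>\<^sub>M borel) \<Otimes>\<^sub>M lborel)"
      by measurable
    then show ?thesis
      unfolding void_mass_def set_lebesgue_integral_def
      by (intro lborel.borel_measurable_lebesgue_integral) (simp add: case_prod_beta')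
  qed
  from measurable_compose[OF measurable_Pair[OF assms] this] show ?thesis by simp
qed

text \<open>The weight of having exactly \<open>k\<close> lines at distances between \<open>y\<close> and \<open>r\<close>, none of which has a node in
  the disc of radius \<open>r\<close>.\<close>

definition ahead :: "real \<Rightarrow> real \<Rightarrow> nat \<Rightarrow> real \<Rightarrow> real \<Rightarrow> real" where
  "ahead \<mu> \<nu> k y r = exp (- \<mu> * (r - y)) * (\<mu> * void_mass \<nu> y r) ^ k / fact k"

lemma ahead_nonneg: "0 \<le> \<mu> \<Longrightarrow> 0 \<le> ahead \<mu> \<nu> k y r"
  by (simp add: ahead_def void_mass_nonneg)

lemma borel_measurable_ahead [measurable]:
  assumes [measurable]: "y \<in> borel_measurable N" "r \<in> borel_measurable N"
  shows "(\<lambda>x. ahead \<mu> \<nu> k (y x) (r x)) \<in> borel_measurable N"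
  unfolding ahead_def by measurable

lemma exponential_tail:
  assumes "0 < \<mu>" "0 \<le> x"
  shows "(\<integral>\<^sup>+s. ennreal (exponential_density \<mu> s) * indicator {x..} s \<partial>lborel) = ennreal (exp (- \<mu> * x))"
proof -
  have "(\<integral>\<^sup>+s. ennreal (exponential_density \<mu> s) * indicator {x..} s \<partial>lborel)
      = (\<integral>\<^sup>+s. ennreal (\<mu> * exp (- \<mu> * s)) * indicator {x..} s \<partial>lborel)"
    using assms by (intro nn_integral_cong) (auto simp: exponential_density_def indicator_def mult.commute)
  also have "\<dots> = ennreal (0 - (- exp (- \<mu> * x)))"
  proof (rule nn_integral_FTC_atLeast)
    have "((\<lambda>s. exp (- \<mu> * s)) \<longlongrightarrow> 0) at_top"
      by (rule filterlim_compose[OF exp_at_bot])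
        (use assms in \<open>auto simp flip: filterlim_uminus_at_top
          intro!: filterlim_tendsto_pos_mult_at_top[OF tendsto_const] filterlim_ident\<close>)
    from tendsto_minus[OF this] show "((\<lambda>s. - exp (- \<mu> * s)) \<longlongrightarrow> 0) at_top"
      by simp
  qed (use assms in \<open>auto intro!: derivative_eq_intros\<close>)
  finally show ?thesis by simp
qed

text \<open>With \<open>u = y + s\<close> the exponentials combine to the constant \<open>exp (- \<mu> * (r - y))\<close>, and what remains is minus
  the derivative of \<open>(\<mu> * void_mass \<nu> u r) ^ Suc k / fact (Suc k)\<close> in \<open>u\<close>.\<close>

lemma ahead_step:
  assumes "0 < \<mu>" "y \<le> r"
  shows "(\<integral>\<^sup>+s. ennreal (exponential_density \<mu> s) *
      (if y + s < r then ennreal (void_prob \<nu> r (y + s) * ahead \<mu> \<nu> k (y + s) r) else 0) \<partial>lborel)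
    = ennreal (ahead \<mu> \<nu> (Suc k) y r)"
proof -
  \<comment> \<open>Agrees with \<open>\<mu> * void_mass \<nu> u r\<close> only for
    \<open>u \<le> r\<close>, but is differentiable on both sides of \<open>r\<close>.\<close>
  define m where "m u = \<mu> * (integral {u..r + 1} (void_prob \<nu> r) - integral {r..r + 1} (void_prob \<nu> r))" for u
  have m: "\<mu> * void_mass \<nu> u r = m u" if "u \<le> r" for u
    using void_mass_split[OF that] by (simp add: m_def)
  let ?f = "\<lambda>u. exp (- \<mu> * (r - y)) * (\<mu> * void_prob \<nu> r u) * (\<mu> * void_mass \<nu> u r) ^ k / fact k"
  define C where "C = - exp (- \<mu> * (r - y)) / fact (Suc k)"
  have C: "C * real (Suc k) = - exp (- \<mu> * (r - y)) / fact k"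
    unfolding C_def by (simp add: divide_simps del: of_nat_Suc)
  have "m r = 0" by (simp add: m_def)
  let ?F = "\<lambda>u. C * m u ^ Suc k"
  have "(\<integral>\<^sup>+s. ennreal (exponential_density \<mu> s) *
        (if y + s < r then ennreal (void_prob \<nu> r (y + s) * ahead \<mu> \<nu> k (y + s) r) else 0) \<partial>lborel)
      = (\<integral>\<^sup>+s. ennreal (?f (y + 1 * s)) * indicator {y..r} (y + 1 * s) \<partial>lborel)"
  proof (rule nn_integral_cong_AE)
    show "AE s in lborel. ennreal (exponential_density \<mu> s) *
        (if y + s < r then ennreal (void_prob \<nu> r (y + s) * ahead \<mu> \<nu> k (y + s) r) else 0)
      = ennreal (?f (y + 1 * s)) * indicator {y..r} (y + 1 * s)"
      \<comment> \<open>The two integrands can differ only at \<open>s = r - y\<close>.\<close>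
      using AE_lborel_singleton[of "r - y"]
    proof eventually_elim
      case (elim s)
      show ?case
      proof (cases "0 \<le> s \<and> y + s < r")
        case True
        have "exp (- \<mu> * s) * exp (- \<mu> * (r - (y + s))) = exp (- \<mu> * (r - y))"
          by (simp add: exp_add[symmetric] algebra_simps)
        then have "exponential_density \<mu> s * (void_prob \<nu> r (y + s) * ahead \<mu> \<nu> k (y + s) r) = ?f (y + s)"
          using True by (simp add: exponential_density_def ahead_def mult.commute[of s])
        then show ?thesis
          using True assms(1) by (simp add: ennreal_mult'[symmetric] exponential_density_nonneg)
      next
        case False
        then show ?thesis using elim by (auto simp: exponential_density_def indicator_def)
      qed
    qed
  qed
  also have "\<dots> = (\<integral>\<^sup>+u. ennreal (?f u) * indicator {y..r} u \<partial>lborel)"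
    using nn_integral_real_affine[of "\<lambda>u. ennreal (?f u) * indicator {y..r} u" 1 y] by simp
  also have "\<dots> = ennreal (?F r - ?F y)"
  proof (rule nn_integral_FTC_Icc)
    fix u assume u: "u \<in> {y..r}"
    have "(m has_real_derivative - (\<mu> * void_prob \<nu> r u)) (at u)"
      unfolding m_def using u
      by (auto intro!: derivative_eq_intros void_mass_DERIV[of "y - 1"])
    from DERIV_cmult[OF DERIV_power[OF this, of "Suc k"], of C]
    have "(?F has_real_derivative C * real (Suc k) * (- (\<mu> * void_prob \<nu> r u) * m u ^ k)) (at u)"
      by (simp only: diff_Suc_Suc diff_zero mult.assoc)
    moreover have "C * real (Suc k) * (- (\<mu> * void_prob \<nu> r u) * m u ^ k) = ?f u"
      unfolding C using u m[of u] by simp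
    ultimately show "(?F has_real_derivative ?f u) (at u)" by simp
    show "0 \<le> ?f u"
      using assms(1) void_mass_nonneg void_prob_pos[of \<nu> r u] by (simp add: less_imp_le)
  qed (use assms in auto)
  also have "?F r - ?F y = ahead \<mu> \<nu> (Suc k) y r"
    unfolding ahead_def m[OF assms(2)] using \<open>m r = 0\<close> by (simp add: C_def)
  finally show ?thesis .
qed

context line_process
begin

text \<open>With exponent 0 the void mass drops out of \<open>ahead\<close> and leaves the
  exponential tail \<open>exp (- \<mu> * (r - \<rho> l))\<close>, which is why the identity holds
  for every \<open>\<nu>\<close>.\<close>

lemma nn_integral_no_point:
  assumes l: "1 \<le> l" and G[measurable]: "G \<in> borel_measurable (F l)" and r[measurable]: "r \<in> borel_measurable (F l)"
    and le: "\<And>\<omega>. G \<omega> \<noteq> 0 \<Longrightarrow> \<rho> l \<omega> \<le> r \<omega>"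
  shows "(\<integral>\<^sup>+\<omega>. G \<omega> * (if r \<omega> \<le> \<rho> (Suc l) \<omega> then 1 else 0) \<partial>M)
    = (\<integral>\<^sup>+\<omega>. G \<omega> * ennreal (ahead \<mu> \<nu> 0 (\<rho> l \<omega>) (r \<omega>)) \<partial>M)"
proof -
  have [measurable]: "\<rho> l \<in> borel_measurable (F l)"
    using l by (intro borel_measurable_\<rho>_F) auto
  let ?X = "\<lambda>\<omega>. (G \<omega>, r \<omega> - \<rho> l \<omega>)"
  let ?g = "\<lambda>((a, b), s). a * (if b \<le> s then 1 else 0) :: ennreal"
  have X: "?X \<in> measurable (F l) (borel \<Otimes>\<^sub>M borel)" by measurable
  have g: "?g \<in> borel_measurable ((borel \<Otimes>\<^sub>M borel) \<Otimes>\<^sub>M (borel :: real measure))"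
    unfolding case_prod_beta' by measurable
  have "(\<integral>\<^sup>+\<omega>. G \<omega> * (if r \<omega> \<le> \<rho> (Suc l) \<omega> then 1 else 0) \<partial>M) = (\<integral>\<^sup>+\<omega>. ?g (?X \<omega>, gap l \<omega>) \<partial>M)"
    by (intro nn_integral_cong) (auto simp: gap_def)
  also have "\<dots> = (\<integral>\<^sup>+\<omega>. \<integral>\<^sup>+s. ennreal (exponential_density \<mu> s) * ?g (?X \<omega>, s) \<partial>lborel \<partial>M)"
    by (rule nn_integral_gap[OF l X g])
  also have "\<dots> = (\<integral>\<^sup>+\<omega>. G \<omega> * ennreal (ahead \<mu> \<nu> 0 (\<rho> l \<omega>) (r \<omega>)) \<partial>M)"
  proof (rule nn_integral_cong)
    fix \<omega>
    have "(\<integral>\<^sup>+s. ennreal (exponential_density \<mu> s) * ?g (?X \<omega>, s) \<partial>lborel)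
        = (\<integral>\<^sup>+s. G \<omega> * (ennreal (exponential_density \<mu> s) * indicator {r \<omega> - \<rho> l \<omega>..} s) \<partial>lborel)"
      by (intro nn_integral_cong) (simp add: indicator_def mult.commute)
    also have "\<dots> = G \<omega> * (\<integral>\<^sup>+s. ennreal (exponential_density \<mu> s) * indicator {r \<omega> - \<rho> l \<omega>..} s \<partial>lborel)"
      by (rule nn_integral_cmult) simp
    also have "\<dots> = G \<omega> * ennreal (ahead \<mu> \<nu> 0 (\<rho> l \<omega>) (r \<omega>))"
    proof (cases "G \<omega> = 0")
      case False
      then have "0 \<le> r \<omega> - \<rho> l \<omega>" using le by simp
      then show ?thesis by (simp add: exponential_tail[OF \<mu>_pos] ahead_def)
    qed simp
    finally show "(\<integral>\<^sup>+s. ennreal (exponential_density \<mu> s) * ?g (?X \<omega>, s) \<partial>lborel)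
        = G \<omega> * ennreal (ahead \<mu> \<nu> 0 (\<rho> l \<omega>) (r \<omega>))" .
  qed
  finally show ?thesis .
qed

lemma nn_integral_next_point:
  assumes l: "1 \<le> l" and G[measurable]: "G \<in> borel_measurable (F l)" and r[measurable]: "r \<in> borel_measurable (F l)"
    and le: "\<And>\<omega>. G \<omega> \<noteq> 0 \<Longrightarrow> \<rho> l \<omega> \<le> r \<omega>"
  shows "(\<integral>\<^sup>+\<omega>. G \<omega> * (if \<rho> (Suc l) \<omega> < r \<omega>
        then ennreal (void_prob \<nu> (r \<omega>) (\<rho> (Suc l) \<omega>) * ahead \<mu> \<nu> k (\<rho> (Suc l) \<omega>) (r \<omega>)) else 0) \<partial>M)
    = (\<integral>\<^sup>+\<omega>. G \<omega> * ennreal (ahead \<mu> \<nu> (Suc k) (\<rho> l \<omega>) (r \<omega>)) \<partial>M)"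
proof -
  have [measurable]: "\<rho> l \<in> borel_measurable (F l)"
    using l by (intro borel_measurable_\<rho>_F) auto
  let ?h = "\<lambda>r y s. if y + s < r then ennreal (void_prob \<nu> r (y + s) * ahead \<mu> \<nu> k (y + s) r) else 0"
  let ?X = "\<lambda>\<omega>. (G \<omega>, r \<omega>, \<rho> l \<omega>)"
  let ?g = "\<lambda>((a, b, y), s). a * ?h b y s"
  have X: "?X \<in> measurable (F l) (borel \<Otimes>\<^sub>M borel \<Otimes>\<^sub>M borel)" by measurable
  have g: "?g \<in> borel_measurable ((borel \<Otimes>\<^sub>M borel \<Otimes>\<^sub>M borel) \<Otimes>\<^sub>M (borel :: real measure))"
    unfolding case_prod_beta' by measurable
  have "(\<integral>\<^sup>+\<omega>. G \<omega> * (if \<rho> (Suc l) \<omega> < r \<omega>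
        then ennreal (void_prob \<nu> (r \<omega>) (\<rho> (Suc l) \<omega>) * ahead \<mu> \<nu> k (\<rho> (Suc l) \<omega>) (r \<omega>)) else 0) \<partial>M)
      = (\<integral>\<^sup>+\<omega>. ?g (?X \<omega>, gap l \<omega>) \<partial>M)"
    by (intro nn_integral_cong) (simp add: gap_def)
  also have "\<dots> = (\<integral>\<^sup>+\<omega>. \<integral>\<^sup>+s. ennreal (exponential_density \<mu> s) * ?g (?X \<omega>, s) \<partial>lborel \<partial>M)"
    by (rule nn_integral_gap[OF l X g])
  also have "\<dots> = (\<integral>\<^sup>+\<omega>. G \<omega> * ennreal (ahead \<mu> \<nu> (Suc k) (\<rho> l \<omega>) (r \<omega>)) \<partial>M)"
  proof (rule nn_integral_cong)
    fix \<omega>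
    have "(\<integral>\<^sup>+s. ennreal (exponential_density \<mu> s) * ?g (?X \<omega>, s) \<partial>lborel)
        = (\<integral>\<^sup>+s. G \<omega> * (ennreal (exponential_density \<mu> s) * ?h (r \<omega>) (\<rho> l \<omega>) s) \<partial>lborel)"
      by (intro nn_integral_cong) (auto simp: mult_ac)
    also have "\<dots> = G \<omega> * (\<integral>\<^sup>+s. ennreal (exponential_density \<mu> s) * ?h (r \<omega>) (\<rho> l \<omega>) s \<partial>lborel)"
      by (rule nn_integral_cmult) measurable
    also have "\<dots> = G \<omega> * ennreal (ahead \<mu> \<nu> (Suc k) (\<rho> l \<omega>) (r \<omega>))"
    proof (cases "G \<omega> = 0")
      case False
      then show ?thesis by (subst ahead_step[OF \<mu>_pos le]) simp_all
    qed simp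
    finally show "(\<integral>\<^sup>+s. ennreal (exponential_density \<mu> s) * ?g (?X \<omega>, s) \<partial>lborel)
        = G \<omega> * ennreal (ahead \<mu> \<nu> (Suc k) (\<rho> l \<omega>) (r \<omega>))" .
  qed
  finally show ?thesis .
qed

text \<open>\<open>G\<close> collects the factors already treated. In the induction step it absorbs
  the factor of line \<open>l + 1\<close>, which is known at \<open>F (Suc l)\<close> and vanishes
  unless that line is closer than \<open>r\<close>; this is why \<open>\<rho> l \<le> r\<close> is
  demanded only where \<open>G\<close> is nonzero. The radius is known at \<open>F l\<close>, so it
  stays fixed throughout.\<close>

lemma nn_integral_points_ahead:
  assumes "1 \<le> l" "G \<in> borel_measurable (F l)" "r \<in> borel_measurable (F l)"
    and "\<And>\<omega>. G \<omega> \<noteq> 0 \<Longrightarrow> \<rho> l \<omega> \<le> r \<omega>"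
  shows "(\<integral>\<^sup>+\<omega>. G \<omega> * ((\<Prod>i\<in>{l<..l + k}. if \<rho> i \<omega> < r \<omega> then ennreal (void_prob \<nu> (r \<omega>) (\<rho> i \<omega>)) else 0) *
      (if r \<omega> \<le> \<rho> (Suc (l + k)) \<omega> then 1 else 0)) \<partial>M)
    = (\<integral>\<^sup>+\<omega>. G \<omega> * ennreal (ahead \<mu> \<nu> k (\<rho> l \<omega>) (r \<omega>)) \<partial>M)"
  using assms
proof (induction k arbitrary: l G)
  case 0
  then show ?case using nn_integral_no_point[of l G r \<nu>] by simp
next
  case (Suc k)
  note [measurable] = Suc.prems(2,3)[THEN measurable_F_Suc]
  have [measurable]: "\<rho> (Suc l) \<in> borel_measurable (F (Suc l))"
    by (rule borel_measurable_\<rho>_F) auto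
  let ?v = "\<lambda>i \<omega>. if \<rho> i \<omega> < r \<omega> then ennreal (void_prob \<nu> (r \<omega>) (\<rho> i \<omega>)) else 0"
  have "{l<..l + Suc k} = insert (Suc l) {Suc l<..Suc l + k}" by auto
  then have "(\<integral>\<^sup>+\<omega>. G \<omega> * ((\<Prod>i\<in>{l<..l + Suc k}. ?v i \<omega>) * (if r \<omega> \<le> \<rho> (Suc (l + Suc k)) \<omega> then 1 else 0)) \<partial>M)
      = (\<integral>\<^sup>+\<omega>. (G \<omega> * ?v (Suc l) \<omega>) * ((\<Prod>i\<in>{Suc l<..Suc l + k}. ?v i \<omega>) *
        (if r \<omega> \<le> \<rho> (Suc (Suc l + k)) \<omega> then 1 else 0)) \<partial>M)"
    by (intro nn_integral_cong) (simp add: mult.assoc)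
  also have "\<dots> = (\<integral>\<^sup>+\<omega>. (G \<omega> * ?v (Suc l) \<omega>) * ennreal (ahead \<mu> \<nu> k (\<rho> (Suc l) \<omega>) (r \<omega>)) \<partial>M)"
    by (rule Suc.IH) (auto split: if_splits)
  also have "\<dots> = (\<integral>\<^sup>+\<omega>. G \<omega> * (if \<rho> (Suc l) \<omega> < r \<omega>
        then ennreal (void_prob \<nu> (r \<omega>) (\<rho> (Suc l) \<omega>) * ahead \<mu> \<nu> k (\<rho> (Suc l) \<omega>) (r \<omega>)) else 0) \<partial>M)"
    using \<mu>_pos by (intro nn_integral_cong) (simp add: mult.assoc ennreal_mult void_prob_pos less_imp_le ahead_nonneg)
  also have "\<dots> = (\<integral>\<^sup>+\<omega>. G \<omega> * ennreal (ahead \<mu> \<nu> (Suc k) (\<rho> l \<omega>) (r \<omega>)) \<partial>M)"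
    by (rule nn_integral_next_point[OF Suc.prems])
  finally show ?case .
qed

end

section \<open>The joint law of the serving line and the number of lines in between\<close>

lemma (in prob_space) indep_elements_compose:
  assumes ind: "indep_elements S X T Z" and f: "f \<in> measurable S S'" and g: "g \<in> measurable T T'"
  shows "indep_elements S' (\<lambda>\<omega>. f (X \<omega>)) T' (\<lambda>\<omega>. g (Z \<omega>))"
  unfolding indep_elements_def
proof (intro conjI ballI)
  have X: "X \<in> measurable M S" and Z: "Z \<in> measurable M T"
    using ind by (auto simp: indep_elements_def)
  show "(\<lambda>\<omega>. f (X \<omega>)) \<in> measurable M S'" "(\<lambda>\<omega>. g (Z \<omega>)) \<in> measurable M T'"
    by (rule measurable_compose[OF X f], rule measurable_compose[OF Z g])
  fix A B assume AB: "A \<in> sets S'" "B \<in> sets T'"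
  have "(\<lambda>\<omega>. f (X \<omega>)) -` A \<inter> space M = X -` (f -` A \<inter> space S) \<inter> space M"
    "(\<lambda>\<omega>. g (Z \<omega>)) -` B \<inter> space M = Z -` (g -` B \<inter> space T) \<inter> space M"
    using measurable_space[OF X] measurable_space[OF Z] by auto
  note eqs = this
  show "prob (((\<lambda>\<omega>. f (X \<omega>)) -` A \<inter> space M) \<inter> ((\<lambda>\<omega>. g (Z \<omega>)) -` B \<inter> space M))
      = prob ((\<lambda>\<omega>. f (X \<omega>)) -` A \<inter> space M) * prob ((\<lambda>\<omega>. g (Z \<omega>)) -` B \<inter> space M)"
    using ind measurable_sets[OF f AB(1)] measurable_sets[OF g AB(2)]
    unfolding eqs indep_elements_def by blast
qed

lemma (in prob_space) indep_var_imp_indep_elements: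
  assumes "indep_var S X T Z"
  shows "indep_elements S X T Z"
  unfolding indep_elements_def
proof (intro conjI ballI)
  show "random_variable S X" "random_variable T Z"
    using assms by (auto dest: indep_var_rv1 indep_var_rv2)
  fix A B assume AB: "A \<in> sets S" "B \<in> sets T"
  have "(\<lambda>x. (X x, Z x)) -` (A \<times> B) \<inter> space M = (X -` A \<inter> space M) \<inter> (Z -` B \<inter> space M)"
    by auto
  with indep_varD[OF assms AB]
  show "prob ((X -` A \<inter> space M) \<inter> (Z -` B \<inter> space M)) = prob (X -` A \<inter> space M) * prob (Z -` B \<inter> space M)"
    by simp
qed

lemma (in prob_space) indep_elements_commute:
  "indep_elements S X T Z \<Longrightarrow> indep_elements T Z S X"
  by (simp add: indep_elements_def Int_commute mult.commute)

text \<open>Applied to the lines beyond the \<open>n\<close>-th one that are closer than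
  \<open>r\<close>: the distances are monotone, so their indices are consecutive.\<close>

lemma initial_segment_eq:
  fixes T :: "nat set"
  assumes "finite T" "\<And>i. i \<in> T \<Longrightarrow> n < i" "\<And>i j. i \<in> T \<Longrightarrow> n < j \<Longrightarrow> j \<le> i \<Longrightarrow> j \<in> T"
  shows "T = {n<..n + card T}"
proof (cases "T = {}")
  case False
  let ?m = "Max T"
  have m: "?m \<in> T" using False assms(1) by (rule Max_in[rotated])
  have T: "T = {n<..?m}"
  proof
    show "T \<subseteq> {n<..?m}" using assms(2) Max_ge[OF assms(1)] by fastforce
    show "{n<..?m} \<subseteq> T" using assms(3)[OF m] by fastforce
  qed
  have "card T = ?m - n" by (subst T) simp
  with assms(2)[OF m] have "n + card T = ?m" by simp
  with T show ?thesis by simp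
qed simp

text \<open>\<open>sqrt (r\<^sup>2 - a\<^sup>2)\<close> is half the chord at distance
  \<open>a\<close>. A line at distance \<open>r\<close> or more imposes no condition on its
  nodes.\<close>

lemma le_sqrt_sum_iff:
  fixes r a b :: real
  assumes "0 \<le> r" "0 \<le> a" "0 \<le> b"
  shows "r \<le> sqrt (a\<^sup>2 + b\<^sup>2) \<longleftrightarrow> (a < r \<longrightarrow> sqrt (r\<^sup>2 - a\<^sup>2) \<le> b)"
proof (cases "a < r")
  case True
  have "r \<le> sqrt (a\<^sup>2 + b\<^sup>2) \<longleftrightarrow> r\<^sup>2 \<le> a\<^sup>2 + b\<^sup>2"
    using assms by (metis real_le_lsqrt real_sqrt_le_iff real_sqrt_unique)
  also have "\<dots> \<longleftrightarrow> r\<^sup>2 - a\<^sup>2 \<le> b\<^sup>2" by linarith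
  also have "\<dots> \<longleftrightarrow> sqrt (r\<^sup>2 - a\<^sup>2) \<le> b"
    using assms by (metis real_sqrt_le_iff real_sqrt_unique)
  finally show ?thesis using True by simp
next
  case False
  then have "r \<le> sqrt (a\<^sup>2 + b\<^sup>2)"
    using assms by (intro real_le_rsqrt) (meson add_increasing2 not_less order_trans power_mono zero_le_power2)
  then show ?thesis using False by simp
qed

locale cox_lines = line_process M \<Phi> lam_l for M :: "'w measure" and \<Phi> lam_l +
  fixes \<Psi> :: "'w \<Rightarrow> nat \<Rightarrow> real set" and lam_v \<theta>\<^sub>0 :: real
  assumes lam_v_pos: "0 < lam_v"
    and node_PPP: "\<And>i. homogeneous_PPP M lam_v UNIV (\<lambda>\<omega>. \<Psi> \<omega> i)"
    and node_indep: "indep_vars (\<lambda>_. configs) (\<lambda>i \<omega>. \<Psi> \<omega> i) UNIV"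
    and line_node_indep: "indep_set (sets (vimage_algebra (space M) \<Phi> configs))
           (sets (vimage_algebra (space M) \<Psi> (PiM UNIV (\<lambda>_. configs))))"
begin

definition W :: "nat \<Rightarrow> 'w \<Rightarrow> real" where
  "W i \<omega> = infdist 0 (\<Psi> \<omega> i)"

lemma \<Psi>_meas [measurable]: "(\<lambda>\<omega>. \<Psi> \<omega> i) \<in> measurable M configs"
  using node_PPP[of i] by (auto simp: homogeneous_PPP_def)

lemma \<Psi>_locally_finite: "\<omega> \<in> space M \<Longrightarrow> \<forall>i. locally_finite (\<Psi> \<omega> i)"
  using Z_locally_finite[OF \<Phi>_meas \<Phi>_sub \<Psi>_meas] .

lemma borel_measurable_W [measurable]: "W i \<in> borel_measurable M"
  unfolding W_def[abs_def] by measurable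

lemma W_nonneg: "0 \<le> W i \<omega>"
  by (simp add: W_def infdist_nonneg)

lemma measurable_node_count [measurable]:
  "(\<lambda>\<omega>. card (\<Psi> \<omega> i \<inter> {-c<..<c})) \<in> measurable M (count_space UNIV)"
  by (rule measurable_card_Int_compose[OF \<Psi>_meas]) auto

lemma prob_no_node:
  assumes "0 < c"
  shows "prob {\<omega> \<in> space M. card (\<Psi> \<omega> i \<inter> {-c<..<c}) = 0} = exp (- 2 * lam_v * c)"
proof -
  have "measure lborel ({-c<..<c} \<inter> UNIV) = 2 * c"
    using assms by simp
  then have "distr M (count_space UNIV) (\<lambda>\<omega>. card (\<Psi> \<omega> i \<inter> {-c<..<c})) = measure_pmf (poisson_pmf (lam_v * (2 * c)))"
    using node_PPP[of i] unfolding homogeneous_PPP_def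
    by (metis bounded_Ioo borel_open open_greaterThanLessThan)
  then have "measure (distr M (count_space UNIV) (\<lambda>\<omega>. card (\<Psi> \<omega> i \<inter> {-c<..<c}))) {0}
      = pmf (poisson_pmf (lam_v * (2 * c))) 0"
    by (simp add: measure_pmf_single)
  moreover have "(\<lambda>\<omega>. card (\<Psi> \<omega> i \<inter> {-c<..<c})) -` {0} \<inter> space M = {\<omega> \<in> space M. card (\<Psi> \<omega> i \<inter> {-c<..<c}) = 0}"
    by auto
  ultimately show ?thesis
    using assms lam_v_pos by (subst (asm) measure_distr) (simp_all add: mult_ac)
qed

lemma AE_nodes_nonempty: "AE \<omega> in M. \<forall>i. \<Psi> \<omega> i \<noteq> {}"
  unfolding AE_all_countable
proof
  fix i
  have "prob {\<omega> \<in> space M. \<Psi> \<omega> i = {}} \<le> exp (- 2 * lam_v * c)" if "0 < c" for c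
    unfolding prob_no_node[OF that, of i, symmetric] by (intro finite_measure_mono) auto
  then have "\<forall>\<^sub>F c in at_top. prob {\<omega> \<in> space M. \<Psi> \<omega> i = {}} \<le> exp (- 2 * lam_v * c)"
    using eventually_gt_at_top[of 0] by (rule eventually_mono[rotated])
  moreover have "((\<lambda>c. exp (- 2 * lam_v * c)) \<longlongrightarrow> 0) at_top"
    by (rule filterlim_compose[OF exp_at_bot])
      (use lam_v_pos in \<open>auto simp flip: filterlim_uminus_at_top
          intro!: filterlim_tendsto_pos_mult_at_top[OF tendsto_const] filterlim_ident\<close>)
  ultimately have "prob {\<omega> \<in> space M. \<Psi> \<omega> i = {}} \<le> 0"
    by (intro tendsto_le[OF _ _ tendsto_const]) (auto simp: trivial_limit_at_top_linorder)
  then have "prob {\<omega> \<in> space M. \<Psi> \<omega> i = {}} = 0"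
    by (simp add: measure_le_0_iff)
  then show "AE \<omega> in M. \<Psi> \<omega> i \<noteq> {}"
    by (subst (asm) prob_eq_0) auto
qed

text \<open>Up to the null event of an empty line, the nearest node is at least \<open>c\<close>
  away from the foot iff the open interval of length \<open>2 * c\<close> around the foot is empty.
  The factor 2 comes from its two sides.\<close>

lemma prob_W_ge:
  assumes "0 \<le> c"
  shows "prob {\<omega> \<in> space M. c \<le> W i \<omega>} = exp (- 2 * lam_v * c)"
proof (cases "c = 0")
  case True
  then show ?thesis by (simp add: W_nonneg prob_space)
next
  case False
  with assms have c: "0 < c" by simp
  have "prob {\<omega> \<in> space M. c \<le> W i \<omega>} = prob {\<omega> \<in> space M. card (\<Psi> \<omega> i \<inter> {-c<..<c}) = 0}"
  proof (rule finite_measure_eq_AE)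
    show "AE \<omega> in M. \<omega> \<in> {\<omega> \<in> space M. c \<le> W i \<omega>} \<longleftrightarrow>
        \<omega> \<in> {\<omega> \<in> space M. card (\<Psi> \<omega> i \<inter> {-c<..<c}) = 0}"
      using AE_nodes_nonempty AE_space
    proof eventually_elim
      case (elim \<omega>)
      have "W i \<omega> < c \<longleftrightarrow> 0 < card (\<Psi> \<omega> i \<inter> {-c<..<c})"
        unfolding W_def using \<Psi>_locally_finite elim by (intro infdist_0_less_iff_card) auto
      then show ?case
        by (simp only: mem_Collect_eq not_less[symmetric] gr0_conv_Suc[symmetric]) simp
    qed
  qed auto
  then show ?thesis unfolding prob_no_node[OF c] .
qed

text \<open>Ensures that \<open>\<rho> n\<close> is strictly below the radius, so that every line
  closer than the \<open>n\<close>-th one meets the disc.\<close>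

lemma AE_W_pos: "AE \<omega> in M. 0 < W i \<omega>"
proof -
  have bound: "prob {\<omega> \<in> space M. W i \<omega> \<le> 0} \<le> 1 - exp (- 2 * lam_v * c)" if "0 < c" for c
  proof -
    have "prob {\<omega> \<in> space M. W i \<omega> \<le> 0} \<le> prob (space M - {\<omega> \<in> space M. c \<le> W i \<omega>})"
      using that by (intro finite_measure_mono) auto
    also have "\<dots> = 1 - exp (- 2 * lam_v * c)"
      using prob_W_ge[of c i] that by (subst prob_compl) simp_all
    finally show ?thesis .
  qed
  have "(\<lambda>m. 1 - exp (- 2 * lam_v * inverse (real (Suc m)))) \<longlonglongrightarrow> 1 - exp (- 2 * lam_v * 0)"
    by (intro tendsto_intros LIMSEQ_inverse_real_of_nat)
  then have "prob {\<omega> \<in> space M. W i \<omega> \<le> 0} \<le> 1 - exp (- 2 * lam_v * 0)"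
    by (rule LIMSEQ_le_const) (use bound in \<open>auto simp del: of_nat_Suc\<close>)
  then have "prob {\<omega> \<in> space M. W i \<omega> \<le> 0} = 0"
    by (simp add: measure_le_0_iff)
  then show ?thesis
    by (subst (asm) prob_eq_0) (auto simp: not_le)
qed

lemma indep_W: "indep_vars (\<lambda>_. borel) W UNIV"
  unfolding W_def[abs_def] using node_indep by (rule indep_vars_compose2) simp

lemma prob_W_ge_all:
  assumes "finite J" "\<And>i. i \<in> J \<Longrightarrow> 0 \<le> c i"
  shows "prob {\<omega> \<in> space M. \<forall>i\<in>J. c i \<le> W i \<omega>} = (\<Prod>i\<in>J. exp (- 2 * lam_v * c i))"
proof (cases "J = {}")
  case False
  have "{\<omega> \<in> space M. \<forall>i\<in>J. c i \<le> W i \<omega>} = (\<Inter>i\<in>J. W i -` {c i..} \<inter> space M)"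
    using False by auto
  also have "prob \<dots> = (\<Prod>i\<in>J. prob (W i -` {c i..} \<inter> space M))"
    using assms False by (intro indep_varsD[OF indep_W]) auto
  also have "\<dots> = (\<Prod>i\<in>J. exp (- 2 * lam_v * c i))"
  proof (rule prod.cong[OF refl])
    fix i assume "i \<in> J"
    moreover have "W i -` {c i..} \<inter> space M = {\<omega> \<in> space M. c i \<le> W i \<omega>}" by auto
    ultimately show "prob (W i -` {c i..} \<inter> space M) = exp (- 2 * lam_v * c i)"
      using prob_W_ge[of "c i" i] assms(2) by simp
  qed
  finally show ?thesis .
qed (simp add: prob_space)

text \<open>Overwriting coordinate \<open>n\<close> keeps the index set \<open>UNIV\<close>, so one
  product space serves all \<open>n\<close>, while the vector stays independent of
  \<open>W n\<close>.\<close>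

definition W_others :: "nat \<Rightarrow> 'w \<Rightarrow> nat \<Rightarrow> real" where
  "W_others n \<omega> i = (if i = n then 0 else W i \<omega>)"

lemma indep_W_others:
  "indep_elements borel (W n) (PiM UNIV (\<lambda>_. borel)) (W_others n)"
proof -
  have "indep_elements (PiM {n} (\<lambda>_. borel)) (\<lambda>\<omega>. restrict (\<lambda>i. W i \<omega>) {n})
      (PiM (- {n}) (\<lambda>_. borel)) (\<lambda>\<omega>. restrict (\<lambda>i. W i \<omega>) (- {n}))"
    by (intro indep_var_imp_indep_elements indep_var_restrict[OF indep_W]) auto
  moreover have "(\<lambda>x. x n) \<in> borel_measurable (PiM {n} (\<lambda>_. borel :: real measure))"
    by simp
  moreover have "(\<lambda>x i. if i = n then 0 else x i) \<in> measurable (PiM (- {n}) (\<lambda>_. borel :: real measure)) (PiM UNIV (\<lambda>_. borel))"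
  proof (rule measurable_PiM_single')
    fix i :: nat
    show "(\<lambda>x. if i = n then 0 else x i) \<in> borel_measurable (PiM (- {n}) (\<lambda>_. borel :: real measure))"
      by (cases "i = n") auto
  qed auto
  ultimately have "indep_elements borel (\<lambda>\<omega>. restrict (\<lambda>i. W i \<omega>) {n} n)
      (PiM UNIV (\<lambda>_. borel)) (\<lambda>\<omega> i. if i = n then 0 else restrict (\<lambda>i. W i \<omega>) (- {n}) i)"
    by (rule indep_elements_compose)
  moreover have "(\<lambda>\<omega> i. if i = n then 0 else restrict (\<lambda>i. W i \<omega>) (- {n}) i) = W_others n"
    by (auto simp: W_others_def fun_eq_iff)
  ultimately show ?thesis by simp
qed

lemma indep_\<rho>_W: "indep_elements (PiM UNIV (\<lambda>_. borel)) (\<lambda>\<omega> i. \<rho> i \<omega>) (PiM UNIV (\<lambda>_. borel)) (\<lambda>\<omega> i. W i \<omega>)"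
proof -
  let ?A = "vimage_algebra (space M) \<Phi> configs" and ?B = "vimage_algebra (space M) \<Psi> (PiM UNIV (\<lambda>_. configs))"
  have \<Phi>: "\<Phi> \<in> measurable ?A configs"
    using measurable_space[OF \<Phi>_meas] by (intro measurable_vimage_algebra1) auto
  have "\<rho> i \<in> borel_measurable ?A" for i
    using borel_measurable_Y[OF \<Phi>, of i] \<Phi>_sub by (cases "i = 0") (auto simp: \<rho>_def[abs_def])
  then have \<rho>: "(\<lambda>\<omega> i. \<rho> i \<omega>) \<in> measurable ?A (PiM UNIV (\<lambda>_. borel))"
    by (intro measurable_PiM_single') auto
  have "\<Psi> \<in> measurable ?B (PiM UNIV (\<lambda>_. configs))"
    using measurable_space[OF \<Psi>_meas] by (intro measurable_vimage_algebra1) (auto simp: space_PiM)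
  then have "W i \<in> borel_measurable ?B" for i
    unfolding W_def[abs_def] by measurable
  then have W: "(\<lambda>\<omega> i. W i \<omega>) \<in> measurable ?B (PiM UNIV (\<lambda>_. borel))"
    by (intro measurable_PiM_single') auto
  show ?thesis
    unfolding indep_elements_def
  proof (intro conjI ballI)
    fix A B :: "(nat \<Rightarrow> real) set" assume "A \<in> sets (PiM UNIV (\<lambda>_. borel))" "B \<in> sets (PiM UNIV (\<lambda>_. borel))"
    then show "prob (((\<lambda>\<omega> i. \<rho> i \<omega>) -` A \<inter> space M) \<inter> ((\<lambda>\<omega> i. W i \<omega>) -` B \<inter> space M))
        = prob ((\<lambda>\<omega> i. \<rho> i \<omega>) -` A \<inter> space M) * prob ((\<lambda>\<omega> i. W i \<omega>) -` B \<inter> space M)"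
      using measurable_sets[OF \<rho>] measurable_sets[OF W] by (intro indep_setD[OF line_node_indep]) auto
  qed (intro measurable_PiM_single'; simp)+
qed

end

section \<open>Indices of the lines between the serving line and the serving radius\<close>

context line_process
begin

lemma \<rho>_strict_mono:
  assumes strict: "\<forall>i\<ge>1. \<rho> i \<omega> < \<rho> (Suc i) \<omega>" and "1 \<le> i" "i < j"
  shows "\<rho> i \<omega> < \<rho> j \<omega>"
  using assms(3)
proof (induction j)
  case (Suc j)
  then show ?case
    using strict assms(2) by (cases "i = j") (auto intro: less_trans)
qed simp

lemma finite_\<rho>_less:
  assumes "\<omega> \<in> space M" "\<forall>i. has_nth (\<Phi> \<omega>) i"
  shows "finite {i. \<rho> i \<omega> < c}"
proof (rule finite_subset)
  show "{i. \<rho> i \<omega> < c} \<subseteq> {..card (lines_within (\<Phi> \<omega>) c)}"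
  proof
    fix i assume i: "i \<in> {i. \<rho> i \<omega> < c}"
    then show "i \<in> {..card (lines_within (\<Phi> \<omega>) c)}"
      using \<rho>_less_iff[OF assms(1) spec[OF assms(2)], of i c] by (cases "i = 0") auto
  qed
qed simp

text \<open>The indices concerned are consecutive, so there are exactly \<open>k\<close> of them iff
  all of \<open>{n<..n + k}\<close> belong and the next one does not. A product over a random set
  thus becomes one over fixed indices, the form that \<open>nn_integral_points_ahead\<close>
  integrates.\<close>

lemma prod_points_ahead:
  fixes g :: "nat \<Rightarrow> ennreal"
  assumes \<omega>: "\<omega> \<in> space M" "\<forall>i. has_nth (\<Phi> \<omega>) i" and strict: "\<forall>i\<ge>1. \<rho> i \<omega> < \<rho> (Suc i) \<omega>"
  shows "(if card {i. n < i \<and> \<rho> i \<omega> < r} = k then 1 else 0) * (\<Prod>i\<in>{i. n < i \<and> \<rho> i \<omega> < r}. g i)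
    = (\<Prod>i\<in>{n<..n + k}. if \<rho> i \<omega> < r then g i else 0) * (if r \<le> \<rho> (Suc (n + k)) \<omega> then 1 else 0)"
proof -
  define T where "T = {i. n < i \<and> \<rho> i \<omega> < r}"
  have T_iff: "i \<in> T \<longleftrightarrow> n < i \<and> \<rho> i \<omega> < r" for i by (simp add: T_def)
  have T: "T = {n<..n + card T}"
  proof (rule initial_segment_eq)
    show "finite T"
      using finite_subset[OF _ finite_\<rho>_less[OF \<omega>, of r]] by (auto simp: T_def)
    show "j \<in> T" if "i \<in> T" "n < j" "j \<le> i" for i j
      using that \<rho>_mono[OF \<omega> that(3)] by (auto simp: T_def)
  qed (simp add: T_def)
  have T_mem: "i \<in> T \<longleftrightarrow> n < i \<and> i \<le> n + card T" for i
    using eqset_imp_iff[OF T, of i] by simp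
  show ?thesis
  proof (cases "card T = k")
    case True
    have seg: "{n<..n + k} = T" by (rule T[unfolded True, symmetric])
    have "Suc (n + k) \<notin> T" using True by (simp add: T_mem)
    then have "\<not> \<rho> (Suc (n + k)) \<omega> < r" by (simp add: T_iff)
    moreover have "(\<Prod>i\<in>{n<..n + k}. if \<rho> i \<omega> < r then g i else 0) = (\<Prod>i\<in>T. g i)"
      unfolding seg by (rule prod.cong[OF refl]) (simp add: T_iff)
    ultimately show ?thesis using True unfolding T_def[symmetric] by simp
  next
    case False
    then consider "card T < k" | "k < card T" by linarith
    then have "(\<Prod>i\<in>{n<..n + k}. if \<rho> i \<omega> < r then g i else 0) * (if r \<le> \<rho> (Suc (n + k)) \<omega> then 1 else 0) = (0 :: ennreal)"
    proof cases
      case 1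
      \<comment> \<open>The last index of the block is missing, so its factor is 0.\<close>
      then have "n + k \<in> {n<..n + k}" "n + k \<notin> T" by (simp_all add: T_mem)
      then have "\<exists>i\<in>{n<..n + k}. (if \<rho> i \<omega> < r then g i else 0) = 0"
        using T_iff[of "n + k"] by (intro bexI[of _ "n + k"]) auto
      then show ?thesis by (simp add: prod_zero)
    next
      case 2
      then have "Suc (n + k) \<in> T" by (simp_all add: T_mem)
      then show ?thesis using T_iff by simp
    qed
    with False show ?thesis unfolding T_def[symmetric] by simp
  qed
qed

end

context cox_lines
begin

definition serving_radius :: "nat \<Rightarrow> 'w \<Rightarrow> real" where
  "serving_radius n \<omega> = sqrt ((\<rho> n \<omega>)\<^sup>2 + (W n \<omega>)\<^sup>2)"

text \<open>Off the null events of missing lines, ties and lines without nodes, the model is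
  expressed by \<open>\<rho>\<close> and \<open>W\<close>. The serving distance is identified with
  the radius of the \<open>n\<close>-th line only where that line serves, hence the
  implication.\<close>

lemma AE_served_count_iff:
  assumes n: "1 \<le> n"
  shows "AE \<omega> in M.
    (served_by_line \<theta>\<^sub>0 (\<Phi> \<omega>) (\<Psi> \<omega>) n \<longleftrightarrow> (\<forall>i. i \<noteq> n \<longrightarrow> serving_radius n \<omega> \<le> sqrt ((\<rho> i \<omega>)\<^sup>2 + (W i \<omega>)\<^sup>2))) \<and>
    (served_by_line \<theta>\<^sub>0 (\<Phi> \<omega>) (\<Psi> \<omega>) n \<longrightarrow> serving_dist \<theta>\<^sub>0 (\<Phi> \<omega>) (\<Psi> \<omega>) = serving_radius n \<omega>) \<and>
    num_lines (\<Phi> \<omega>) (Y (\<Phi> \<omega>) n) (serving_radius n \<omega>) = card {i. n < i \<and> \<rho> i \<omega> < serving_radius n \<omega>}"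
  using AE_has_nth AE_\<rho>_strict AE_nodes_nonempty AE_space
proof eventually_elim
  case (elim \<omega>)
  have ld: "line_dist \<theta>\<^sub>0 (\<Phi> \<omega>) (\<Psi> \<omega>) i = sqrt ((\<rho> i \<omega>)\<^sup>2 + (W i \<omega>)\<^sup>2)" for i
    by (simp add: line_dist_def L_def \<rho>_def Y_def W_def)
  have served: "served_by_line \<theta>\<^sub>0 (\<Phi> \<omega>) (\<Psi> \<omega>) n \<longleftrightarrow>
      (\<forall>i. i \<noteq> n \<longrightarrow> serving_radius n \<omega> \<le> sqrt ((\<rho> i \<omega>)\<^sup>2 + (W i \<omega>)\<^sup>2))"
    unfolding served_by_line_iff[OF \<Psi>_locally_finite[OF elim(4)]] ld serving_radius_def
    using elim(3) by auto
  have "{i. 1 \<le> i \<and> has_nth (\<Phi> \<omega>) i \<and> Y (\<Phi> \<omega>) n < Y (\<Phi> \<omega>) i \<and> Y (\<Phi> \<omega>) i < serving_radius n \<omega>}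
      = {i. n < i \<and> \<rho> i \<omega> < serving_radius n \<omega>}"
  proof -
    have "Y (\<Phi> \<omega>) n < Y (\<Phi> \<omega>) i \<longleftrightarrow> n < i" if "1 \<le> i" for i
    proof
      assume "Y (\<Phi> \<omega>) n < Y (\<Phi> \<omega>) i"
      then have "\<rho> n \<omega> < \<rho> i \<omega>" using n that by (simp add: \<rho>_def)
      then show "n < i" using \<rho>_mono[OF elim(4,1), of i n] by (cases "n < i") auto
    next
      assume "n < i"
      then show "Y (\<Phi> \<omega>) n < Y (\<Phi> \<omega>) i"
        using \<rho>_strict_mono[OF elim(2) n] n by (simp add: \<rho>_def)
    qed
    then show ?thesis using elim(1) n by (auto simp: \<rho>_def)
  qed
  then show ?case
    using served serving_dist_served[OF \<Psi>_locally_finite[OF elim(4)], of \<theta>\<^sub>0 "\<Phi> \<omega>" n]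
    by (simp add: num_lines_eq_card_index[OF line_config_\<Phi>[OF elim(4)]] ld serving_radius_def)
qed

text \<open>Lines at distance \<open>r\<close> or more impose nothing, so finitely many independent
  conditions remain, each of which says that a chord carries no node.\<close>

lemma prob_others_farther:
  assumes \<omega>: "\<omega> \<in> space M" "\<forall>i. has_nth (\<Phi> \<omega>) i" and r: "0 \<le> r"
  shows "prob {\<omega>' \<in> space M. \<forall>i. i \<noteq> n \<longrightarrow> r \<le> sqrt ((\<rho> i \<omega>)\<^sup>2 + (W_others n \<omega>' i)\<^sup>2)}
    = (\<Prod>i\<in>{i. i \<noteq> n \<and> \<rho> i \<omega> < r}. void_prob lam_v r (\<rho> i \<omega>))"
proof -
  have "{\<omega>' \<in> space M. \<forall>i. i \<noteq> n \<longrightarrow> r \<le> sqrt ((\<rho> i \<omega>)\<^sup>2 + (W_others n \<omega>' i)\<^sup>2)}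
      = {\<omega>' \<in> space M. \<forall>i\<in>{i. i \<noteq> n \<and> \<rho> i \<omega> < r}. sqrt (r\<^sup>2 - (\<rho> i \<omega>)\<^sup>2) \<le> W i \<omega>'}"
    using le_sqrt_sum_iff[OF r \<rho>_nonneg[OF \<omega>(1) spec[OF \<omega>(2)]] W_nonneg]
    by (auto simp: W_others_def)
  also have "prob \<dots> = (\<Prod>i\<in>{i. i \<noteq> n \<and> \<rho> i \<omega> < r}. exp (- 2 * lam_v * sqrt (r\<^sup>2 - (\<rho> i \<omega>)\<^sup>2)))"
  proof (rule prob_W_ge_all)
    show "finite {i. i \<noteq> n \<and> \<rho> i \<omega> < r}"
      by (rule finite_subset[OF _ finite_\<rho>_less[OF \<omega>, of r]]) auto
    fix i assume "i \<in> {i. i \<noteq> n \<and> \<rho> i \<omega> < r}"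
    then have "(\<rho> i \<omega>)\<^sup>2 \<le> r\<^sup>2"
      using \<rho>_nonneg[OF \<omega>(1) spec[OF \<omega>(2)], of i] by (intro power_mono) auto
    then show "0 \<le> sqrt (r\<^sup>2 - (\<rho> i \<omega>)\<^sup>2)" by simp
  qed
  finally show ?thesis by (simp add: void_prob_def)
qed

text \<open>Independence is given in two layers: the lines against all nodes, and the nodes of
  different lines among each other. The lines are decoupled from the nodes, then
  \<open>W_others n\<close> from \<open>W n\<close> with the lines frozen, and finally the lines are
  joined to \<open>W n\<close> again.\<close>

lemma nn_integral_others_independent:
  fixes Q :: "((nat \<Rightarrow> real) \<times> real) \<times> (nat \<Rightarrow> real) \<Rightarrow> ennreal"
  assumes Q[measurable]: "Q \<in> borel_measurable ((PiM UNIV (\<lambda>_. borel) \<Otimes>\<^sub>M borel) \<Otimes>\<^sub>M PiM UNIV (\<lambda>_. borel))"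
  shows "(\<integral>\<^sup>+\<omega>. Q ((\<lambda>i. \<rho> i \<omega>, W n \<omega>), W_others n \<omega>) \<partial>M)
    = (\<integral>\<^sup>+\<omega>. \<integral>\<^sup>+\<omega>'. Q ((\<lambda>i. \<rho> i \<omega>, W n \<omega>), W_others n \<omega>') \<partial>M \<partial>M)"
proof -
  let ?S = "PiM UNIV (\<lambda>_. borel) :: (nat \<Rightarrow> real) measure"
  have [measurable]: "W_others n \<in> measurable M ?S"
    using indep_W_others[of n] by (simp add: indep_elements_def)
  define V where "V w i = (if i = n then 0 else w i)" for w :: "nat \<Rightarrow> real" and i
  have V[measurable]: "V \<in> measurable ?S ?S"
  proof (rule measurable_PiM_single')
    fix i
    show "(\<lambda>w. V w i) \<in> borel_measurable ?S"
      unfolding V_def by (cases "i = n") auto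
  qed auto
  have V_W: "V (\<lambda>i. W i \<omega>) = W_others n \<omega>" for \<omega>
    by (auto simp: V_def W_others_def)
  have "(\<integral>\<^sup>+\<omega>. Q ((\<lambda>i. \<rho> i \<omega>, W n \<omega>), W_others n \<omega>) \<partial>M)
      = (\<integral>\<^sup>+\<omega>. (\<lambda>(p, w). Q ((p, w n), V w)) (\<lambda>i. \<rho> i \<omega>, \<lambda>i. W i \<omega>) \<partial>M)"
    by (simp add: V_W)
  also have "\<dots> = (\<integral>\<^sup>+\<omega>. \<integral>\<^sup>+\<omega>'. (\<lambda>(p, w). Q ((p, w n), V w)) (\<lambda>i. \<rho> i \<omega>, \<lambda>i. W i \<omega>') \<partial>M \<partial>M)"
    by (rule indep_elements_nn_integral[OF indep_\<rho>_W]) measurable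
  also have "\<dots> = (\<integral>\<^sup>+\<omega>. \<integral>\<^sup>+\<omega>'. (\<lambda>(x, v). Q ((\<lambda>i. \<rho> i \<omega>, x), v)) (W n \<omega>', W_others n \<omega>') \<partial>M \<partial>M)"
    by (simp add: V_W)
  also have "\<dots> = (\<integral>\<^sup>+\<omega>. \<integral>\<^sup>+\<omega>'. \<integral>\<^sup>+\<omega>''. (\<lambda>(x, v). Q ((\<lambda>i. \<rho> i \<omega>, x), v)) (W n \<omega>', W_others n \<omega>'') \<partial>M \<partial>M \<partial>M)"
  proof (rule nn_integral_cong)
    fix \<omega>
    have "(\<lambda>(x, v). ((\<lambda>i. \<rho> i \<omega>, x), v)) \<in> measurable (borel \<Otimes>\<^sub>M ?S) ((?S \<Otimes>\<^sub>M borel) \<Otimes>\<^sub>M ?S)"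
      unfolding case_prod_beta' by (intro measurable_Pair measurable_const measurable_fst measurable_snd) (simp add: space_PiM)
    from measurable_compose[OF this Q]
    have "(\<lambda>(x, v). Q ((\<lambda>i. \<rho> i \<omega>, x), v)) \<in> borel_measurable (borel \<Otimes>\<^sub>M ?S)"
      by (simp add: case_prod_beta')
    then show "(\<integral>\<^sup>+\<omega>'. (\<lambda>(x, v). Q ((\<lambda>i. \<rho> i \<omega>, x), v)) (W n \<omega>', W_others n \<omega>') \<partial>M)
        = (\<integral>\<^sup>+\<omega>'. \<integral>\<^sup>+\<omega>''. (\<lambda>(x, v). Q ((\<lambda>i. \<rho> i \<omega>, x), v)) (W n \<omega>', W_others n \<omega>'') \<partial>M \<partial>M)"
      by (rule indep_elements_nn_integral[OF indep_W_others])
  qed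
  also have "\<dots> = (\<integral>\<^sup>+\<omega>. \<integral>\<^sup>+\<omega>'. (\<lambda>(p, w). \<integral>\<^sup>+\<omega>''. Q ((p, w n), W_others n \<omega>'') \<partial>M) (\<lambda>i. \<rho> i \<omega>, \<lambda>i. W i \<omega>') \<partial>M \<partial>M)"
    by simp
  also have "\<dots> = (\<integral>\<^sup>+\<omega>. (\<lambda>(p, w). \<integral>\<^sup>+\<omega>''. Q ((p, w n), W_others n \<omega>'') \<partial>M) (\<lambda>i. \<rho> i \<omega>, \<lambda>i. W i \<omega>) \<partial>M)"
    by (rule indep_elements_nn_integral[OF indep_\<rho>_W, symmetric]) measurable
  finally show ?thesis by simp
qed

text \<open>The product starts at index 0, so the typical line contributes besides the closer lines
  of the process.\<close>

definition closer_void :: "nat \<Rightarrow> 'w \<Rightarrow> real \<Rightarrow> ennreal" where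
  "closer_void n \<omega> r = (\<Prod>i<n. ennreal (void_prob lam_v r (\<rho> i \<omega>)))"

text \<open>The arbitrary \<open>f\<close> tests the joint law of offset and serving distance on the
  serving event. The order of averaging matters: the nodes of the other lines come first and produce
  the void probabilities, then come the lines beyond the \<open>n\<close>-th one, with
  \<open>W n\<close> frozen.\<close>

lemma nn_integral_served:
  assumes n: "1 \<le> n" and f[measurable]: "f \<in> borel_measurable (borel \<Otimes>\<^sub>M borel)"
  shows "(\<integral>\<^sup>+\<omega>. f (Y (\<Phi> \<omega>) n, serving_dist \<theta>\<^sub>0 (\<Phi> \<omega>) (\<Psi> \<omega>)) *
      (if served_by_line \<theta>\<^sub>0 (\<Phi> \<omega>) (\<Psi> \<omega>) n \<and>
        num_lines (\<Phi> \<omega>) (Y (\<Phi> \<omega>) n) (serving_dist \<theta>\<^sub>0 (\<Phi> \<omega>) (\<Psi> \<omega>)) = k then 1 else 0) \<partial>M)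
    = (\<integral>\<^sup>+\<omega>. f (\<rho> n \<omega>, serving_radius n \<omega>) * closer_void n \<omega> (serving_radius n \<omega>) *
        ennreal (ahead \<mu> lam_v k (\<rho> n \<omega>) (serving_radius n \<omega>)) \<partial>M)"
proof -
  let ?S = "PiM UNIV (\<lambda>_. borel) :: (nat \<Rightarrow> real) measure"
  define rad where "rad p w = sqrt ((p n)\<^sup>2 + w\<^sup>2)" for p :: "nat \<Rightarrow> real" and w :: real
  have rad: "rad (\<lambda>i. \<rho> i \<omega>) (W n \<omega>) = serving_radius n \<omega>" for \<omega>
    by (simp add: rad_def serving_radius_def)
  \<comment> \<open>\<open>Q0\<close> depends on the lines and on \<open>W n\<close> only; in
    \<open>Q\<close> the nodes of the other lines enter through a single indicator.\<close>
  define Q0 where "Q0 p w = f (p n, rad p w) * (if card {i. n < i \<and> p i < rad p w} = k then 1 else 0)" for p w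
  define Q where "Q x = Q0 (fst (fst x)) (snd (fst x)) *
    (if \<forall>i. i \<noteq> n \<longrightarrow> rad (fst (fst x)) (snd (fst x)) \<le> sqrt ((fst (fst x) i)\<^sup>2 + (snd x i)\<^sup>2) then 1 else 0)" for x
  define v where "v i p r = (if p i < r then ennreal (void_prob lam_v r (p i)) else 0)"
    for i and p :: "nat \<Rightarrow> real" and r
  define K where "K x = f (snd x n, rad (snd x) (fst x)) * (\<Prod>i<n. ennreal (void_prob lam_v (rad (snd x) (fst x)) (snd x i))) *
    ((\<Prod>i\<in>{n<..n + k}. v i (snd x) (rad (snd x) (fst x))) *
      (if rad (snd x) (fst x) \<le> snd x (Suc (n + k)) then 1 else 0))" for x
  have rad_meas [measurable]: "(\<lambda>x. rad (fst x) (snd x)) \<in> borel_measurable (?S \<Otimes>\<^sub>M borel)"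
    unfolding rad_def by measurable
  have Q0_meas: "(\<lambda>x. Q0 (fst x) (snd x)) \<in> borel_measurable (?S \<Otimes>\<^sub>M borel)"
  proof -
    have [measurable]: "(\<lambda>x. card {i. n < i \<and> fst x i < rad (fst x) (snd x)}) \<in> measurable (?S \<Otimes>\<^sub>M borel) (count_space UNIV)"
      by (rule measurable_card) simp
    show ?thesis unfolding Q0_def by measurable
  qed
  have Q: "Q \<in> borel_measurable ((?S \<Otimes>\<^sub>M borel) \<Otimes>\<^sub>M ?S)"
  proof -
    have [measurable]: "(\<lambda>x. Q0 (fst (fst x)) (snd (fst x))) \<in> borel_measurable ((?S \<Otimes>\<^sub>M borel) \<Otimes>\<^sub>M ?S)"
      "(\<lambda>x. rad (fst (fst x)) (snd (fst x))) \<in> borel_measurable ((?S \<Otimes>\<^sub>M borel) \<Otimes>\<^sub>M ?S)"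
      using measurable_compose[OF measurable_fst Q0_meas] measurable_compose[OF measurable_fst rad_meas] by simp_all
    have [measurable]: "(\<lambda>x. fst (fst x) i) \<in> borel_measurable ((?S \<Otimes>\<^sub>M (borel :: real measure)) \<Otimes>\<^sub>M ?S)"
      "(\<lambda>x. snd x i) \<in> borel_measurable ((?S \<Otimes>\<^sub>M (borel :: real measure)) \<Otimes>\<^sub>M ?S)" for i
      by measurable
    show ?thesis
      unfolding Q_def[abs_def] by measurable
  qed
  have K: "K \<in> borel_measurable (borel \<Otimes>\<^sub>M ?S)"
    unfolding K_def[abs_def] v_def rad_def by measurable
  have "(\<integral>\<^sup>+\<omega>. f (Y (\<Phi> \<omega>) n, serving_dist \<theta>\<^sub>0 (\<Phi> \<omega>) (\<Psi> \<omega>)) *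
      (if served_by_line \<theta>\<^sub>0 (\<Phi> \<omega>) (\<Psi> \<omega>) n \<and>
        num_lines (\<Phi> \<omega>) (Y (\<Phi> \<omega>) n) (serving_dist \<theta>\<^sub>0 (\<Phi> \<omega>) (\<Psi> \<omega>)) = k then 1 else 0) \<partial>M)
      = (\<integral>\<^sup>+\<omega>. Q ((\<lambda>i. \<rho> i \<omega>, W n \<omega>), W_others n \<omega>) \<partial>M)"
  proof (rule nn_integral_cong_AE)
    show "AE \<omega> in M. f (Y (\<Phi> \<omega>) n, serving_dist \<theta>\<^sub>0 (\<Phi> \<omega>) (\<Psi> \<omega>)) *
      (if served_by_line \<theta>\<^sub>0 (\<Phi> \<omega>) (\<Psi> \<omega>) n \<and>
        num_lines (\<Phi> \<omega>) (Y (\<Phi> \<omega>) n) (serving_dist \<theta>\<^sub>0 (\<Phi> \<omega>) (\<Psi> \<omega>)) = k then 1 else 0)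
      = Q ((\<lambda>i. \<rho> i \<omega>, W n \<omega>), W_others n \<omega>)"
      using AE_served_count_iff[OF n]
    proof eventually_elim
      case (elim \<omega>)
      have Y: "Y (\<Phi> \<omega>) n = \<rho> n \<omega>" using n by (simp add: \<rho>_def)
      have others: "(\<forall>i. i \<noteq> n \<longrightarrow> serving_radius n \<omega> \<le> sqrt ((\<rho> i \<omega>)\<^sup>2 + (W_others n \<omega> i)\<^sup>2))
          \<longleftrightarrow> served_by_line \<theta>\<^sub>0 (\<Phi> \<omega>) (\<Psi> \<omega>) n"
        using elim by (simp add: W_others_def)
      show ?case
      proof (cases "served_by_line \<theta>\<^sub>0 (\<Phi> \<omega>) (\<Psi> \<omega>) n")
        case True
        with elim have "serving_dist \<theta>\<^sub>0 (\<Phi> \<omega>) (\<Psi> \<omega>) = serving_radius n \<omega>"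
          "num_lines (\<Phi> \<omega>) (Y (\<Phi> \<omega>) n) (serving_radius n \<omega>) = card {i. n < i \<and> \<rho> i \<omega> < serving_radius n \<omega>}"
          by blast+
        with True others show ?thesis by (simp add: Q_def Q0_def rad Y)
      next
        case False
        then show ?thesis unfolding Q_def fst_conv snd_conv rad others by simp
      qed
    qed
  qed
  also have "\<dots> = (\<integral>\<^sup>+\<omega>. \<integral>\<^sup>+\<omega>'. Q ((\<lambda>i. \<rho> i \<omega>, W n \<omega>), W_others n \<omega>') \<partial>M \<partial>M)"
    by (rule nn_integral_others_independent[OF Q])
  also have "\<dots> = (\<integral>\<^sup>+\<omega>. K (W n \<omega>, \<lambda>i. \<rho> i \<omega>) \<partial>M)"
  proof (rule nn_integral_cong_AE)
    show "AE \<omega> in M. (\<integral>\<^sup>+\<omega>'. Q ((\<lambda>i. \<rho> i \<omega>, W n \<omega>), W_others n \<omega>') \<partial>M) = K (W n \<omega>, \<lambda>i. \<rho> i \<omega>)"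
      using AE_has_nth AE_\<rho>_strict AE_W_pos[of n] AE_space
    proof eventually_elim
      case (elim \<omega>)
      let ?r = "serving_radius n \<omega>"
      let ?B = "{\<omega>' \<in> space M. \<forall>i. i \<noteq> n \<longrightarrow> ?r \<le> sqrt ((\<rho> i \<omega>)\<^sup>2 + (W_others n \<omega>' i)\<^sup>2)}"
      have wo [measurable]: "(\<lambda>\<omega>'. W_others n \<omega>' i) \<in> borel_measurable M" for i
        unfolding W_others_def by (cases "i = n") auto
      have B: "?B \<in> events" by measurable
      have r: "0 \<le> ?r" "\<rho> n \<omega> < ?r"
      proof -
        show "0 \<le> ?r" by (simp add: serving_radius_def)
        have "sqrt ((\<rho> n \<omega>)\<^sup>2) < ?r"
          unfolding serving_radius_def using elim(3) by (intro real_sqrt_less_mono) simp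
        then show "\<rho> n \<omega> < ?r" by simp
      qed
      \<comment> \<open>All lines closer than the \<open>n\<close>-th one meet the disc, so the
        product over the constrained lines splits into \<open>closer_void\<close> and the lines in
        between.\<close>
      have split: "{i. i \<noteq> n \<and> \<rho> i \<omega> < ?r} = {..<n} \<union> {i. n < i \<and> \<rho> i \<omega> < ?r}"
      proof -
        have "\<rho> i \<omega> < ?r" if "i < n" for i
          using \<rho>_mono[OF elim(4,1), of i n] that r(2) by simp
        then show ?thesis by (auto simp: nat_neq_iff)
      qed
      have fin: "finite {i. n < i \<and> \<rho> i \<omega> < ?r}"
        by (rule finite_subset[OF _ finite_\<rho>_less[OF elim(4,1), of ?r]]) auto
      have "(\<integral>\<^sup>+\<omega>'. Q ((\<lambda>i. \<rho> i \<omega>, W n \<omega>), W_others n \<omega>') \<partial>M)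
          = (\<integral>\<^sup>+\<omega>'. Q0 (\<lambda>i. \<rho> i \<omega>) (W n \<omega>) * indicator ?B \<omega>' \<partial>M)"
        by (intro nn_integral_cong) (simp add: Q_def rad indicator_def)
      also have "\<dots> = Q0 (\<lambda>i. \<rho> i \<omega>) (W n \<omega>) * ennreal (prob ?B)"
        using B by (simp add: nn_integral_cmult_indicator emeasure_eq_measure)
      also have "ennreal (prob ?B) = (\<Prod>i\<in>{i. i \<noteq> n \<and> \<rho> i \<omega> < ?r}. ennreal (void_prob lam_v ?r (\<rho> i \<omega>)))"
        unfolding prob_others_farther[OF elim(4,1) r(1)]
        by (rule prod_ennreal[symmetric]) (simp add: void_prob_pos less_imp_le)
      also have "\<dots> = closer_void n \<omega> ?r * (\<Prod>i\<in>{i. n < i \<and> \<rho> i \<omega> < ?r}. ennreal (void_prob lam_v ?r (\<rho> i \<omega>)))"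
        unfolding split closer_void_def using fin by (intro prod.union_disjoint) auto
      finally have "(\<integral>\<^sup>+\<omega>'. Q ((\<lambda>i. \<rho> i \<omega>, W n \<omega>), W_others n \<omega>') \<partial>M) = f (\<rho> n \<omega>, ?r) * closer_void n \<omega> ?r *
          ((if card {i. n < i \<and> \<rho> i \<omega> < ?r} = k then 1 else 0) *
            (\<Prod>i\<in>{i. n < i \<and> \<rho> i \<omega> < ?r}. ennreal (void_prob lam_v ?r (\<rho> i \<omega>))))"
        by (simp add: Q0_def rad mult_ac)
      then show ?case
        unfolding prod_points_ahead[OF elim(4,1,2)] by (simp add: K_def v_def rad closer_void_def)
    qed
  qed
  \<comment> \<open>Freezing \<open>W n\<close> makes the radius a function of
    \<open>\<rho> n\<close> alone, hence measurable with respect to \<open>F n\<close>, as the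
    induction over gaps requires.\<close>
  also have "\<dots> = (\<integral>\<^sup>+\<omega>. \<integral>\<^sup>+\<omega>'. K (W n \<omega>, \<lambda>i. \<rho> i \<omega>') \<partial>M \<partial>M)"
  proof -
    have "indep_elements borel (\<lambda>\<omega>. W n \<omega>) ?S (\<lambda>\<omega> i. \<rho> i \<omega>)"
      using indep_elements_compose[OF indep_elements_commute[OF indep_\<rho>_W], of "\<lambda>w. w n" borel "\<lambda>p. p" ?S] by simp
    from indep_elements_nn_integral[OF this K] show ?thesis .
  qed
  also have "\<dots> = (\<integral>\<^sup>+\<omega>. \<integral>\<^sup>+\<omega>'. (\<lambda>(w, p). f (p n, rad p w) * (\<Prod>i<n. ennreal (void_prob lam_v (rad p w) (p i))) *
      ennreal (ahead \<mu> lam_v k (p n) (rad p w))) (W n \<omega>, \<lambda>i. \<rho> i \<omega>') \<partial>M \<partial>M)"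
  proof (rule nn_integral_cong)
    fix \<omega>
    define w where "w = W n \<omega>"
    have F[measurable]: "\<rho> i \<in> borel_measurable (F n)" if "i \<le> n" for i
      using borel_measurable_\<rho>_F[of i n] that by (cases "i = 0") (auto simp: \<rho>_def[abs_def])
    have [measurable]: "(\<lambda>\<omega>'. rad (\<lambda>i. \<rho> i \<omega>') w) \<in> borel_measurable (F n)"
      unfolding rad_def using F[of n] by measurable
    have "(\<lambda>\<omega>'. \<Prod>i<n. ennreal (void_prob lam_v (rad (\<lambda>i. \<rho> i \<omega>') w) (\<rho> i \<omega>'))) \<in> borel_measurable (F n)"
      by (rule borel_measurable_prod_ennreal) (use F in \<open>simp; measurable\<close>)
    then have G: "(\<lambda>\<omega>'. f (\<rho> n \<omega>', rad (\<lambda>i. \<rho> i \<omega>') w) *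
        (\<Prod>i<n. ennreal (void_prob lam_v (rad (\<lambda>i. \<rho> i \<omega>') w) (\<rho> i \<omega>')))) \<in> borel_measurable (F n)"
      using F[of n] by measurable
    have "\<rho> n \<omega>' \<le> rad (\<lambda>i. \<rho> i \<omega>') w" for \<omega>'
      unfolding rad_def by (rule real_le_rsqrt) simp
    from nn_integral_points_ahead[OF n G _ this, where k = k and \<nu> = lam_v]
    show "(\<integral>\<^sup>+\<omega>'. K (W n \<omega>, \<lambda>i. \<rho> i \<omega>') \<partial>M) = (\<integral>\<^sup>+\<omega>'. (\<lambda>(w, p). f (p n, rad p w) *
        (\<Prod>i<n. ennreal (void_prob lam_v (rad p w) (p i))) *
        ennreal (ahead \<mu> lam_v k (p n) (rad p w))) (W n \<omega>, \<lambda>i. \<rho> i \<omega>') \<partial>M)"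
      by (simp add: K_def v_def w_def[symmetric])
  qed
  also have "\<dots> = (\<integral>\<^sup>+\<omega>. (\<lambda>(w, p). f (p n, rad p w) * (\<Prod>i<n. ennreal (void_prob lam_v (rad p w) (p i))) *
      ennreal (ahead \<mu> lam_v k (p n) (rad p w))) (W n \<omega>, \<lambda>i. \<rho> i \<omega>) \<partial>M)"
  proof -
    have "indep_elements borel (\<lambda>\<omega>. W n \<omega>) ?S (\<lambda>\<omega> i. \<rho> i \<omega>)"
      using indep_elements_compose[OF indep_elements_commute[OF indep_\<rho>_W], of "\<lambda>w. w n" borel "\<lambda>p. p" ?S] by simp
    moreover have "(\<lambda>(w, p). f (p n, rad p w) * (\<Prod>i<n. ennreal (void_prob lam_v (rad p w) (p i))) *
        ennreal (ahead \<mu> lam_v k (p n) (rad p w))) \<in> borel_measurable (borel \<Otimes>\<^sub>M ?S)"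
      unfolding case_prod_beta' rad_def by measurable
    ultimately show ?thesis by (rule indep_elements_nn_integral[symmetric])
  qed
  finally show ?thesis by (simp add: rad closer_void_def)
qed

end

section \<open>The conditional distribution\<close>

lemma void_prob_le_1:
  assumes "0 \<le> \<nu>" "0 \<le> u" "u \<le> r"
  shows "void_prob \<nu> r u \<le> 1"
  using assms power_mono[of u r 2] by (simp add: void_prob_def)

text \<open>Dominated convergence with moving limits of integration: the indicators converge except
  at the two end points. Restricting to \<open>0 < fst p\<close> keeps \<open>u\<close> positive,
  where the integrand is at most 1 up to the radius; along a convergent sequence the radii are
  bounded by some \<open>C\<close>, so \<open>indicator {0..C}\<close> dominates.\<close>

lemma continuous_on_void_mass:
  assumes "0 \<le> \<nu>"
  shows "continuous_on {p. 0 < fst p} (\<lambda>p. void_mass \<nu> (fst p) (snd p))"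
  unfolding continuous_on_sequentially
proof (intro allI ballI impI, elim conjE)
  fix x :: "nat \<Rightarrow> real \<times> real" and a
  assume a: "a \<in> {p. 0 < fst p}" and x: "\<forall>n. x n \<in> {p. 0 < fst p}" "x \<longlonglongrightarrow> a"
  have fst_lim: "(\<lambda>n. fst (x n)) \<longlonglongrightarrow> fst a" and snd_lim: "(\<lambda>n. snd (x n)) \<longlonglongrightarrow> snd a"
    using tendsto_fst[OF x(2)] tendsto_snd[OF x(2)] by auto
  have "Bseq (\<lambda>n. snd (x n))"
    using snd_lim by (intro convergent_imp_Bseq) (auto simp: convergent_def)
  then obtain C where C: "\<And>n. \<bar>snd (x n)\<bar> \<le> C"
    by (auto simp: Bseq_def)
  have "(\<lambda>n. LBINT u. indicator {fst (x n)..snd (x n)} u *\<^sub>R void_prob \<nu> (snd (x n)) u)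
      \<longlonglongrightarrow> (LBINT u. indicator {fst a..snd a} u *\<^sub>R void_prob \<nu> (snd a) u)"
  proof (rule integral_dominated_convergence[where w = "indicator {0..C}"])
    show "AE u in lborel. (\<lambda>n. indicator {fst (x n)..snd (x n)} u *\<^sub>R void_prob \<nu> (snd (x n)) u)
        \<longlonglongrightarrow> indicator {fst a..snd a} u *\<^sub>R void_prob \<nu> (snd a) u"
      using AE_lborel_singleton[of "fst a"] AE_lborel_singleton[of "snd a"]
    proof eventually_elim
      case (elim u)
      have "\<forall>\<^sub>F n in sequentially. indicator {fst a..snd a} u = (indicator {fst (x n)..snd (x n)} u :: real)"
      proof (cases "fst a < u \<and> u < snd a")
        case True
        have "\<forall>\<^sub>F n in sequentially. fst (x n) < u" "\<forall>\<^sub>F n in sequentially. u < snd (x n)"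
          using True order_tendstoD(2)[OF fst_lim, of u] order_tendstoD(1)[OF snd_lim, of u] by auto
        then show ?thesis by eventually_elim (use True in \<open>auto simp: indicator_def\<close>)
      next
        case False
        then consider "u < fst a" | "snd a < u" using elim by linarith
        then show ?thesis
        proof cases
          case 1
          then have "\<forall>\<^sub>F n in sequentially. u < fst (x n)" by (rule order_tendstoD(1)[OF fst_lim])
          then show ?thesis by eventually_elim (use 1 in \<open>auto simp: indicator_def\<close>)
        next
          case 2
          then have "\<forall>\<^sub>F n in sequentially. snd (x n) < u" by (rule order_tendstoD(2)[OF snd_lim])
          then show ?thesis by eventually_elim (use 2 in \<open>auto simp: indicator_def\<close>)
        qed
      qed
      then have "(\<lambda>n. indicator {fst (x n)..snd (x n)} u :: real) \<longlonglongrightarrow> indicator {fst a..snd a} u"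
        by (rule Lim_transform_eventually[OF tendsto_const])
      then show ?case
        unfolding void_prob_def by (intro tendsto_intros snd_lim)
    qed
    show "integrable lborel (indicator {0..C} :: real \<Rightarrow> real)"
      by (intro integrable_real_indicator) (auto simp: emeasure_lborel_Icc_eq)
    fix n
    show "AE u in lborel. norm (indicator {fst (x n)..snd (x n)} u *\<^sub>R void_prob \<nu> (snd (x n)) u) \<le> indicator {0..C} u"
    proof (rule AE_I2)
      fix u
      have "0 < fst (x n)" "snd (x n) \<le> C" using x(1) C[of n] by auto
      then show "norm (indicator {fst (x n)..snd (x n)} u *\<^sub>R void_prob \<nu> (snd (x n)) u) \<le> indicator {0..C} u"
        using void_prob_le_1[OF assms, of u "snd (x n)"] void_prob_pos[of \<nu> "snd (x n)" u]
        by (auto simp: indicator_def)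
    qed
  qed measurable
  then show "((\<lambda>p. void_mass \<nu> (fst p) (snd p)) \<circ> x) \<longlonglongrightarrow> void_mass \<nu> (fst a) (snd a)"
    by (simp add: void_mass_def set_lebesgue_integral_def o_def)
qed

definition count_prob :: "real \<Rightarrow> real \<Rightarrow> nat \<Rightarrow> real \<Rightarrow> real \<Rightarrow> real" where
  "count_prob \<mu> \<nu> k y r = exp (- (\<mu> * void_mass \<nu> y r)) * (\<mu> * void_mass \<nu> y r) ^ k / fact k"

lemma borel_measurable_count_prob [measurable]:
  assumes [measurable]: "y \<in> borel_measurable N" "r \<in> borel_measurable N"
  shows "(\<lambda>x. count_prob \<mu> \<nu> k (y x) (r x)) \<in> borel_measurable N"
  unfolding count_prob_def by measurable

lemma count_prob_nonneg: "0 \<le> \<mu> \<Longrightarrow> 0 \<le> count_prob \<mu> \<nu> k y r"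
  by (simp add: count_prob_def void_mass_nonneg)

lemma sums_power_over_fact: "(\<lambda>k. x ^ k / fact k) sums exp (x :: real)"
  using exp_converges[of x] by (simp add: field_simps)

lemma count_prob_le_1:
  assumes "0 \<le> \<mu>"
  shows "count_prob \<mu> \<nu> k y r \<le> 1"
proof -
  define m where "m = \<mu> * void_mass \<nu> y r"
  have "0 \<le> m" using assms by (simp add: m_def void_mass_nonneg)
  then have "m ^ k / fact k \<le> exp m"
    using sum_le_suminf[OF sums_summable[OF sums_power_over_fact[of m]], of "{k}"]
    by (simp add: sums_unique[OF sums_power_over_fact, symmetric])
  then have "exp (- m) * (m ^ k / fact k) \<le> exp (- m) * exp m"
    by (intro mult_left_mono) auto
  then show ?thesis
    by (simp add: count_prob_def m_def[symmetric] exp_add[symmetric])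
qed

text \<open>The normalisation. With \<open>m = \<mu> * void_mass \<nu> y r\<close>, the exponential
  series sums the weights to \<open>exp (- \<mu> * (r - y)) * exp m\<close>, and dividing by this
  replaces \<open>exp (- \<mu> * (r - y))\<close> by \<open>exp (- m)\<close>.\<close>

lemma count_prob_times_suminf_ahead:
  assumes "0 \<le> \<mu>"
  shows "ennreal (count_prob \<mu> \<nu> k y r) * (\<Sum>j. ennreal (ahead \<mu> \<nu> j y r)) = ennreal (ahead \<mu> \<nu> k y r)"
proof -
  define m where "m = \<mu> * void_mass \<nu> y r"
  have "(\<lambda>j. exp (- \<mu> * (r - y)) * (m ^ j / fact j)) sums (exp (- \<mu> * (r - y)) * exp m)"
    by (intro sums_mult sums_power_over_fact)
  then have "(\<lambda>j. ahead \<mu> \<nu> j y r) sums (exp (- \<mu> * (r - y)) * exp m)"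
    by (simp add: ahead_def m_def)
  then have "(\<Sum>j. ennreal (ahead \<mu> \<nu> j y r)) = ennreal (exp (- \<mu> * (r - y)) * exp m)"
    by (intro suminf_ennreal_eq ahead_nonneg assms)
  moreover have "count_prob \<mu> \<nu> k y r * (exp (- \<mu> * (r - y)) * exp m) = ahead \<mu> \<nu> k y r * (exp (- m) * exp m)"
    by (simp add: count_prob_def ahead_def m_def)
  ultimately show ?thesis
    using count_prob_nonneg[OF assms, of \<nu> k y r] by (simp add: ennreal_mult[symmetric] exp_add[symmetric])
qed

section \<open>Positive probability near every admissible pair\<close>

context line_process
begin

text \<open>It suffices to have \<open>n - 1\<close> lines before \<open>a\<close> and exactly one
  in the strip from \<open>a\<close> to \<open>b\<close>: two independent events of positive
  probability.\<close>

lemma prob_\<rho>_between_pos: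
  assumes "1 \<le> n" "0 < a" "a < b"
  shows "0 < prob {\<omega> \<in> space M. a \<le> \<rho> n \<omega> \<and> \<rho> n \<omega> < b}"
proof -
  define B where "B j = (if j = 0 then strip 0 a else if j = 1 then strip a b else {})" for j :: nat
  have B: "bounded (B j)" "B j \<in> sets borel" for j
    by (auto simp: B_def bounded_strip sets_strip)
  moreover have "disjoint_family B"
    by (auto simp: disjoint_family_on_def B_def strip_def)
  ultimately have ind: "indep_vars (\<lambda>_. count_space UNIV) (\<lambda>j \<omega>. card (\<Phi> \<omega> \<inter> B j)) UNIV"
    using PPP unfolding homogeneous_PPP_def by blast
  define c where "c j = (if j = 0 then n - 1 else 1)" for j :: nat
  have "prob (\<Inter>j\<in>{0, 1}. (\<lambda>\<omega>. card (\<Phi> \<omega> \<inter> B j)) -` {c j} \<inter> space M)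
      = (\<Prod>j\<in>{0, 1}. prob ((\<lambda>\<omega>. card (\<Phi> \<omega> \<inter> B j)) -` {c j} \<inter> space M))"
    by (rule indep_varsD[OF ind]) auto
  also have "\<dots> = prob {\<omega> \<in> space M. card (\<Phi> \<omega> \<inter> strip 0 a) = n - 1} * prob {\<omega> \<in> space M. card (\<Phi> \<omega> \<inter> strip a b) = 1}"
    by (simp add: B_def c_def vimage_def Int_def conj_commute)
  also have "\<dots> > 0"
    using assms \<mu>_pos prob_strip[of 0 a "n - 1"] prob_strip[of a b 1] by simp
  finally have "0 < prob (\<Inter>j\<in>{0, 1}. (\<lambda>\<omega>. card (\<Phi> \<omega> \<inter> B j)) -` {c j} \<inter> space M)" .
  also have "(\<Inter>j\<in>{0, 1}. (\<lambda>\<omega>. card (\<Phi> \<omega> \<inter> B j)) -` {c j} \<inter> space M)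
      = {\<omega> \<in> space M. card (\<Phi> \<omega> \<inter> strip 0 a) = n - 1 \<and> card (\<Phi> \<omega> \<inter> strip a b) = 1}"
    by (auto simp: B_def c_def)
  also have "prob \<dots> \<le> prob {\<omega> \<in> space M. a \<le> \<rho> n \<omega> \<and> \<rho> n \<omega> < b}"
  proof (rule finite_measure_mono_AE)
    show "AE \<omega> in M. \<omega> \<in> {\<omega> \<in> space M. card (\<Phi> \<omega> \<inter> strip 0 a) = n - 1 \<and> card (\<Phi> \<omega> \<inter> strip a b) = 1} \<longrightarrow>
        \<omega> \<in> {\<omega> \<in> space M. a \<le> \<rho> n \<omega> \<and> \<rho> n \<omega> < b}"
      using AE_has_nth AE_space
    proof eventually_elim
      case (elim \<omega>)
      note less = \<rho>_less_iff[OF elim(2) spec[OF elim(1)] assms(1)]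
      note config = line_config_\<Phi>[OF elim(2)]
      have "card (lines_within (\<Phi> \<omega>) b) = card (lines_within (\<Phi> \<omega>) a) + card (\<Phi> \<omega> \<inter> strip a b)"
        using assms by (intro card_lines_within_add[OF config]) auto
      then show ?case
        using less[of a] less[of b] assms(1) elim(2) by (auto simp: lines_within_eq_strip[OF config, of a])
    qed
  qed auto
  finally show ?thesis .
qed

end

context cox_lines
begin

lemma prob_W_between_pos:
  assumes "0 \<le> a" "a < b"
  shows "0 < prob {\<omega> \<in> space M. a \<le> W i \<omega> \<and> W i \<omega> < b}"
proof -
  have "{\<omega> \<in> space M. a \<le> W i \<omega> \<and> W i \<omega> < b} = {\<omega> \<in> space M. a \<le> W i \<omega>} - {\<omega> \<in> space M. b \<le> W i \<omega>}"
    by auto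
  also have "prob \<dots> = prob {\<omega> \<in> space M. a \<le> W i \<omega>} - prob {\<omega> \<in> space M. b \<le> W i \<omega>}"
    using assms by (intro finite_measure_Diff) auto
  also have "\<dots> = exp (- 2 * lam_v * a) - exp (- 2 * lam_v * b)"
    using prob_W_ge[of a i] prob_W_ge[of b i] assms by simp
  also have "\<dots> > 0"
    using assms lam_v_pos by simp
  finally show ?thesis .
qed

text \<open>In the coordinates \<open>(\<rho> n, W n)\<close> the point \<open>(y, r)\<close>
  becomes \<open>(y, w)\<close>, and a small rectangle around it has positive probability by
  independence.\<close>

lemma prob_offset_radius_pos:
  assumes "1 \<le> n" "0 < y" "y < r" "0 < \<epsilon>"
  shows "0 < prob {\<omega> \<in> space M. (\<rho> n \<omega>, serving_radius n \<omega>) \<in> ball (y, r) \<epsilon>}"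
proof -
  define w where "w = sqrt (r\<^sup>2 - y\<^sup>2)"
  have "y\<^sup>2 < r\<^sup>2" using assms by (intro power_strict_mono) auto
  then have w: "0 < w" "sqrt (y\<^sup>2 + w\<^sup>2) = r"
    using assms by (simp_all add: w_def)
  let ?g = "\<lambda>p :: real \<times> real. (fst p, sqrt ((fst p)\<^sup>2 + (snd p)\<^sup>2))"
  have "isCont ?g (y, w)"
    by (intro continuous_intros)
  then obtain d where d: "0 < d" "\<And>p. dist p (y, w) < d \<Longrightarrow> dist (?g p) (y, r) < \<epsilon>"
    using assms(4) w(2) unfolding continuous_at_eps_delta by (metis fst_conv snd_conv)
  \<comment> \<open>The halves of \<open>y\<close> and \<open>w\<close> keep the rectangle in the
    positive quadrant; \<open>d / 3\<close> keeps the sum of the two deviations below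
    \<open>d\<close>.\<close>
  define \<eta> where "\<eta> = min (d / 3) (min (y / 2) (w / 2))"
  have \<eta>: "0 < \<eta>" "\<eta> < y" "\<eta> < w" "2 * \<eta> < d"
    using d(1) assms(2) w(1) by (auto simp: \<eta>_def)
  let ?A = "{y - \<eta>..<y + \<eta>}" and ?B = "{w - \<eta>..<w + \<eta>}"
  have "0 < prob {\<omega> \<in> space M. y - \<eta> \<le> \<rho> n \<omega> \<and> \<rho> n \<omega> < y + \<eta>} * prob {\<omega> \<in> space M. w - \<eta> \<le> W n \<omega> \<and> W n \<omega> < w + \<eta>}"
    using \<eta> by (intro mult_pos_pos prob_\<rho>_between_pos[OF assms(1)] prob_W_between_pos) auto
  also have "\<dots> = prob (\<rho> n -` ?A \<inter> space M) * prob (W n -` ?B \<inter> space M)"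
    by (intro arg_cong2[where f = "(*)"] arg_cong[where f = prob]) auto
  also have "\<dots> = prob ((\<rho> n -` ?A \<inter> space M) \<inter> (W n -` ?B \<inter> space M))"
  proof -
    have "indep_elements borel (\<lambda>\<omega>. \<rho> n \<omega>) borel (\<lambda>\<omega>. W n \<omega>)"
      using indep_elements_compose[OF indep_\<rho>_W, of "\<lambda>p. p n" borel "\<lambda>w. w n" borel] by simp
    then show ?thesis unfolding indep_elements_def by simp
  qed
  also have "\<dots> \<le> prob {\<omega> \<in> space M. (\<rho> n \<omega>, serving_radius n \<omega>) \<in> ball (y, r) \<epsilon>}"
  proof (rule finite_measure_mono)
    show "(\<rho> n -` ?A \<inter> space M) \<inter> (W n -` ?B \<inter> space M)
        \<subseteq> {\<omega> \<in> space M. (\<rho> n \<omega>, serving_radius n \<omega>) \<in> ball (y, r) \<epsilon>}"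
    proof safe
      fix \<omega> assume "\<rho> n \<omega> \<in> ?A" "W n \<omega> \<in> ?B"
      then have "\<bar>\<rho> n \<omega> - y\<bar> \<le> \<eta>" "\<bar>W n \<omega> - w\<bar> \<le> \<eta>" by auto
      moreover have "dist (\<rho> n \<omega>, W n \<omega>) (y, w) \<le> \<bar>\<rho> n \<omega> - y\<bar> + \<bar>W n \<omega> - w\<bar>"
        unfolding dist_Pair_Pair dist_real_def by (rule sqrt_sum_squares_le_sum_abs[THEN order_trans]) simp
      ultimately have "dist (\<rho> n \<omega>, W n \<omega>) (y, w) < d" using \<eta>(4) by linarith
      from d(2)[OF this] show "(\<rho> n \<omega>, serving_radius n \<omega>) \<in> ball (y, r) \<epsilon>"
        by (simp add: serving_radius_def dist_commute)
    qed
    show "{\<omega> \<in> space M. (\<rho> n \<omega>, serving_radius n \<omega>) \<in> ball (y, r) \<epsilon>} \<in> events"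
      unfolding serving_radius_def mem_ball by measurable
  qed
  finally show ?thesis .
qed

definition served :: "nat \<Rightarrow> 'w \<Rightarrow> bool" where
  "served n \<omega> \<longleftrightarrow> served_by_line \<theta>\<^sub>0 (\<Phi> \<omega>) (\<Psi> \<omega>) n"

definition offset_dist :: "nat \<Rightarrow> 'w \<Rightarrow> real \<times> real" where
  "offset_dist n \<omega> = (Y (\<Phi> \<omega>) n, serving_dist \<theta>\<^sub>0 (\<Phi> \<omega>) (\<Psi> \<omega>))"

definition num_between :: "nat \<Rightarrow> 'w \<Rightarrow> nat" where
  "num_between n \<omega> = num_lines (\<Phi> \<omega>) (fst (offset_dist n \<omega>)) (snd (offset_dist n \<omega>))"

definition q :: "nat \<Rightarrow> real \<times> real \<Rightarrow> real" where
  "q k p = count_prob \<mu> lam_v k (fst p) (snd p)"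

lemma borel_measurable_q [measurable]: "q k \<in> borel_measurable borel"
proof -
  have "q k \<in> borel_measurable (borel \<Otimes>\<^sub>M borel)"
    unfolding q_def[abs_def] by measurable
  then show ?thesis unfolding borel_prod .
qed

lemma q_nonneg: "0 \<le> q k p" and q_le_1: "q k p \<le> 1"
  using \<mu>_pos by (simp_all add: q_def count_prob_nonneg count_prob_le_1)

context
  fixes n :: nat
  assumes n: "1 \<le> n"
begin

lemma measurable_served [measurable]: "Measurable.pred M (served n)"
  unfolding served_def[abs_def] by (rule measurable_served_by_line[OF \<Phi>_meas \<Phi>_sub \<Psi>_meas])

lemma measurable_offset_dist [measurable]: "offset_dist n \<in> borel_measurable M"
  unfolding offset_dist_def[abs_def]
  using borel_measurable_Y[OF \<Phi>_meas \<Phi>_sub n] borel_measurable_serving_dist[OF \<Phi>_meas \<Phi>_sub \<Psi>_meas]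
  by (rule borel_measurable_Pair)

lemma measurable_offset_dist_pair: "offset_dist n \<in> measurable M (borel \<Otimes>\<^sub>M borel)"
  using measurable_offset_dist unfolding borel_prod .

lemma measurable_num_between [measurable]: "num_between n \<in> measurable M (count_space UNIV)"
proof -
  have "(\<lambda>\<omega>. fst (offset_dist n \<omega>)) \<in> borel_measurable M" "(\<lambda>\<omega>. snd (offset_dist n \<omega>)) \<in> borel_measurable M"
    using measurable_compose[OF measurable_offset_dist_pair measurable_fst]
      measurable_compose[OF measurable_offset_dist_pair measurable_snd] by auto
  then show ?thesis
    unfolding num_between_def[abs_def] by (rule measurable_num_lines[OF \<Phi>_meas \<Phi>_sub])
qed

lemma nn_integral_served_count:
  assumes f: "f \<in> borel_measurable borel"
  shows "(\<integral>\<^sup>+\<omega>. f (offset_dist n \<omega>) * (if served n \<omega> \<and> num_between n \<omega> = k then 1 else 0) \<partial>M)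
    = (\<integral>\<^sup>+\<omega>. f (\<rho> n \<omega>, serving_radius n \<omega>) * closer_void n \<omega> (serving_radius n \<omega>) *
        ennreal (ahead \<mu> lam_v k (\<rho> n \<omega>) (serving_radius n \<omega>)) \<partial>M)"
  using nn_integral_served[OF n, of f k] f
  unfolding borel_prod served_def offset_dist_def num_between_def fst_conv snd_conv .

lemma borel_measurable_serving_radius [measurable]: "serving_radius n \<in> borel_measurable M"
  unfolding serving_radius_def[abs_def] by measurable

lemma borel_measurable_closer_void [measurable]:
  "(\<lambda>\<omega>. closer_void n \<omega> (serving_radius n \<omega>)) \<in> borel_measurable M"
  unfolding closer_void_def by measurable

lemma measurable_\<rho>_radius [measurable]: "(\<lambda>\<omega>. (\<rho> n \<omega>, serving_radius n \<omega>)) \<in> borel_measurable M"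
  by (intro borel_measurable_Pair) measurable

text \<open>The conditional law in integrated form. The serving event is split by the number of
  lines in between, each part is replaced by its weight with test function \<open>f * q k\<close>,
  and \<open>count_prob_times_suminf_ahead\<close> collapses the sum under the integral.\<close>

lemma nn_integral_q_served:
  assumes f[measurable]: "f \<in> borel_measurable borel"
  shows "(\<integral>\<^sup>+\<omega>. f (offset_dist n \<omega>) * (if served n \<omega> \<and> num_between n \<omega> = k then 1 else 0) \<partial>M)
    = (\<integral>\<^sup>+\<omega>. f (offset_dist n \<omega>) * ennreal (q k (offset_dist n \<omega>)) * (if served n \<omega> then 1 else 0) \<partial>M)"
proof -
  let ?f = "\<lambda>p. f p * ennreal (q k p)"
  let ?X = "\<lambda>\<omega>. (\<rho> n \<omega>, serving_radius n \<omega>)" and ?a = "\<lambda>\<omega>. closer_void n \<omega> (serving_radius n \<omega>)"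
  have sum_count: "(\<Sum>j. if served n \<omega> \<and> num_between n \<omega> = j then 1 else 0) = (if served n \<omega> then 1 else 0 :: ennreal)" for \<omega>
  proof (cases "served n \<omega>")
    case True
    have "(\<Sum>j. if num_between n \<omega> = j then 1 else 0 :: ennreal) = (\<Sum>j\<in>{num_between n \<omega>}. if num_between n \<omega> = j then 1 else 0)"
      by (intro suminf_finite) auto
    then show ?thesis using True by simp
  qed simp
  have "(\<integral>\<^sup>+\<omega>. ?f (offset_dist n \<omega>) * (if served n \<omega> then 1 else 0) \<partial>M)
      = (\<integral>\<^sup>+\<omega>. (\<Sum>j. ?f (offset_dist n \<omega>) * (if served n \<omega> \<and> num_between n \<omega> = j then 1 else 0)) \<partial>M)"
    by (simp add: ennreal_suminf_cmult sum_count)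
  also have "\<dots> = (\<Sum>j. \<integral>\<^sup>+\<omega>. ?f (offset_dist n \<omega>) * (if served n \<omega> \<and> num_between n \<omega> = j then 1 else 0) \<partial>M)"
    by (intro nn_integral_suminf) measurable
  also have "\<dots> = (\<Sum>j. \<integral>\<^sup>+\<omega>. ?f (?X \<omega>) * ?a \<omega> * ennreal (ahead \<mu> lam_v j (\<rho> n \<omega>) (serving_radius n \<omega>)) \<partial>M)"
    by (subst nn_integral_served_count) auto
  also have "\<dots> = (\<integral>\<^sup>+\<omega>. (\<Sum>j. ?f (?X \<omega>) * ?a \<omega> * ennreal (ahead \<mu> lam_v j (\<rho> n \<omega>) (serving_radius n \<omega>))) \<partial>M)"
    by (intro nn_integral_suminf[symmetric]) measurable
  also have "\<dots> = (\<integral>\<^sup>+\<omega>. f (?X \<omega>) * ?a \<omega> * ennreal (ahead \<mu> lam_v k (\<rho> n \<omega>) (serving_radius n \<omega>)) \<partial>M)"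
  proof (rule nn_integral_cong)
    fix \<omega>
    have "(\<Sum>j. ?f (?X \<omega>) * ?a \<omega> * ennreal (ahead \<mu> lam_v j (\<rho> n \<omega>) (serving_radius n \<omega>)))
        = f (?X \<omega>) * ?a \<omega> * (ennreal (count_prob \<mu> lam_v k (\<rho> n \<omega>) (serving_radius n \<omega>)) *
          (\<Sum>j. ennreal (ahead \<mu> lam_v j (\<rho> n \<omega>) (serving_radius n \<omega>))))"
      by (simp add: ennreal_suminf_cmult q_def mult_ac)
    then show "(\<Sum>j. ?f (?X \<omega>) * ?a \<omega> * ennreal (ahead \<mu> lam_v j (\<rho> n \<omega>) (serving_radius n \<omega>)))
        = f (?X \<omega>) * ?a \<omega> * ennreal (ahead \<mu> lam_v k (\<rho> n \<omega>) (serving_radius n \<omega>))"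
      using \<mu>_pos by (simp add: count_prob_times_suminf_ahead)
  qed
  also have "\<dots> = (\<integral>\<^sup>+\<omega>. f (offset_dist n \<omega>) * (if served n \<omega> \<and> num_between n \<omega> = k then 1 else 0) \<partial>M)"
    by (rule nn_integral_served_count[OF f, symmetric])
  finally show ?thesis by simp
qed

text \<open>The weight for \<open>k = 0\<close> never vanishes. If being served near
  \<open>(y, r)\<close> were a null event, the integral of this weight over the ball would be 0, so
  \<open>\<rho> n\<close> and its radius would avoid the ball almost surely, against
  \<open>prob_offset_radius_pos\<close>.\<close>

lemma prob_served_near_pos:
  assumes "0 < y" "y < r" "0 < \<epsilon>"
  shows "0 < prob {\<omega> \<in> space M. served n \<omega> \<and> offset_dist n \<omega> \<in> ball (y, r) \<epsilon>}"
proof (rule ccontr)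
  let ?B = "ball (y, r) \<epsilon>"
  let ?X = "\<lambda>\<omega>. (\<rho> n \<omega>, serving_radius n \<omega>)" and ?a = "\<lambda>\<omega>. closer_void n \<omega> (serving_radius n \<omega>)"
  have B[measurable]: "?B \<in> sets borel" by simp
  assume "\<not> 0 < prob {\<omega> \<in> space M. served n \<omega> \<and> offset_dist n \<omega> \<in> ?B}"
  then have "prob {\<omega> \<in> space M. served n \<omega> \<and> offset_dist n \<omega> \<in> ?B} = 0"
    using measure_nonneg[of M] by (simp add: not_less measure_le_0_iff)
  moreover have "{\<omega> \<in> space M. served n \<omega> \<and> offset_dist n \<omega> \<in> ?B} \<in> events"
    using B by measurable
  ultimately have "AE \<omega> in M. \<not> (served n \<omega> \<and> offset_dist n \<omega> \<in> ?B)"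
    by (subst (asm) prob_eq_0) auto
  then have "(\<integral>\<^sup>+\<omega>. indicator ?B (offset_dist n \<omega>) * (if served n \<omega> \<and> num_between n \<omega> = 0 then 1 else 0) \<partial>M) = (\<integral>\<^sup>+\<omega>. 0 \<partial>M)"
    by (intro nn_integral_cong_AE) (auto elim!: eventually_mono)
  then have "(\<integral>\<^sup>+\<omega>. indicator ?B (?X \<omega>) * ?a \<omega> * ennreal (ahead \<mu> lam_v 0 (\<rho> n \<omega>) (serving_radius n \<omega>)) \<partial>M) = 0"
    using nn_integral_served_count[of "indicator ?B" 0] by simp
  then have "AE \<omega> in M. indicator ?B (?X \<omega>) * ?a \<omega> * ennreal (ahead \<mu> lam_v 0 (\<rho> n \<omega>) (serving_radius n \<omega>)) = 0"
    by (subst (asm) nn_integral_0_iff_AE) auto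
  moreover have "?a \<omega> \<noteq> 0" "ennreal (ahead \<mu> lam_v 0 (\<rho> n \<omega>) (serving_radius n \<omega>)) \<noteq> 0" for \<omega>
    using void_prob_pos[of lam_v] by (simp_all add: closer_void_def ahead_def ennreal_eq_0_iff not_le)
  ultimately have "AE \<omega> in M. ?X \<omega> \<notin> ?B"
    by (auto elim!: eventually_mono simp: indicator_eq_0_iff)
  then have "prob {\<omega> \<in> space M. ?X \<omega> \<in> ?B} = 0"
    by (rule prob_eq_0_AE)
  with prob_offset_radius_pos[OF n assms] show False by simp
qed

end

end

section \<open>The two forms of the conditional distribution\<close>

context cox_lines
begin

context
  fixes n :: nat
  assumes n: "1 \<le> n"
begin

lemma integral_q_served:
  assumes B[measurable]: "B \<in> sets borel"
  shows "prob {\<omega> \<in> space M. served n \<omega> \<and> num_between n \<omega> = k \<and> offset_dist n \<omega> \<in> B}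
    = (\<integral>\<omega>. q k (offset_dist n \<omega>) * indicator {\<omega> \<in> space M. served n \<omega> \<and> offset_dist n \<omega> \<in> B} \<omega> \<partial>M)"
proof -
  note [measurable] = measurable_served[OF n] measurable_offset_dist[OF n] measurable_num_between[OF n]
    borel_measurable_q
  let ?A = "{\<omega> \<in> space M. served n \<omega> \<and> num_between n \<omega> = k \<and> offset_dist n \<omega> \<in> B}"
  let ?D = "{\<omega> \<in> space M. served n \<omega> \<and> offset_dist n \<omega> \<in> B}"
  have [measurable]: "?A \<in> events" "?D \<in> events" using B by measurable
  have "emeasure M ?A = (\<integral>\<^sup>+\<omega>. indicator ?A \<omega> \<partial>M)" by simp
  also have "\<dots> = (\<integral>\<^sup>+\<omega>. indicator B (offset_dist n \<omega>) * (if served n \<omega> \<and> num_between n \<omega> = k then 1 else 0) \<partial>M)"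
    by (intro nn_integral_cong) (auto simp: indicator_def)
  also have "\<dots> = (\<integral>\<^sup>+\<omega>. indicator B (offset_dist n \<omega>) * ennreal (q k (offset_dist n \<omega>)) * (if served n \<omega> then 1 else 0) \<partial>M)"
    by (rule nn_integral_q_served[OF n]) simp
  also have "\<dots> = (\<integral>\<^sup>+\<omega>. ennreal (q k (offset_dist n \<omega>) * indicator ?D \<omega>) \<partial>M)"
    by (intro nn_integral_cong) (simp add: indicator_def)
  finally have "emeasure M ?A = (\<integral>\<^sup>+\<omega>. ennreal (q k (offset_dist n \<omega>) * indicator ?D \<omega>) \<partial>M)" .
  moreover have "(\<integral>\<omega>. q k (offset_dist n \<omega>) * indicator ?D \<omega> \<partial>M)
      = enn2real (\<integral>\<^sup>+\<omega>. ennreal (q k (offset_dist n \<omega>) * indicator ?D \<omega>) \<partial>M)"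
    by (rule integral_eq_nn_integral) (simp_all add: q_nonneg)
  ultimately show ?thesis by (simp add: measure_def)
qed

lemma served_events: "{\<omega> \<in> space M. served n \<omega>} \<in> events"
  using measurable_served[OF n] unfolding pred_def .

lemma prob_served_pos: "0 < prob {\<omega> \<in> space M. served n \<omega>}"
proof -
  \<comment> \<open>A sample point with \<open>0 < y < r\<close>; any other would do.\<close>
  have "0 < prob {\<omega> \<in> space M. served n \<omega> \<and> offset_dist n \<omega> \<in> ball (1, 2) 1}"
    by (rule prob_served_near_pos[OF n]) auto
  also have "\<dots> \<le> prob {\<omega> \<in> space M. served n \<omega>}"
    by (intro finite_measure_mono served_events) auto
  finally show ?thesis .
qed

lemma integral_uniform_served:
  assumes [measurable]: "g \<in> borel_measurable M" and "\<And>\<omega>. 0 \<le> g \<omega>"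
  shows "(\<integral>\<omega>. g \<omega> \<partial>uniform_measure M {\<omega> \<in> space M. served n \<omega>})
    = (\<integral>\<omega>. g \<omega> * indicator {\<omega> \<in> space M. served n \<omega>} \<omega> \<partial>M) / prob {\<omega> \<in> space M. served n \<omega>}"
proof -
  let ?E = "{\<omega> \<in> space M. served n \<omega>}"
  note [measurable] = served_events
  have "(\<integral>\<omega>. g \<omega> \<partial>uniform_measure M ?E) = enn2real (\<integral>\<^sup>+\<omega>. ennreal (g \<omega>) \<partial>uniform_measure M ?E)"
    using assms by (intro integral_eq_nn_integral) auto
  also have "(\<integral>\<^sup>+\<omega>. ennreal (g \<omega>) \<partial>uniform_measure M ?E) = (\<integral>\<^sup>+\<omega>. ennreal (g \<omega>) * indicator ?E \<omega> \<partial>M) / emeasure M ?E"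
    by (rule nn_integral_uniform_measure) measurable
  also have "(\<integral>\<^sup>+\<omega>. ennreal (g \<omega>) * indicator ?E \<omega> \<partial>M) = (\<integral>\<^sup>+\<omega>. ennreal (g \<omega> * indicator ?E \<omega>) \<partial>M)"
    by (intro nn_integral_cong) (simp add: indicator_def)
  also have "enn2real ((\<integral>\<^sup>+\<omega>. ennreal (g \<omega> * indicator ?E \<omega>) \<partial>M) / emeasure M ?E)
      = enn2real (\<integral>\<^sup>+\<omega>. ennreal (g \<omega> * indicator ?E \<omega>) \<partial>M) / prob ?E"
    using prob_served_pos
    by (simp add: divide_ennreal_def emeasure_eq_measure inverse_ennreal enn2real_mult divide_inverse)
  also have "enn2real (\<integral>\<^sup>+\<omega>. ennreal (g \<omega> * indicator ?E \<omega>) \<partial>M) = (\<integral>\<omega>. g \<omega> * indicator ?E \<omega> \<partial>M)"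
    using assms by (intro integral_eq_nn_integral[symmetric]) auto
  finally show ?thesis .
qed

text \<open>The conditioning events are preimages of Borel sets under \<open>offset_dist n\<close>.
  On each of them \<open>integral_q_served\<close> is the defining equation of the conditional
  expectation, up to division by the probability of being served.\<close>

lemma cond_exp_num_between:
  "AE \<omega> in uniform_measure M {\<omega> \<in> space M. served n \<omega>}.
    real_cond_exp (uniform_measure M {\<omega> \<in> space M. served n \<omega>}) (vimage_algebra (space M) (offset_dist n) borel)
      (indicator {\<omega> \<in> space M. num_between n \<omega> = k}) \<omega> = q k (offset_dist n \<omega>)"
proof -
  let ?E = "{\<omega> \<in> space M. served n \<omega>}" and ?V = "vimage_algebra (space M) (offset_dist n) borel"
  let ?K = "{\<omega> \<in> space M. num_between n \<omega> = k}"
  note [measurable] = measurable_served[OF n] measurable_offset_dist[OF n] measurable_num_between[OF n]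
    borel_measurable_q
  have E_pos: "emeasure M ?E \<noteq> 0"
    using prob_served_pos by (simp add: emeasure_eq_measure)
  interpret U: prob_space "uniform_measure M ?E"
    by (rule prob_space_uniform_measure[OF E_pos]) (simp add: emeasure_eq_measure)
  have V_sets: "sets ?V \<subseteq> events"
    using measurable_sets[OF measurable_offset_dist[OF n]] by (auto simp: sets_vimage_algebra2)
  have "subalgebra (uniform_measure M ?E) ?V"
    using V_sets by (simp add: subalgebra_def)
  then interpret U: finite_measure_subalgebra "uniform_measure M ?E" ?V
    by unfold_locales
  have V_meas: "offset_dist n \<in> borel_measurable ?V"
    by (rule measurable_vimage_algebra1) simp
  have q_V: "(\<lambda>\<omega>. q k (offset_dist n \<omega>)) \<in> borel_measurable ?V"
    by (rule measurable_compose[OF V_meas borel_measurable_q])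
  show ?thesis
  proof (rule U.real_cond_exp_charact[OF _ _ _ q_V])
    fix A assume "A \<in> sets ?V"
    then obtain B where B[measurable]: "B \<in> sets borel" and A: "A = offset_dist n -` B \<inter> space M"
      by (auto simp: sets_vimage_algebra2)
    have [measurable]: "A \<in> events" unfolding A by measurable
    have "(LINT \<omega>:A|uniform_measure M ?E. indicator ?K \<omega> :: real)
        = (\<integral>\<omega>. indicator A \<omega> * indicator ?K \<omega> * indicator ?E \<omega> \<partial>M) / prob ?E"
      unfolding set_lebesgue_integral_def by (subst integral_uniform_served) auto
    also have "(\<integral>\<omega>. indicator A \<omega> * indicator ?K \<omega> * indicator ?E \<omega> \<partial>M)
        = (\<integral>\<omega>. indicator {\<omega> \<in> space M. served n \<omega> \<and> num_between n \<omega> = k \<and> offset_dist n \<omega> \<in> B} \<omega> \<partial>M :: real)"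
      by (intro Bochner_Integration.integral_cong) (auto simp: A indicator_def)
    also have "\<dots> = prob {\<omega> \<in> space M. served n \<omega> \<and> num_between n \<omega> = k \<and> offset_dist n \<omega> \<in> B}"
      by (simp add: Int_def conj_ac)
    also have "\<dots> = (\<integral>\<omega>. q k (offset_dist n \<omega>) * indicator {\<omega> \<in> space M. served n \<omega> \<and> offset_dist n \<omega> \<in> B} \<omega> \<partial>M)"
      by (rule integral_q_served[OF B])
    also have "\<dots> = (\<integral>\<omega>. (indicator A \<omega> * q k (offset_dist n \<omega>)) * indicator ?E \<omega> \<partial>M)"
      by (intro Bochner_Integration.integral_cong) (auto simp: A indicator_def)
    also have "\<dots> / prob ?E = (LINT \<omega>:A|uniform_measure M ?E. q k (offset_dist n \<omega>))"
      unfolding set_lebesgue_integral_def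
      by (subst integral_uniform_served) (auto simp: q_nonneg)
    finally show "(LINT \<omega>:A|uniform_measure M ?E. indicator ?K \<omega> :: real)
        = (LINT \<omega>:A|uniform_measure M ?E. q k (offset_dist n \<omega>))" .
  next
    show "integrable (uniform_measure M ?E) (indicator ?K :: 'w \<Rightarrow> real)"
      by (rule U.integrable_const_bound[where B = 1]) (auto simp: indicator_def)
    show "integrable (uniform_measure M ?E) (\<lambda>\<omega>. q k (offset_dist n \<omega>))"
      by (rule U.integrable_const_bound[where B = 1]) (auto simp: q_nonneg q_le_1)
  qed
qed

lemma isCont_q:
  assumes "0 < fst p"
  shows "isCont (q k) p"
proof -
  have "open {p :: real \<times> real. 0 < fst p}"
    by (intro open_Collect_less continuous_intros)
  moreover have "continuous_on {p. 0 < fst p} (q k)"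
    unfolding q_def[abs_def] count_prob_def
    using continuous_on_void_mass[OF less_imp_le[OF lam_v_pos]] by (intro continuous_intros) auto
  ultimately show ?thesis
    using assms by (cases p) (auto simp: continuous_on_eq_continuous_at)
qed

text \<open>The conditional probability is the average of \<open>q k\<close> over the event of being
  served within the ball, which has positive probability; continuity of \<open>q k\<close> keeps the
  average close to the value at the centre.\<close>

lemma cond_prob_num_between_tendsto:
  assumes "0 < y" "y < r"
  shows "((\<lambda>\<epsilon>. \<P>(\<omega> in M. num_between n \<omega> = k \<bar> served n \<omega> \<and> dist (offset_dist n \<omega>) (y, r) < \<epsilon>))
    \<longlongrightarrow> q k (y, r)) (at_right 0)"
  unfolding tendsto_iff
proof (intro allI impI)
  fix e :: real assume "0 < e"
  note [measurable] = measurable_served[OF n] measurable_offset_dist[OF n] measurable_num_between[OF n]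
    borel_measurable_q
  have "isCont (q k) (y, r)" using assms by (intro isCont_q) simp
  then obtain d where d: "0 < d" "\<And>p. dist p (y, r) < d \<Longrightarrow> dist (q k p) (q k (y, r)) < e / 2"
    using \<open>0 < e\<close> half_gt_zero unfolding continuous_at_eps_delta by blast
  have close: "dist (\<P>(\<omega> in M. num_between n \<omega> = k \<bar> served n \<omega> \<and> dist (offset_dist n \<omega>) (y, r) < \<epsilon>)) (q k (y, r)) < e"
    if "0 < \<epsilon>" "\<epsilon> < d" for \<epsilon>
  proof -
    define D where "D = {\<omega> \<in> space M. served n \<omega> \<and> offset_dist n \<omega> \<in> ball (y, r) \<epsilon>}"
    have B[measurable]: "ball (y, r) \<epsilon> \<in> sets borel" by simp
    have D[measurable]: "D \<in> events" unfolding D_def using B by measurable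
    have pos: "0 < prob D"
      unfolding D_def by (rule prob_served_near_pos[OF n assms \<open>0 < \<epsilon>\<close>])
    have intq: "integrable M (\<lambda>\<omega>. q k (offset_dist n \<omega>) * indicator D \<omega>)"
      by (rule integrable_const_bound[where B = 1]) (auto simp: q_nonneg q_le_1 indicator_def)
    have intc: "integrable M (\<lambda>\<omega>. c * indicator D \<omega>)" for c :: real
      by (intro integrable_mult_right integrable_real_indicator) (auto simp: emeasure_eq_measure)
    \<comment> \<open>The comparison is made before dividing by \<open>prob D\<close>: on
      \<open>D\<close> the integrands differ by less than \<open>e / 2\<close>, and off
      \<open>D\<close> both vanish.\<close>
    have "(\<integral>\<omega>. q k (offset_dist n \<omega>) * indicator D \<omega> \<partial>M) - q k (y, r) * prob D
        = (\<integral>\<omega>. q k (offset_dist n \<omega>) * indicator D \<omega> - q k (y, r) * indicator D \<omega> \<partial>M)"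
      by (subst Bochner_Integration.integral_diff[OF intq intc]) simp
    also have "\<bar>\<dots>\<bar> \<le> (\<integral>\<omega>. e / 2 * indicator D \<omega> \<partial>M)"
    proof (rule integral_abs_bound[THEN order_trans], rule integral_mono)
      show "integrable M (\<lambda>\<omega>. \<bar>q k (offset_dist n \<omega>) * indicator D \<omega> - q k (y, r) * indicator D \<omega>\<bar>)"
        by (intro integrable_abs Bochner_Integration.integrable_diff intq intc)
      fix \<omega>
      show "\<bar>q k (offset_dist n \<omega>) * indicator D \<omega> - q k (y, r) * indicator D \<omega>\<bar> \<le> e / 2 * indicator D \<omega>"
        using d(2)[of "offset_dist n \<omega>"] \<open>\<epsilon> < d\<close> by (auto simp: D_def indicator_def dist_real_def dist_commute)
    qed (rule intc)
    also have "\<dots> = e / 2 * prob D" by simp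
    finally have bound: "\<bar>(\<integral>\<omega>. q k (offset_dist n \<omega>) * indicator D \<omega> \<partial>M) - q k (y, r) * prob D\<bar> \<le> e / 2 * prob D" .
    have cond: "\<P>(\<omega> in M. num_between n \<omega> = k \<bar> served n \<omega> \<and> dist (offset_dist n \<omega>) (y, r) < \<epsilon>)
        = (\<integral>\<omega>. q k (offset_dist n \<omega>) * indicator D \<omega> \<partial>M) / prob D"
    proof -
      have "{\<omega> \<in> space M. num_between n \<omega> = k \<and> served n \<omega> \<and> dist (offset_dist n \<omega>) (y, r) < \<epsilon>}
          = {\<omega> \<in> space M. served n \<omega> \<and> num_between n \<omega> = k \<and> offset_dist n \<omega> \<in> ball (y, r) \<epsilon>}"
        and "{\<omega> \<in> space M. served n \<omega> \<and> dist (offset_dist n \<omega>) (y, r) < \<epsilon>} = D"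
        unfolding D_def mem_ball by (auto simp: dist_commute)
      then show ?thesis
        unfolding cond_prob_def D_def by (simp only: integral_q_served[OF B])
    qed
    then have "dist (\<P>(\<omega> in M. num_between n \<omega> = k \<bar> served n \<omega> \<and> dist (offset_dist n \<omega>) (y, r) < \<epsilon>)) (q k (y, r))
        = \<bar>(\<integral>\<omega>. q k (offset_dist n \<omega>) * indicator D \<omega> \<partial>M) - q k (y, r) * prob D\<bar> / prob D"
    proof -
      have "a / prob D - c = (a - c * prob D) / prob D" for a c
        using pos by (simp add: diff_divide_distrib)
      then show ?thesis
        by (simp only: cond dist_real_def abs_divide abs_of_pos[OF pos])
    qed
    also have "\<dots> \<le> e / 2"
      using bound pos by (simp add: divide_le_eq)
    also have "\<dots> < e" using \<open>0 < e\<close> by simp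
    finally show ?thesis .
  qed
  show "\<forall>\<^sub>F \<epsilon> in at_right 0. dist (\<P>(\<omega> in M. num_between n \<omega> = k \<bar> served n \<omega> \<and>
      dist (offset_dist n \<omega>) (y, r) < \<epsilon>)) (q k (y, r)) < e"
    using eventually_at_right_real[OF d(1)] by (rule eventually_mono) (use close in auto)
qed

end

end

theorem lemma10:
  fixes M :: "'w measure"
    and lam_l lam_v \<theta>\<^sub>0 :: real
    and \<Phi> :: "'w \<Rightarrow> (real \<times> real) set"
    and \<Psi> :: "'w \<Rightarrow> nat \<Rightarrow> real set"
    and n :: nat
  assumes "prob_space M"
    and "lam_l > 0" and "lam_v > 0"
    and "homogeneous_PPP M lam_l ({0..<2 * pi} \<times> {0..}) \<Phi>"
    and "\<And>i. homogeneous_PPP M lam_v UNIV (\<lambda>\<omega>. \<Psi> \<omega> i)"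
    and "prob_space.indep_vars M (\<lambda>_. configs) (\<lambda>i \<omega>. \<Psi> \<omega> i) UNIV"
    and "prob_space.indep_set M
           (sets (vimage_algebra (space M) \<Phi> configs))
           (sets (vimage_algebra (space M) \<Psi> (PiM UNIV (\<lambda>_. configs))))"
    and "n \<ge> 1"
  defines "E \<equiv> {\<omega> \<in> space M. served_by_line \<theta>\<^sub>0 (\<Phi> \<omega>) (\<Psi> \<omega>) n}"
    and "Yn \<equiv> \<lambda>\<omega>. Y (\<Phi> \<omega>) n"
    and "R \<equiv> \<lambda>\<omega>. serving_dist \<theta>\<^sub>0 (\<Phi> \<omega>) (\<Psi> \<omega>)"
    and "N \<equiv> \<lambda>\<omega>. num_lines (\<Phi> \<omega>) (Y (\<Phi> \<omega>) n) (serving_dist \<theta>\<^sub>0 (\<Phi> \<omega>) (\<Psi> \<omega>))"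
    and "m \<equiv> \<lambda>y r. 2 * pi * lam_l * (LBINT u:{y..r}. exp (- 2 * lam_v * sqrt (r\<^sup>2 - u\<^sup>2)))"
  shows
    \<comment> \<open>a version of the conditional distribution of \<open>N\<close> given the pair \<open>(Yn, R)\<close> under \<open>P(\<cdot> | E)\<close> \<dots>\<close>
    "(\<forall>k. AE \<omega> in uniform_measure M E.
        real_cond_exp (uniform_measure M E)
          (vimage_algebra (space M) (\<lambda>\<omega>. (Yn \<omega>, R \<omega>)) borel)
          (indicator {\<omega> \<in> space M. N \<omega> = k}) \<omega>
        = exp (- m (Yn \<omega>) (R \<omega>)) * m (Yn \<omega>) (R \<omega>) ^ k / fact k) \<and>
    \<comment> \<open>\<dots> and its value at every single point \<open>(y, r)\<close>\<close>
    (\<forall>k y r. 0 < y \<and> y < r \<longrightarrow>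
        ((\<lambda>\<epsilon>. \<P>(\<omega> in M. N \<omega> = k \<bar> \<omega> \<in> E \<and> dist (Yn \<omega>, R \<omega>) (y, r) < \<epsilon>))
          \<longlongrightarrow> exp (- m y r) * m y r ^ k / fact k) (at_right 0))"
proof -
  interpret prob_space M by fact
  interpret cox_lines M \<Phi> lam_l \<Psi> lam_v \<theta>\<^sub>0
    by unfold_locales (fact assms)+
  have n: "1 \<le> n" by fact
  have q: "q k (y, r) = exp (- m y r) * m y r ^ k / fact k" for k y r
    by (simp add: q_def count_prob_def void_mass_def void_prob_def \<mu>_def m_def)
  have E: "E = {\<omega> \<in> space M. served n \<omega>}"
    by (simp add: E_def served_def)
  have pair: "(Yn \<omega>, R \<omega>) = offset_dist n \<omega>" for \<omega>
    by (simp add: Yn_def R_def offset_dist_def)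
  have N: "N \<omega> = num_between n \<omega>" for \<omega>
    by (simp add: N_def num_between_def offset_dist_def)
  have "AE \<omega> in uniform_measure M E. real_cond_exp (uniform_measure M E)
      (vimage_algebra (space M) (\<lambda>\<omega>. (Yn \<omega>, R \<omega>)) borel) (indicator {\<omega> \<in> space M. N \<omega> = k}) \<omega>
      = exp (- m (Yn \<omega>) (R \<omega>)) * m (Yn \<omega>) (R \<omega>) ^ k / fact k" for k
    using cond_exp_num_between[OF n, of k] unfolding q[symmetric] pair N E .
  moreover have "((\<lambda>\<epsilon>. \<P>(\<omega> in M. N \<omega> = k \<bar> \<omega> \<in> E \<and> dist (Yn \<omega>, R \<omega>) (y, r) < \<epsilon>))
      \<longlongrightarrow> exp (- m y r) * m y r ^ k / fact k) (at_right 0)" if "0 < y" "y < r" for k y r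
  proof -
    have "\<P>(\<omega> in M. N \<omega> = k \<bar> \<omega> \<in> E \<and> dist (Yn \<omega>, R \<omega>) (y, r) < \<epsilon>)
        = \<P>(\<omega> in M. num_between n \<omega> = k \<bar> served n \<omega> \<and> dist (offset_dist n \<omega>) (y, r) < \<epsilon>)" for \<epsilon>
      unfolding cond_prob_def N pair E by (auto intro!: arg_cong2[where f = "(/)"] arg_cong[where f = prob])
    then show ?thesis
      using cond_prob_num_between_tendsto[OF n that, of k] unfolding q by simp
  qed
  ultimately show ?thesis by blast
qed

end
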